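(* Let $K$ be a finite-dimensional, locally finite CAT(0) cubical complex. There exists a uniform embedding $f$ of $K$ into a Hilbert space $\mathcal{H}$ with compression $$\rho_f(t)\succeq\frac{t}{\sqrt{\ln t}\cdot\ln\ln t}.$$
   Context: Let $(X,d_X)$ be a metric space and $\mathcal{H}$ a Hilbert space, with $d_{\mathcal{H}}$ the metric given by the norm. A map $f\colon X\to\mathcal{H}$ is a uniform embedding if there exist non-decreasing functions $\rho,\delta\colon\mathbb{R}_+\to\mathbb{R}_+$ such that (1) $\rho(d_X(x,y))\le d_{\mathcal{H}}(f(x),f(y))\le\delta(d_X(x,y))$ for all $x,y\in X$, and (2) $\lim_{t\to+\infty}\rho(t)=+\infty$. The compression of $f$ is the function $\rho_f(t)=\inf\{d_{\mathcal{H}}(f(x),f(y)) \mid d_X(x,y)\ge t\}$ (with $\inf\emptyset=+\infty$). For functions $g,h$ of a positive real variable (defined for all sufficiently large $t$), $g\preceq h$ (equivalently $h\succeq g$) means that there exist numbers $C>0$ and $M$ such that $g(t)\le C\,h(t)$ for all $t\ge M$. A cubical complex is a polyhedral complex with geodesic metric in which each cell is isometric to a Euclidean unit cube $[0,1]^n$ for some $n$ and the gluing maps are isometries. It is a CAT(0) cubical complex if this geodesic metric is CAT(0); $K$ is regarded as a metric space with this metric. *)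

theory Defs
  imports "HOL-Analysis.Analysis"
begin

section \<open>The Hilbert spaces of square-summable families\<close>

text \<open>For a map from a set \<open>X\<close> of elements of type \<open>'a\<close> to any Hilbert space, the closed span of the
  image has an orthonormal basis of cardinality at most that of \<open>X\<close>, hence embeds isometrically
  in \<open>'a ell2\<close>.  So \<open>'a ell2\<close> can stand in for an existentially quantified target Hilbert space.\<close>

typedef 'i ell2 = "{f :: 'i \<Rightarrow> real. (\<lambda>i. (f i)\<^sup>2) summable_on UNIV}"
  morphisms coord Abs_ell2
  by (rule exI [of _ "\<lambda>_. 0"]) simp

setup_lifting type_definition_ell2

lemma square_summable_mult:
  fixes f g :: "'i \<Rightarrow> real"
  assumes "(\<lambda>i. (f i)\<^sup>2) summable_on UNIV" "(\<lambda>i. (g i)\<^sup>2) summable_on UNIV"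
  shows "(\<lambda>i. f i * g i) summable_on UNIV"
proof -
  have "(\<lambda>i. (f i)\<^sup>2 + (g i)\<^sup>2) summable_on UNIV"
    by (rule summable_on_add [OF assms])
  then have "(\<lambda>i. norm (f i * g i)) summable_on UNIV"
  proof (rule Infinite_Sum.abs_summable_on_comparison_test')
    fix i
    have "2 * \<bar>f i * g i\<bar> \<le> (f i)\<^sup>2 + (g i)\<^sup>2"
      using sum_squares_bound [of "\<bar>f i\<bar>" "\<bar>g i\<bar>"] by (simp add: abs_mult)
    then show "norm (f i * g i) \<le> (f i)\<^sup>2 + (g i)\<^sup>2"
      by simp
  qed
  then show ?thesis
    using summable_on_iff_abs_summable_on_real by blast
qed

lemma square_summable_add:
  fixes f g :: "'i \<Rightarrow> real"
  assumes "(\<lambda>i. (f i)\<^sup>2) summable_on UNIV" "(\<lambda>i. (g i)\<^sup>2) summable_on UNIV"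
  shows "(\<lambda>i. (f i + g i)\<^sup>2) summable_on UNIV"
proof -
  have "(\<lambda>i. (f i)\<^sup>2 + (g i)\<^sup>2 + 2 * (f i * g i)) summable_on UNIV"
    by (intro summable_on_add summable_on_cmult_right assms square_summable_mult)
  then show ?thesis
    by (simp add: power2_sum mult.assoc)
qed

lemma coord_square_summable: "(\<lambda>i. (coord x i)\<^sup>2) summable_on UNIV"
  using coord [of x] by simp

lemma coord_mult_summable: "(\<lambda>i. coord x i * coord y i) summable_on UNIV"
  by (intro square_summable_mult coord_square_summable)

instantiation ell2 :: (type) real_vector
begin

lift_definition zero_ell2 :: "'a ell2" is "\<lambda>_. 0" by simp

lift_definition uminus_ell2 :: "'a ell2 \<Rightarrow> 'a ell2" is "\<lambda>f i. - f i" by simp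

lift_definition plus_ell2 :: "'a ell2 \<Rightarrow> 'a ell2 \<Rightarrow> 'a ell2" is "\<lambda>f g i. f i + g i"
  by (rule square_summable_add)

lift_definition minus_ell2 :: "'a ell2 \<Rightarrow> 'a ell2 \<Rightarrow> 'a ell2" is "\<lambda>f g i. f i - g i"
  subgoal for f g using square_summable_add [of f "\<lambda>i. - g i"] by simp
  done

lift_definition scaleR_ell2 :: "real \<Rightarrow> 'a ell2 \<Rightarrow> 'a ell2" is "\<lambda>r f i. r * f i"
  by (simp add: power_mult_distrib summable_on_cmult_right)

instance
proof
  fix x y z :: "'a ell2" and a b :: real
  show "x + y + z = x + (y + z)" by transfer (simp add: add.assoc)
  show "x + y = y + x" by transfer (simp add: add.commute)
  show "0 + x = x" by transfer simp
  show "- x + x = 0" by transfer simp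
  show "x - y = x + - y" by transfer simp
  show "a *\<^sub>R (x + y) = a *\<^sub>R x + a *\<^sub>R y" by transfer (simp add: algebra_simps)
  show "(a + b) *\<^sub>R x = a *\<^sub>R x + b *\<^sub>R x" by transfer (simp add: algebra_simps)
  show "a *\<^sub>R b *\<^sub>R x = (a * b) *\<^sub>R x" by transfer (simp add: algebra_simps)
  show "1 *\<^sub>R x = x" by transfer simp
qed

end

instantiation ell2 :: (type) real_inner
begin

definition inner_ell2 :: "'a ell2 \<Rightarrow> 'a ell2 \<Rightarrow> real"
  where "inner_ell2 x y = (\<Sum>\<^sub>\<infinity>i. coord x i * coord y i)"

definition norm_ell2 :: "'a ell2 \<Rightarrow> real"
  where "norm_ell2 x = sqrt (inner x x)"

definition sgn_ell2 :: "'a ell2 \<Rightarrow> 'a ell2"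
  where "sgn_ell2 x = x /\<^sub>R norm x"

definition dist_ell2 :: "'a ell2 \<Rightarrow> 'a ell2 \<Rightarrow> real"
  where "dist_ell2 x y = norm (x - y)"

definition uniformity_ell2 :: "('a ell2 \<times> 'a ell2) filter"
  where "uniformity_ell2 = (INF e\<in>{0<..}. principal {(x, y). dist x y < e})"

definition open_ell2 :: "'a ell2 set \<Rightarrow> bool"
  where "open_ell2 U \<longleftrightarrow> (\<forall>x\<in>U. eventually (\<lambda>(x', y). x' = x \<longrightarrow> y \<in> U) uniformity)"

instance
proof
  fix x y z :: "'a ell2" and r :: real
  show "sgn x = x /\<^sub>R norm x" by (rule sgn_ell2_def)
  show "dist x y = norm (x - y)" by (rule dist_ell2_def)
  show "uniformity = (INF e\<in>{0<..}. principal {(x::'a ell2, y). dist x y < e})"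
    by (rule uniformity_ell2_def)
  show "open U \<longleftrightarrow> (\<forall>x\<in>U. eventually (\<lambda>(x', y). x' = x \<longrightarrow> y \<in> U) uniformity)"
    for U :: "'a ell2 set" by (rule open_ell2_def)
  show "inner x y = inner y x"
    by (simp add: inner_ell2_def mult.commute)
  show "inner (x + y) z = inner x z + inner y z"
    by (simp add: inner_ell2_def plus_ell2.rep_eq distrib_right infsum_add coord_mult_summable)
  show "inner (r *\<^sub>R x) y = r * inner x y"
    by (simp add: inner_ell2_def scaleR_ell2.rep_eq mult.assoc infsum_cmult_right')
  show "0 \<le> inner x x"
    by (simp add: inner_ell2_def infsum_nonneg)
  show "inner x x = 0 \<longleftrightarrow> x = 0"
  proof
    assume "inner x x = 0"
    then have "coord x i * coord x i = 0" for i
      using nonneg_infsum_le_0D [OF _ coord_mult_summable [of x x], of i]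
      by (simp add: inner_ell2_def)
    then show "x = 0"
      by transfer auto
  next
    assume "x = 0"
    then show "inner x x = 0"
      by (simp add: inner_ell2_def zero_ell2.rep_eq)
  qed
  show "norm x = sqrt (inner x x)" by (rule norm_ell2_def)
qed

end

lemma norm_ell2_square: "(norm x)\<^sup>2 = (\<Sum>\<^sub>\<infinity>i. (coord x i)\<^sup>2)"
  unfolding power2_norm_eq_inner inner_ell2_def by (simp add: power2_eq_square)

lemma finite_sum_coord_le_norm:
  assumes "finite F"
  shows "(\<Sum>i\<in>F. (coord x i)\<^sup>2) \<le> (norm x)\<^sup>2"
  unfolding norm_ell2_square
  by (rule finite_sum_le_infsum [OF coord_square_summable assms]) auto

lemma coord_le_norm: "\<bar>coord x i\<bar> \<le> norm x"
  using finite_sum_coord_le_norm [of "{i}" x] abs_le_square_iff [of "coord x i" "norm x"]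
  by simp

lemma coord_diff: "coord (x - y) i = coord x i - coord y i"
  by (simp add: minus_ell2.rep_eq)

instance ell2 :: (type) complete_space
proof
  fix X :: "nat \<Rightarrow> 'a ell2"
  assume X: "Cauchy X"
  have "Cauchy (\<lambda>n. coord (X n) i)" for i
  proof (rule metric_CauchyI)
    fix e :: real assume "0 < e"
    then obtain N where N: "\<forall>m\<ge>N. \<forall>n\<ge>N. dist (X m) (X n) < e"
      using metric_CauchyD [OF X] by blast
    have "dist (coord (X m) i) (coord (X n) i) < e" if "m \<ge> N" "n \<ge> N" for m n
    proof -
      have "norm (X m - X n) < e"
        using N that by (simp add: dist_norm)
      then show ?thesis
        using coord_le_norm [of "X m - X n" i] by (simp add: dist_real_def coord_diff)
    qed
    then show "\<exists>N. \<forall>m\<ge>N. \<forall>n\<ge>N. dist (coord (X m) i) (coord (X n) i) < e"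
      by blast
  qed
  then have "\<forall>i. \<exists>l. (\<lambda>n. coord (X n) i) \<longlonglongrightarrow> l"
    using Cauchy_convergent convergent_def by blast
  then obtain f where f: "(\<lambda>n. coord (X n) i) \<longlonglongrightarrow> f i" for i
    by metis
  have fin: "\<exists>N. \<forall>m\<ge>N. \<forall>F. finite F \<longrightarrow> (\<Sum>i\<in>F. (coord (X m) i - f i)\<^sup>2) \<le> e\<^sup>2"
    if e: "0 < e" for e :: real
  proof -
    obtain N where N: "\<forall>m\<ge>N. \<forall>n\<ge>N. dist (X m) (X n) < e"
      using metric_CauchyD [OF X e] by blast
    have "(\<Sum>i\<in>F. (coord (X m) i - f i)\<^sup>2) \<le> e\<^sup>2" if "m \<ge> N" "finite F" for m F
    proof (rule LIMSEQ_le_const2)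
      show "(\<lambda>n. \<Sum>i\<in>F. (coord (X m) i - coord (X n) i)\<^sup>2)
              \<longlonglongrightarrow> (\<Sum>i\<in>F. (coord (X m) i - f i)\<^sup>2)"
        by (intro tendsto_intros f)
      have "(\<Sum>i\<in>F. (coord (X m) i - coord (X n) i)\<^sup>2) \<le> e\<^sup>2" if "n \<ge> N" for n
      proof -
        have "(\<Sum>i\<in>F. (coord (X m) i - coord (X n) i)\<^sup>2) \<le> (norm (X m - X n))\<^sup>2"
          using finite_sum_coord_le_norm [OF \<open>finite F\<close>, of "X m - X n"]
          by (simp add: coord_diff)
        also have "\<dots> \<le> e\<^sup>2"
          using N \<open>m \<ge> N\<close> that by (intro power_mono) (simp_all add: dist_norm less_imp_le)
        finally show ?thesis .
      qed
      then show "\<exists>N. \<forall>n\<ge>N. (\<Sum>i\<in>F. (coord (X m) i - coord (X n) i)\<^sup>2) \<le> e\<^sup>2"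
        by blast
    qed
    then show ?thesis by blast
  qed
  obtain N where N: "\<forall>m\<ge>N. \<forall>F. finite F \<longrightarrow> (\<Sum>i\<in>F. (coord (X m) i - f i)\<^sup>2) \<le> 1\<^sup>2"
    using fin [of 1] by auto
  have "(\<lambda>i. (coord (X N) i - f i)\<^sup>2) summable_on UNIV"
    by (rule nonneg_bdd_above_summable_on) (use N in \<open>auto intro: bdd_aboveI2 [where M = 1]\<close>)
  then have "(\<lambda>i. (- (coord (X N) i - f i))\<^sup>2) summable_on UNIV"
    by (simp only: power2_minus)
  with coord_square_summable have "(\<lambda>i. (coord (X N) i + - (coord (X N) i - f i))\<^sup>2) summable_on UNIV"
    by (rule square_summable_add)
  then have sf: "(\<lambda>i. (f i)\<^sup>2) summable_on UNIV"
    by simp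
  define L where "L = Abs_ell2 f"
  have L: "coord L = f"
    using sf by (simp add: L_def Abs_ell2_inverse)
  have "X \<longlonglongrightarrow> L"
  proof (rule metric_LIMSEQ_I)
    fix e :: real assume "0 < e"
    then obtain N where N:
      "\<forall>m\<ge>N. \<forall>F. finite F \<longrightarrow> (\<Sum>i\<in>F. (coord (X m) i - f i)\<^sup>2) \<le> (e/2)\<^sup>2"
      using fin [of "e/2"] by auto
    have "dist (X m) L < e" if "m \<ge> N" for m
    proof -
      have "(norm (X m - L))\<^sup>2 \<le> (e/2)\<^sup>2"
        unfolding norm_ell2_square
        by (rule infsum_le_finite_sums [OF coord_square_summable])
          (use N that in \<open>auto simp: coord_diff L\<close>)
      then have "norm (X m - L) \<le> e/2"
        by (rule power2_le_imp_le) (use \<open>0 < e\<close> in simp)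
      then show ?thesis
        using \<open>0 < e\<close> by (simp add: dist_norm)
    qed
    then show "\<exists>N. \<forall>m\<ge>N. dist (X m) L < e" by blast
  qed
  then show "convergent X"
    by (auto simp: convergent_def)
qed


section \<open>CAT(0) spaces\<close>

definition geodesic_segment :: "'a set \<Rightarrow> ('a \<Rightarrow> 'a \<Rightarrow> real) \<Rightarrow> 'a \<Rightarrow> 'a \<Rightarrow> 'a set \<Rightarrow> bool"
  where "geodesic_segment M d x y S \<longleftrightarrow>
    (\<exists>\<gamma> :: real \<Rightarrow> 'a. \<gamma> 0 = x \<and> \<gamma> (d x y) = y \<and> \<gamma> ` {0..d x y} = S \<and> S \<subseteq> M \<and>
      (\<forall>s\<in>{0..d x y}. \<forall>t\<in>{0..d x y}. d (\<gamma> s) (\<gamma> t) = \<bar>s - t\<bar>))"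

definition geodesic_space :: "'a set \<Rightarrow> ('a \<Rightarrow> 'a \<Rightarrow> real) \<Rightarrow> bool"
  where "geodesic_space M d \<longleftrightarrow>
    Metric_space M d \<and> (\<forall>x\<in>M. \<forall>y\<in>M. \<exists>S. geodesic_segment M d x y S)"

definition comparison_point ::
  "('a \<Rightarrow> 'a \<Rightarrow> real) \<Rightarrow> 'a \<Rightarrow> 'a set \<Rightarrow> real^2 \<Rightarrow> real^2 \<Rightarrow> 'a \<Rightarrow> real^2 \<Rightarrow> bool"
  where "comparison_point d p S p' q' x x' \<longleftrightarrow>
    x \<in> S \<and> x' \<in> closed_segment p' q' \<and> dist p' x' = d p x"

text \<open>The geodesic triangle has vertices \<open>p, q, r\<close> and sides \<open>A = [p,q]\<close>, \<open>B = [q,r]\<close>,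
  \<open>C = [r,p]\<close>; \<open>p', q', r'\<close> are the vertices of a comparison triangle in the Euclidean plane.\<close>

definition CAT0_space :: "'a set \<Rightarrow> ('a \<Rightarrow> 'a \<Rightarrow> real) \<Rightarrow> bool"
  where "CAT0_space M d \<longleftrightarrow> geodesic_space M d \<and>
    (\<forall>p\<in>M. \<forall>q\<in>M. \<forall>r\<in>M. \<forall>A B C. \<forall>p' q' r' :: real^2.
      geodesic_segment M d p q A \<and> geodesic_segment M d q r B \<and> geodesic_segment M d r p C \<and>
      dist p' q' = d p q \<and> dist q' r' = d q r \<and> dist r' p' = d r p \<longrightarrow>
      (let comparison = (\<lambda>x x'. comparison_point d p A p' q' x x' \<or>
             comparison_point d q B q' r' x x' \<or> comparison_point d r C r' p' x x')
       in \<forall>x x' y y'. comparison x x' \<and> comparison y y' \<longrightarrow> d x y \<le> dist x' y'))"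


section \<open>Cubical complexes\<close>

text \<open>Points of \<open>[0,1]\<^sup>n\<close> are extensional functions on \<open>{..<n}\<close>, so that cubes of different
  dimensions live in one type.\<close>

definition unit_cube :: "nat \<Rightarrow> (nat \<Rightarrow> real) set"
  where "unit_cube n = {..<n} \<rightarrow>\<^sub>E {0..1}"

definition cube_dist :: "nat \<Rightarrow> (nat \<Rightarrow> real) \<Rightarrow> (nat \<Rightarrow> real) \<Rightarrow> real"
  where "cube_dist n u v = L2_set (\<lambda>i. u i - v i) {..<n}"

definition cube_face :: "nat \<Rightarrow> (nat \<Rightarrow> real) set \<Rightarrow> bool"
  where "cube_face n T \<longleftrightarrow> (\<exists>S. (\<forall>i<n. S i \<in> {{0}, {1}, {0..1}}) \<and> T = Pi\<^sub>E {..<n} S)"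

definition face_isometry ::
  "nat \<Rightarrow> (nat \<Rightarrow> real) set \<Rightarrow> nat \<Rightarrow> (nat \<Rightarrow> real) set \<Rightarrow> ((nat \<Rightarrow> real) \<Rightarrow> nat \<Rightarrow> real) \<Rightarrow> bool"
  where "face_isometry m S n T h \<longleftrightarrow> cube_face m S \<and> cube_face n T \<and> bij_betw h S T \<and>
    (\<forall>u\<in>S. \<forall>v\<in>S. cube_dist n (h u) (h v) = cube_dist m u v)"

text \<open>The complex is a quotient of the disjoint union of the cubes \<open>unit_cube (cdim K c)\<close>,
  \<open>c \<in> cubes K\<close>; the quotient map restricted to the cube \<open>c\<close> is \<open>chart K c\<close>.  Proper faces of a
  listed cube need not be listed themselves.\<close>

record ('c, 'a) cube_complex =
  cubes :: "'c set"
  cdim :: "'c \<Rightarrow> nat"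
  chart :: "'c \<Rightarrow> (nat \<Rightarrow> real) \<Rightarrow> 'a"

definition cube_of :: "('c, 'a) cube_complex \<Rightarrow> 'c \<Rightarrow> (nat \<Rightarrow> real) set"
  where "cube_of K c = unit_cube (cdim K c)"

definition points :: "('c, 'a) cube_complex \<Rightarrow> 'a set"
  where "points K = (\<Union>c\<in>cubes K. chart K c ` cube_of K c)"

definition cells :: "('c, 'a) cube_complex \<Rightarrow> 'a set set"
  where "cells K = {chart K c ` T | c T. c \<in> cubes K \<and> cube_face (cdim K c) T}"

text \<open>\<open>string_length K x y L\<close>: there is a string of points from \<open>x\<close> to \<open>y\<close>, any two consecutive
  ones lying in a common cube, such that the distances measured in these cubes add up to \<open>L\<close>.\<close>

inductive string_length :: "('c, 'a) cube_complex \<Rightarrow> 'a \<Rightarrow> 'a \<Rightarrow> real \<Rightarrow> bool"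
  for K :: "('c, 'a) cube_complex"
  where
    string_refl: "x \<in> points K \<Longrightarrow> string_length K x x 0"
  | string_step: "\<lbrakk>string_length K x (chart K c u) L; c \<in> cubes K; u \<in> cube_of K c; v \<in> cube_of K c\<rbrakk>
      \<Longrightarrow> string_length K x (chart K c v) (L + cube_dist (cdim K c) u v)"

text \<open>The value 0 for points not joined by a string is a dummy: it only occurs outside \<open>points K\<close>
  when \<open>K\<close> is a cubical complex in the sense below.\<close>

definition intrinsic_dist :: "('c, 'a) cube_complex \<Rightarrow> 'a \<Rightarrow> 'a \<Rightarrow> real"
  where "intrinsic_dist K x y =
    (if \<exists>L. string_length K x y L then Inf {L. string_length K x y L} else 0)"

text \<open>Bridson and Haefliger, Metric Spaces of Non-Positive Curvature, Definition I.7.32, with the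
  requirement that all distances be finite, i.e. that any two points be joined by a string.\<close>

definition cubical_complex :: "('c, 'a) cube_complex \<Rightarrow> bool"
  where "cubical_complex K \<longleftrightarrow>
    (\<forall>c\<in>cubes K. inj_on (chart K c) (cube_of K c)) \<and>
    (\<forall>c\<in>cubes K. \<forall>c'\<in>cubes K. chart K c ` cube_of K c \<inter> chart K c' ` cube_of K c' \<noteq> {} \<longrightarrow>
      (\<exists>T T' h. face_isometry (cdim K c) T (cdim K c') T' h \<and>
        (\<forall>u\<in>cube_of K c. \<forall>u'\<in>cube_of K c'.
          chart K c u = chart K c' u' \<longleftrightarrow> u \<in> T \<and> u' = h u))) \<and>
    (\<forall>x\<in>points K. \<forall>y\<in>points K. \<exists>L. string_length K x y L)"

definition CAT0_cubical_complex :: "('c, 'a) cube_complex \<Rightarrow> bool"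
  where "CAT0_cubical_complex K \<longleftrightarrow>
    cubical_complex K \<and> CAT0_space (points K) (intrinsic_dist K)"

definition finite_dimensional_complex :: "('c, 'a) cube_complex \<Rightarrow> bool"
  where "finite_dimensional_complex K \<longleftrightarrow> (\<exists>N. \<forall>c\<in>cubes K. cdim K c \<le> N)"

definition locally_finite_complex :: "('c, 'a) cube_complex \<Rightarrow> bool"
  where "locally_finite_complex K \<longleftrightarrow> (\<forall>x\<in>points K. finite {C \<in> cells K. x \<in> C})"


section \<open>Uniform embeddings and compression\<close>

definition uniform_embedding ::
  "'a set \<Rightarrow> ('a \<Rightarrow> 'a \<Rightarrow> real) \<Rightarrow> ('a \<Rightarrow> 'h :: {real_inner, complete_space}) \<Rightarrow> bool"
  where "uniform_embedding X d f \<longleftrightarrow>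
    (\<exists>\<rho> \<delta> :: real \<Rightarrow> real.
      \<rho> \<in> {0..} \<rightarrow> {0..} \<and> \<delta> \<in> {0..} \<rightarrow> {0..} \<and> mono_on {0..} \<rho> \<and> mono_on {0..} \<delta> \<and>
      (\<forall>x\<in>X. \<forall>y\<in>X. \<rho> (d x y) \<le> dist (f x) (f y) \<and> dist (f x) (f y) \<le> \<delta> (d x y)) \<and>
      filterlim \<rho> at_top at_top)"

text \<open>Extended real values, so that the infimum of the empty set is \<open>\<infinity>\<close>.\<close>

definition compression ::
  "'a set \<Rightarrow> ('a \<Rightarrow> 'a \<Rightarrow> real) \<Rightarrow> ('a \<Rightarrow> 'h :: {real_inner, complete_space}) \<Rightarrow> real \<Rightarrow> ereal"
  where "compression X d f t =
    (INF (x, y) \<in> {(x, y). x \<in> X \<and> y \<in> X \<and> t \<le> d x y}. ereal (dist (f x) (f y)))"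

definition asymp_le :: "(real \<Rightarrow> ereal) \<Rightarrow> (real \<Rightarrow> ereal) \<Rightarrow> bool"  (infix "\<preceq>" 50)
  where "g \<preceq> h \<longleftrightarrow> (\<exists>C>0. \<exists>M. \<forall>t\<ge>M. g t \<le> ereal C * h t)"

end

theory Submission
  imports Defs
begin

text \<open>For an edge \<open>[a, b]\<close> let \<open>hs a b\<close> be the set of vertices closer to \<open>a\<close> than to \<open>b\<close> in the CAT(0) metric.
  Straightening the coordinate along the edge of a string that stays in the open carrier of the dual
  hyperplane shows that the distance to a vertex never attains its minimum over an edge in the
  interior.  With convexity of the metric and a continuity argument it follows that parallel edges
  define the same halfspaces and that crossing an edge changes exactly one of them.  All edges at a
  vertex \<open>x\<close> that descend towards a vertex \<open>p\<close> lie in the cube into which the geodesic from \<open>x\<close> to \<open>p\<close>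
  departs; hence antichains of halfspaces separating \<open>x\<close> from \<open>p\<close> have at most \<open>N\<close> members, where \<open>N\<close> bounds
  the dimension.

  Fix a base vertex \<open>p\<close> and map \<open>x\<close> to the family with entry \<open>weight (height A)\<close> at each halfspace \<open>A\<close> that
  separates \<open>x\<close> from \<open>p\<close>, the height being the maximal length of a chain of such halfspaces ending in
  \<open>A\<close>.  Crossing an edge changes every height by at most one, and at most \<open>N\<close> halfspaces share a height,
  so the map is Lipschitz because the increments of \<open>weight\<close> are square summable.  Conversely, at distance
  \<open>t\<close> there is a chain of at least \<open>t / N\<close> separating halfspaces, half of which contribute the weights of
  their ranks; since \<open>weight k\<close> is at least of order \<open>sqrt k / (sqrt (ln k) * ln (ln k))\<close>, these squares sum
  to the required lower bound.\<close>

section \<open>Faces of cubes and their isometries\<close>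

text \<open>The weights answer two competing demands. The Lipschitz bound needs square summable
  increments, while compression is governed by the sum of the squared weights up to a multiple of
  \<open>t\<close>. The series of 1 / (k ln k (ln ln k)^2) lies just on the convergent side of the
  divergent series of 1 / (k ln k ln ln k), which is the source of the factor sqrt (ln t) * ln (ln
  t). Heights are taken among the halfspaces separating \<open>x\<close> from \<open>p\<close>, so
  they count from \<open>x\<close>, and an edge at \<open>x\<close> shifts each of them by at most
  one.

  The geometric obstacle is that distances are infima over strings, and that cubes meet through
  arbitrary face isometries. Strict inequalities therefore need a quantitative gap that survives a
  small excess of string length, and a direction has to be followed from cube to cube together with
  its orientation. Comparing distances to the two ends of an edge makes a halfspace a global object
  from the start, without building the hyperplane as a subspace.\<close>

definition flip :: "bool \<Rightarrow> real \<Rightarrow> real"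
  where "flip b s = (if b then 1 - s else s)"

lemma flip_flip [simp]: "flip b (flip b' s) = flip (b \<noteq> b') s"
  by (auto simp: flip_def)

lemma flip_False [simp]: "flip False s = s"
  by (simp add: flip_def)

lemma flip_mem [simp]: "flip b s \<in> {0..1} \<longleftrightarrow> s \<in> {0..1}"
  by (auto simp: flip_def)

lemma flip_pos [simp]: "0 < flip b s \<and> flip b s < 1 \<longleftrightarrow> 0 < s \<and> s < 1"
  by (auto simp: flip_def)

lemma cube_dist_square: "(cube_dist n u v)\<^sup>2 = (\<Sum>i<n. (u i - v i)\<^sup>2)"
  by (simp add: cube_dist_def L2_set_def sum_nonneg)

lemma cube_dist_nonneg [simp]: "0 \<le> cube_dist n u v"
  by (simp add: cube_dist_def L2_set_nonneg)

lemma cube_dist_self [simp]: "cube_dist n u u = 0"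
  by (simp add: cube_dist_def L2_set_def)

lemma cube_dist_commute: "cube_dist n u v = cube_dist n v u"
  by (simp add: cube_dist_def L2_set_def power2_commute)

lemma cube_dist_triangle: "cube_dist n u w \<le> cube_dist n u v + cube_dist n v w"
  using L2_set_triangle_ineq [of "\<lambda>i. u i - v i" "\<lambda>i. v i - w i" "{..<n}"]
  by (simp add: cube_dist_def)

lemma coord_diff_le_cube_dist: "i < n \<Longrightarrow> \<bar>u i - v i\<bar> \<le> cube_dist n u v"
  unfolding cube_dist_def using member_le_L2_set [of "{..<n}" i "\<lambda>i. \<bar>u i - v i\<bar>"]
  by (simp add: L2_set_def)

lemma sum_abs_le_cube_dist:
  "(\<Sum>i<n. \<bar>u i - v i\<bar>) \<le> real n * cube_dist n u v"
  using sum_mono [of "{..<n}" "\<lambda>i. \<bar>u i - v i\<bar>" "\<lambda>_. cube_dist n u v"] coord_diff_le_cube_dist by simp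

lemma unit_cube_upd: "u \<in> unit_cube n \<Longrightarrow> i < n \<Longrightarrow> s \<in> {0..1} \<Longrightarrow> u(i := s) \<in> unit_cube n"
  by (auto simp: unit_cube_def PiE_def Pi_def extensional_def)

lemma unit_cube_mem: "u \<in> unit_cube n \<Longrightarrow> i < n \<Longrightarrow> 0 \<le> u i \<and> u i \<le> 1"
  by (auto simp: unit_cube_def PiE_def Pi_def)

lemma unit_cube_eqI: "u \<in> unit_cube n \<Longrightarrow> v \<in> unit_cube n \<Longrightarrow> (\<And>i. i < n \<Longrightarrow> u i = v i) \<Longrightarrow> u = v"
  unfolding unit_cube_def by (rule PiE_ext) auto

lemma cube_dist_upd:
  assumes "i < n"
  shows "(cube_dist n (u(i := s)) (v(i := t)))\<^sup>2 = (cube_dist n (u(i := 0)) (v(i := 0)))\<^sup>2 + (s - t)\<^sup>2"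
proof -
  have *: "sum f {..<n} = f i + sum f ({..<n} - {i})" for f :: "nat \<Rightarrow> real"
    using assms by (simp add: sum.remove)
  have "(\<Sum>j\<in>{..<n} - {i}. ((u(i := s)) j - (v(i := t)) j)\<^sup>2) = (\<Sum>j\<in>{..<n} - {i}. ((u(i := 0)) j - (v(i := 0)) j)\<^sup>2)"
    by (intro sum.cong) auto
  then show ?thesis
    unfolding cube_dist_square * [of "\<lambda>j. ((u(i := s)) j - (v(i := t)) j)\<^sup>2"]
      * [of "\<lambda>j. ((u(i := 0)) j - (v(i := 0)) j)\<^sup>2"]
    by simp
qed

lemma cube_dist_upd_le:
  assumes "i < n" shows "cube_dist n (u(i := s)) (v(i := s)) \<le> cube_dist n u v"
proof (rule power2_le_imp_le)
  show "(cube_dist n (u(i := s)) (v(i := s)))\<^sup>2 \<le> (cube_dist n u v)\<^sup>2"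
    using cube_dist_upd [OF assms, of u s v s] cube_dist_upd [OF assms, of u "u i" v "v i"] by simp
qed simp

lemma cube_dist_upd_same:
  assumes "i < n" shows "cube_dist n (u(i := s)) (u(i := t)) = \<bar>s - t\<bar>"
proof -
  have "(cube_dist n (u(i := s)) (u(i := t)))\<^sup>2 = (s - t)\<^sup>2"
    using cube_dist_upd [OF assms, of u s u t] by simp
  then have "\<bar>cube_dist n (u(i := s)) (u(i := t))\<bar> = \<bar>s - t\<bar>"
    by (simp only: power2_eq_iff abs_eq_iff)
  then show ?thesis by simp
qed

lemma cube_face_normal_form:
  assumes "cube_face m S"
  obtains I e where "I \<subseteq> {..<m}" "\<And>i. e i = 0 \<or> e i = (1::real)"
    "S = {u \<in> unit_cube m. \<forall>i<m. i \<notin> I \<longrightarrow> u i = e i}"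
proof -
  obtain F where F0: "(\<forall>i<m. F i \<in> {{0}, {1}, {0..1::real}}) \<and> S = Pi\<^sub>E {..<m} F"
    using assms unfolding cube_face_def by (rule exE)
  have F: "F i = {0} \<or> F i = {1} \<or> F i = {0..1}" if "i < m" for i
    using F0 that by simp
  have S: "S = Pi\<^sub>E {..<m} F" using F0 by (rule conjunct2)
  define I where "I = {i. i < m \<and> F i \<noteq> {0} \<and> F i \<noteq> {1}}"
  define e where "e i = (if F i = {1} then 1 else (0::real))" for i
  have "S = {u \<in> unit_cube m. \<forall>i<m. i \<notin> I \<longrightarrow> u i = e i}" (is "_ = ?R")
  proof (rule set_eqI)
    fix u
    have "u i \<in> F i \<longleftrightarrow> u i \<in> {0..1} \<and> (i \<notin> I \<longrightarrow> u i = e i)" if i: "i < m" for i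
    proof -
      consider "F i = {0}" | "F i = {1}" | "F i \<noteq> {0}" "F i \<noteq> {1}" "F i = {0..1}"
        using F [OF i] by argo
      then show ?thesis
      proof cases
        case 1
        have "i \<notin> I" "e i = 0" unfolding I_def e_def mem_Collect_eq 1 by simp_all
        then show ?thesis unfolding 1 by auto
      next
        case 2
        have "i \<notin> I" "e i = 1" unfolding I_def e_def mem_Collect_eq 2 by simp_all
        then show ?thesis unfolding 2 by auto
      next
        case 3
        have "i \<in> I" unfolding I_def mem_Collect_eq using i 3 by (intro conjI)
        then show ?thesis unfolding 3(3) by simp
      qed
    qed
    then have "(\<forall>i<m. u i \<in> F i) \<longleftrightarrow> (\<forall>i<m. u i \<in> {0..1}) \<and> (\<forall>i<m. i \<notin> I \<longrightarrow> u i = e i)"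
      by blast
    then show "u \<in> S \<longleftrightarrow> u \<in> ?R"
      unfolding S unit_cube_def PiE_iff mem_Collect_eq Ball_def lessThan_iff by blast
  qed
  moreover have "I \<subseteq> {..<m}" unfolding I_def by blast
  moreover have "e i = 0 \<or> e i = 1" for i unfolding e_def by simp
  ultimately show ?thesis using that by blast
qed

lemma cube_dist_flip_set:
  assumes I: "I \<subseteq> {..<m}" and u: "\<And>i. i \<in> I \<Longrightarrow> u i = 0 \<or> u i = (1::real)"
  shows "(cube_dist m u (\<lambda>i. if i \<in> I then 1 - u i else u i))\<^sup>2 = card I"
proof -
  have "(u i - (if i \<in> I then 1 - u i else u i))\<^sup>2 = (if i \<in> I then 1 else 0)" for i
    using u [of i] by auto
  then have "(\<Sum>i<m. (u i - (if i \<in> I then 1 - u i else u i))\<^sup>2) = (\<Sum>i<m. if i \<in> I then 1 else (0::real))"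
    by simp
  also have "\<dots> = card I"
    using I by (simp add: sum.If_cases Int_absorb1)
  finally show ?thesis by (simp add: cube_dist_square)
qed

text \<open>Such an isometry permutes and reflects coordinates. Diameters determine the dimension; a
  corner and its opposite realise the diameter, so their images have coordinates 0 or 1; adjacent
  corners are at distance 1, so their images differ in one coordinate; all other points are read off
  from their distances to corners.\<close>

lemma face_isometry_coordinates:
  assumes fi: "face_isometry m S n T h"
  shows "\<exists>I J \<pi> b. I \<subseteq> {..<m} \<and> J \<subseteq> {..<n} \<and> bij_betw \<pi> I J \<and>
    (\<forall>u\<in>S. \<forall>i<m. i \<notin> I \<longrightarrow> u i = 0 \<or> u i = (1::real)) \<and>
    (\<forall>u\<in>S. \<forall>v\<in>unit_cube m. (\<forall>i<m. i \<notin> I \<longrightarrow> u i = v i) \<longrightarrow> v \<in> S) \<and>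
    (\<forall>w\<in>T. \<forall>w'\<in>T. \<forall>j<n. j \<notin> J \<longrightarrow> w j = w' j) \<and>
    (\<forall>w\<in>T. \<forall>j<n. j \<notin> J \<longrightarrow> w j = 0 \<or> w j = (1::real)) \<and>
    (\<forall>u\<in>S. \<forall>i\<in>I. h u (\<pi> i) = flip (b i) (u i))"
proof -
  have cf: "cube_face m S" "cube_face n T" and bij: "bij_betw h S T"
    and iso: "\<And>u v. u \<in> S \<Longrightarrow> v \<in> S \<Longrightarrow> cube_dist n (h u) (h v) = cube_dist m u v"
    using fi by (simp_all add: face_isometry_def)
  obtain I e where I: "I \<subseteq> {..<m}" and e: "\<And>i. e i = 0 \<or> e i = (1::real)"
    and S: "S = {u \<in> unit_cube m. \<forall>i<m. i \<notin> I \<longrightarrow> u i = e i}"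
    by (rule cube_face_normal_form [OF cf(1)]) (rule that)
  obtain J f where J: "J \<subseteq> {..<n}" and f: "\<And>i. f i = 0 \<or> f i = (1::real)"
    and T: "T = {u \<in> unit_cube n. \<forall>i<n. i \<notin> J \<longrightarrow> u i = f i}"
    by (rule cube_face_normal_form [OF cf(2)]) (rule that)
  have finI: "finite I" "finite J" using I J finite_subset by auto
  have hT: "h u \<in> T" if "u \<in> S" for u using bij that bij_betwE by blast
  have face_dist: "(cube_dist n w w')\<^sup>2 = (\<Sum>j\<in>J. (w j - w' j)\<^sup>2)" if "w \<in> T" "w' \<in> T" for w w'
    unfolding cube_dist_square using that J
    by (intro sum.mono_neutral_right) (auto simp: T)
  have face_dist_S: "(cube_dist m w w')\<^sup>2 = (\<Sum>j\<in>I. (w j - w' j)\<^sup>2)" if "w \<in> S" "w' \<in> S" for w w'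
    unfolding cube_dist_square using that I
    by (intro sum.mono_neutral_right) (auto simp: S)
  have le1: "(a - b)\<^sup>2 \<le> 1" if "a \<in> {0..1}" "b \<in> {0..1}" for a b :: real
    using that by (auto simp: abs_square_le_1 abs_le_iff)
  have T01: "w j \<in> {0..1}" if "w \<in> T" "j \<in> J" for w j
    using that J unit_cube_mem [of w n j] by (auto simp: T)
  have S01: "w j \<in> {0..1}" if "w \<in> S" "j \<in> I" for w j
    using that I unit_cube_mem [of w m j] by (auto simp: S)
  have dT: "(cube_dist n w w')\<^sup>2 \<le> card J" if "w \<in> T" "w' \<in> T" for w w'
    unfolding face_dist [OF that] using sum_mono [of J "\<lambda>j. (w j - w' j)\<^sup>2" "\<lambda>_. 1"] le1 T01 that by auto
  have dS: "(cube_dist m w w')\<^sup>2 \<le> card I" if "w \<in> S" "w' \<in> S" for w w'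
    unfolding face_dist_S [OF that] using sum_mono [of I "\<lambda>j. (w j - w' j)\<^sup>2" "\<lambda>_. 1"] le1 S01 that by auto
  define opS where "opS u = (\<lambda>i. if i \<in> I then 1 - u i else u i)" for u :: "nat \<Rightarrow> real"
  have opS: "opS u \<in> S" if "u \<in> S" for u
  proof -
    have "u \<in> unit_cube m" using that by (simp add: S)
    then have "opS u \<in> unit_cube m"
      using I by (auto simp: opS_def unit_cube_def PiE_iff extensional_def)
    then show ?thesis using that by (simp add: S opS_def)
  qed
  define v0 where "v0 = (\<lambda>i. if i < m then if i \<in> I then 0 else e i else undefined)"
  have v0: "v0 \<in> S"
  proof -
    have "0 \<le> e i \<and> e i \<le> 1" for i using e [of i] by auto
    then have "v0 \<in> unit_cube m"
      by (auto simp: v0_def unit_cube_def PiE_iff extensional_def)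
    then show ?thesis by (simp add: S v0_def)
  qed
  define w0 where "w0 = (\<lambda>i. if i < n then if i \<in> J then 0 else f i else undefined)"
  have w0: "w0 \<in> T"
  proof -
    have "0 \<le> f i \<and> f i \<le> 1" for i using f [of i] by auto
    then have "w0 \<in> unit_cube n"
      by (auto simp: w0_def unit_cube_def PiE_iff extensional_def)
    then show ?thesis by (simp add: T w0_def)
  qed
  have opT: "(\<lambda>i. if i \<in> J then 1 - w0 i else w0 i) \<in> T"
  proof -
    have "w0 \<in> unit_cube n" using w0 by (simp add: T)
    then have "(\<lambda>i. if i \<in> J then 1 - w0 i else w0 i) \<in> unit_cube n"
      using J by (auto simp: unit_cube_def PiE_iff extensional_def)
    then show ?thesis using w0 by (simp add: T)
  qed
  have cardIJ: "card I = card J"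
  proof (rule antisym)
    have "(cube_dist m v0 (opS v0))\<^sup>2 = card I"
      unfolding opS_def using I by (intro cube_dist_flip_set) (auto simp: v0_def)
    then have "real (card I) \<le> card J"
      using iso [OF v0 opS [OF v0]] dT [OF hT [OF v0] hT [OF opS [OF v0]]] by simp
    then show "card I \<le> card J" by simp
    have surj: "\<exists>a. a \<in> S \<and> h a = w" if "w \<in> T" for w
      using that bij_betw_imp_surj_on [OF bij] by blast
    obtain a where a: "a \<in> S" "h a = w0"
      using surj [OF w0] by (elim exE conjE) (rule that)
    obtain b where b: "b \<in> S" "h b = (\<lambda>i. if i \<in> J then 1 - w0 i else w0 i)"
      using surj [OF opT] by (elim exE conjE) (rule that)
    have "(cube_dist n w0 (\<lambda>i. if i \<in> J then 1 - w0 i else w0 i))\<^sup>2 = card J"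
      using J by (intro cube_dist_flip_set) (auto simp: w0_def)
    then have "real (card J) \<le> card I"
      using iso [OF a(1) b(1)] dS [OF a(1) b(1)] unfolding a b by simp
    then show "card J \<le> card I" by simp
  qed
  have corner: "h u j = 0 \<or> h u j = 1" if u: "u \<in> S" "\<And>i. i \<in> I \<Longrightarrow> u i = 0 \<or> u i = 1" and j: "j < n" for u j
  proof (cases "j \<in> J")
    case True
    have "(cube_dist n (h u) (h (opS u)))\<^sup>2 = card J"
      using iso [OF u(1) opS [OF u(1)]] cube_dist_flip_set [OF I u(2)] cardIJ by (simp add: opS_def)
    \<comment> \<open>Each summand on the left is at most 1, so equality of the sums forces every
      one of them to be 1.\<close>
    then have "(\<Sum>j\<in>J. (h u j - h (opS u) j)\<^sup>2) = (\<Sum>j\<in>J. 1)"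
      using face_dist [OF hT hT] u opS by simp
    then have "(\<Sum>j\<in>J. 1 - (h u j - h (opS u) j)\<^sup>2) = 0"
      by (simp add: sum_subtractf)
    moreover have "0 \<le> 1 - (h u j - h (opS u) j)\<^sup>2" if "j \<in> J" for j
      using le1 [OF T01 [OF hT [OF u(1)] that] T01 [OF hT [OF opS [OF u(1)]] that]] by simp
    ultimately have "1 - (h u j - h (opS u) j)\<^sup>2 = 0"
      using True finI sum_nonneg_eq_0_iff [of J "\<lambda>j. 1 - (h u j - h (opS u) j)\<^sup>2"] by auto
    then have "(h u j - h (opS u) j)\<^sup>2 = 1" by simp
    then have "h u j - h (opS u) j = 1 \<or> h u j - h (opS u) j = - 1"
      by (simp only: power2_eq_1_iff)
    then show ?thesis
      using T01 [OF hT [OF u(1)] True] T01 [OF hT [OF opS [OF u(1)]] True] by auto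
  next
    case False
    then show ?thesis using hT [OF u(1)] j f by (auto simp: T)
  qed
  have v0i: "v0(i := 1) \<in> S" if "i \<in> I" for i
    using v0 that I unit_cube_upd [of v0 m i 1] by (auto simp: S)
  have v0_corner: "v0 k = 0 \<or> v0 k = 1" if "k \<in> I" for k
    using that I by (auto simp: v0_def)
  have ex1: "\<exists>j. j \<in> J \<and> h (v0(i := 1)) j = 1 - h v0 j \<and> (\<forall>k<n. k \<noteq> j \<longrightarrow> h (v0(i := 1)) k = h v0 k)"
    if i: "i \<in> I" for i
  proof -
    let ?D = "{j\<in>J. h v0 j \<noteq> h (v0(i := 1)) j}"
    have c: "h v0 j = 0 \<or> h v0 j = 1" "h (v0(i := 1)) j = 0 \<or> h (v0(i := 1)) j = 1" if "j < n" for j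
      using corner [OF v0 v0_corner that] corner [OF v0i [OF i] _ that] v0_corner by auto
    have "(cube_dist m v0 (v0(i := 1)))\<^sup>2 = 1"
      using cube_dist_upd_same [of i m v0 0 1] i I by (auto simp: v0_def fun_upd_idem subset_eq)
    then have "1 = (\<Sum>j\<in>J. (h v0 j - h (v0(i := 1)) j)\<^sup>2)"
      using iso [OF v0 v0i [OF i]] face_dist [OF hT [OF v0] hT [OF v0i [OF i]]] by simp
    also have "\<dots> = (\<Sum>j\<in>J. if h v0 j \<noteq> h (v0(i := 1)) j then 1 else 0)"
    proof (rule sum.cong [OF refl])
      fix j assume "j \<in> J"
      then have "j < n" using J by auto
      show "(h v0 j - h (v0(i := 1)) j)\<^sup>2 = (if h v0 j \<noteq> h (v0(i := 1)) j then 1 else 0)"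
        by (rule disjE [OF c(1) [OF \<open>j < n\<close>]]; rule disjE [OF c(2) [OF \<open>j < n\<close>]]) simp_all
    qed
    also have "\<dots> = card ?D" using finI by (simp add: sum.If_cases Int_def)
    finally have "card ?D = 1" by simp
    then obtain j where j: "?D = {j}" by (rule card_1_singletonE)
    then have jD: "j \<in> ?D" by (simp only: singletonI)
    then have jJ: "j \<in> J" and ne: "h v0 j \<noteq> h (v0(i := 1)) j" by simp_all
    then have "j < n" using J by auto
    have "h (v0(i := 1)) j = 1 - h v0 j"
      by (rule disjE [OF c(1) [OF \<open>j < n\<close>]]; rule disjE [OF c(2) [OF \<open>j < n\<close>]]) (use ne in simp_all)
    moreover have "h (v0(i := 1)) k = h v0 k" if "k < n" "k \<noteq> j" for k
    proof (cases "k \<in> J")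
      case True
      have "k \<notin> ?D" using j that by (simp only: singleton_iff not_False_eq_True)
      then show ?thesis using True by simp
    next
      case False then show ?thesis using hT [OF v0] hT [OF v0i [OF i]] that by (auto simp: T)
    qed
    ultimately show ?thesis using jJ by (intro exI [of _ j]) blast
  qed
  define \<pi> where "\<pi> i = (SOME j. j \<in> J \<and> h (v0(i := 1)) j = 1 - h v0 j \<and> (\<forall>k<n. k \<noteq> j \<longrightarrow> h (v0(i := 1)) k = h v0 k))" for i
  have \<pi>: "\<pi> i \<in> J" "h (v0(i := 1)) (\<pi> i) = 1 - h v0 (\<pi> i)"
    "\<And>k. k < n \<Longrightarrow> k \<noteq> \<pi> i \<Longrightarrow> h (v0(i := 1)) k = h v0 k" if "i \<in> I" for i
    using someI_ex [OF ex1 [OF that]] by (auto simp: \<pi>_def)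
  have inj: "inj_on \<pi> I"
  proof (rule inj_onI, rule ccontr)
    fix i k assume ik: "i \<in> I" "k \<in> I" "\<pi> i = \<pi> k" "i \<noteq> k"
    have "h (v0(i := 1)) j = h (v0(k := 1)) j" if "j < n" for j
      using \<pi> [OF ik(1)] \<pi> [OF ik(2)] ik(3) that by (cases "j = \<pi> i") auto
    then have "cube_dist n (h (v0(i := 1))) (h (v0(k := 1))) = 0"
      by (simp add: cube_dist_def L2_set_def)
    then have "cube_dist m (v0(i := 1)) (v0(k := 1)) = 0"
      using iso v0i ik by simp
    moreover have "i < m" using I ik by auto
    ultimately show False
      using coord_diff_le_cube_dist [of i m "v0(i := 1)" "v0(k := 1)"] ik I by (auto simp: v0_def)
  qed
  have "\<pi> ` I = J"
    using \<pi>(1) finI cardIJ inj by (intro card_subset_eq) (auto simp: card_image)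
  then have bij\<pi>: "bij_betw \<pi> I J" using inj by (simp add: bij_betw_def)
  define b where "b i = (h v0 (\<pi> i) = 1)" for i
  have form: "h u (\<pi> i) = flip (b i) (u i)" if u: "u \<in> S" and i: "i \<in> I" for u i
  proof -
    have im: "i < m" and jn: "\<pi> i < n" using I J i \<pi>(1) [OF i] by auto
    let ?v = "v0(i := 1)"
    have split: "sum g {..<n} = g (\<pi> i) + sum g ({..<n} - {\<pi> i})" for g :: "nat \<Rightarrow> real"
      using jn by (simp add: sum.remove)
    \<comment> \<open>The difference of the squared distances to \<open>v0\<close> and to its
      neighbour is affine in the single coordinate \<open>u i\<close>, and the isometry preserves
      it.\<close>
    have "(cube_dist n (h u) (h v0))\<^sup>2 - (cube_dist n (h u) (h ?v))\<^sup>2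
        = (h u (\<pi> i) - h v0 (\<pi> i))\<^sup>2 - (h u (\<pi> i) - h ?v (\<pi> i))\<^sup>2"
    proof -
      have "(\<Sum>j\<in>{..<n} - {\<pi> i}. (h u j - h v0 j)\<^sup>2) = (\<Sum>j\<in>{..<n} - {\<pi> i}. (h u j - h ?v j)\<^sup>2)"
        using \<pi>(3) [OF i] by (intro sum.cong) auto
      then show ?thesis
        unfolding cube_dist_square split [of "\<lambda>j. (h u j - h v0 j)\<^sup>2"] split [of "\<lambda>j. (h u j - h ?v j)\<^sup>2"]
        by simp
    qed
    moreover have "(cube_dist m u v0)\<^sup>2 - (cube_dist m u ?v)\<^sup>2 = (u i)\<^sup>2 - (u i - 1)\<^sup>2"
      using cube_dist_upd [OF im, of u "u i" v0 0] cube_dist_upd [OF im, of u "u i" v0 1] i im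
      by (simp add: v0_def fun_upd_idem)
    ultimately have "(h u (\<pi> i) - h v0 (\<pi> i))\<^sup>2 - (h u (\<pi> i) - (1 - h v0 (\<pi> i)))\<^sup>2 = (u i)\<^sup>2 - (u i - 1)\<^sup>2"
      using iso [OF u v0] iso [OF u v0i [OF i]] \<pi>(2) [OF i] by simp
    moreover have "h v0 (\<pi> i) = 0 \<or> h v0 (\<pi> i) = 1"
      using corner [OF v0 v0_corner jn] .
    ultimately show ?thesis
      by (elim disjE) (simp_all add: b_def flip_def power2_eq_square algebra_simps)
  qed
  have f1: "\<forall>u\<in>S. \<forall>i<m. i \<notin> I \<longrightarrow> u i = 0 \<or> u i = 1"
    using e by (simp add: S)
  have f2: "\<forall>u\<in>S. \<forall>v\<in>unit_cube m. (\<forall>i<m. i \<notin> I \<longrightarrow> u i = v i) \<longrightarrow> v \<in> S"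
    by (simp add: S)
  have f3: "\<forall>w\<in>T. \<forall>w'\<in>T. \<forall>j<n. j \<notin> J \<longrightarrow> w j = w' j"
    by (simp add: T)
  have f4: "\<forall>w\<in>T. \<forall>j<n. j \<notin> J \<longrightarrow> w j = 0 \<or> w j = 1"
    using f by (simp add: T)
  have f5: "\<forall>u\<in>S. \<forall>i\<in>I. h u (\<pi> i) = flip (b i) (u i)"
    using form by simp
  show ?thesis
    by (rule exI [of _ I], rule exI [of _ J], rule exI [of _ \<pi>], rule exI [of _ b], intro conjI; fact)
qed

section \<open>Elementary geometry\<close>

lemma norm_Pair_minus_commute: "norm (A :: real, x - y :: real) = norm (A, y - x)"
  by (simp add: norm_Pair power2_commute)

text \<open>The excess of the hypotenuse over the leg \<open>A\<close> is x^2 divided by their sum,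
  which is at most \<open>2 * A + 1\<close>. For bounded \<open>A\<close> the excess is bounded
  below, and this beats the small excess of a near-optimal string.\<close>

lemma norm_Pair_gap:
  fixes A x :: real
  assumes "0 \<le> A" "\<bar>x\<bar> \<le> 1"
  shows "A + x\<^sup>2 / (2 * A + 1) \<le> norm (A, x)"
proof -
  have sq: "(norm (A, x))\<^sup>2 = A\<^sup>2 + x\<^sup>2" by (simp add: norm_Pair)
  have "norm (A, x) \<le> norm (A, 0 :: real) + norm (0 :: real, x)"
    using norm_triangle_ineq [of "(A, 0 :: real)" "(0 :: real, x)"] by simp
  then have le: "norm (A, x) + A \<le> 2 * A + 1" using assms by (simp add: norm_Pair)
  have "A \<le> norm (A, x)"
    using power2_le_imp_le [of A "norm (A, x)"] sq by simp
  then have "x\<^sup>2 \<le> (norm (A, x) - A) * (2 * A + 1)"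
    using mult_left_mono [OF le, of "norm (A, x) - A"] sq by (simp add: algebra_simps power2_eq_square)
  then show ?thesis using assms by (simp add: field_simps)
qed

text \<open>Unfolds two consecutive strips of widths \<open>A\<close> and \<open>a\<close>:
  \<open>m\<close> is the height at which the straight segment from \<open>(0, r)\<close> to
  \<open>(A + a, s)\<close> crosses the abscissa \<open>A\<close>.\<close>

lemma straighten:
  fixes A a r s :: real
  assumes "0 \<le> A" "0 \<le> a" "r \<in> {0..1}" "s \<in> {0..1}"
  obtains m where "m \<in> {0..1}" "norm (A, m - r) + norm (a, s - m) = norm (A + a, s - r)"
proof -
  define k where "k = A / (A + a)"
  have k: "0 \<le> k" "k \<le> 1" using assms by (auto simp: k_def divide_le_eq_1)
  have kA: "k * (A + a) = A" "(1 - k) * (A + a) = a"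
    using assms by (cases "A + a = 0"; simp add: k_def field_simps)+
  define m where "m = (1 - k) * r + k * s"
  have "m \<in> {0..1}"
    using convexD_alt [of "{0..1::real}" r s k] assms k by (simp add: m_def)
  moreover have "(A, m - r) = k *\<^sub>R (A + a, s - r)" "(a, s - m) = (1 - k) *\<^sub>R (A + a, s - r)"
    using kA by (simp_all add: m_def algebra_simps)
  then have "norm (A, m - r) = k * norm (A + a, s - r)" "norm (a, s - m) = (1 - k) * norm (A + a, s - r)"
    using k by (metis norm_scaleR abs_of_nonneg, metis norm_scaleR abs_of_nonneg diff_ge_0_iff_ge)
  then have "norm (A, m - r) + norm (a, s - m) = norm (A + a, s - r)" by (simp add: algebra_simps)
  ultimately show ?thesis by (rule that)
qed

lemma comparison_triangle_exists:
  fixes a b c :: real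
  assumes "0 \<le> a" "0 \<le> b" "0 \<le> c" "a \<le> b + c" "b \<le> a + c" "c \<le> a + b"
  obtains p q r :: "real^2" where "dist p q = a" "dist q r = b" "dist r p = c"
proof (cases "b = 0")
  case True
  then have "a = c" using assms by simp
  then show ?thesis
    using that [of "vector [a, 0]" 0 0] True assms(1)
    by (simp add: dist_vec_def L2_set_def sum_2 vector_2 dist_real_def)
next
  case False
  \<comment> \<open>Law of cosines with \<open>q\<close> at the origin and \<open>r\<close> at
    \<open>(b, 0)\<close>: this is the first coordinate of \<open>p\<close>.\<close>
  define x where "x = (a\<^sup>2 + b\<^sup>2 - c\<^sup>2) / (2 * b)"
  have bx: "2 * b * x = a\<^sup>2 + b\<^sup>2 - c\<^sup>2" using False by (simp add: x_def)
  have "\<bar>a\<^sup>2 + b\<^sup>2 - c\<^sup>2\<bar> \<le> 2 * b * a"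
  proof -
    have "(a - b)\<^sup>2 \<le> c\<^sup>2" using assms by (intro power2_le_iff_abs_le [THEN iffD2]) auto
    moreover have "c\<^sup>2 \<le> (a + b)\<^sup>2" using assms by (intro power_mono) auto
    ultimately show ?thesis by (simp add: abs_le_iff power2_eq_square algebra_simps)
  qed
  then have "2 * b * \<bar>x\<bar> \<le> 2 * b * a"
    using assms(2) by (metis abs_mult abs_numeral abs_of_nonneg bx)
  then have "\<bar>x\<bar> \<le> a" using False assms(2) by simp
  then have xa: "x\<^sup>2 \<le> a\<^sup>2" using assms(1) by (simp add: abs_le_square_iff [symmetric])
  define y where "y = sqrt (a\<^sup>2 - x\<^sup>2)"
  have y: "y\<^sup>2 = a\<^sup>2 - x\<^sup>2" using xa by (simp add: y_def)
  have 1: "dist (vector [x, y] :: real^2) 0 = a"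
    using assms(1) y by (simp add: dist_vec_def L2_set_def sum_2 vector_2 dist_real_def)
  have 2: "dist (0 :: real^2) (vector [b, 0]) = b"
    using assms(2) by (simp add: dist_vec_def L2_set_def sum_2 vector_2 dist_real_def)
  have "(b - x)\<^sup>2 + y\<^sup>2 = c\<^sup>2" using y bx by (simp add: power2_eq_square algebra_simps)
  then have 3: "dist (vector [b, 0] :: real^2) (vector [x, y]) = c"
    using assms(3) by (simp add: dist_vec_def L2_set_def sum_2 vector_2 dist_real_def)
  show ?thesis using that 1 2 3 by blast
qed

lemma stewart:
  fixes p q r :: "'v :: real_inner"
  shows "(dist p (q + t *\<^sub>R (r - q)))\<^sup>2 =
    (1 - t) * (dist p q)\<^sup>2 + t * (dist p r)\<^sup>2 - t * (1 - t) * (dist q r)\<^sup>2"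
  unfolding dist_norm power2_norm_eq_inner
  by (simp add: inner_diff_left inner_diff_right inner_add_left inner_add_right inner_commute algebra_simps)

lemma nonzero_same_sign:
  fixes D :: "real \<Rightarrow> real"
  assumes "continuous_on {0..1} D" "\<And>r. r \<in> {0..1} \<Longrightarrow> D r \<noteq> 0"
  shows "0 < D 0 \<longleftrightarrow> 0 < D 1"
proof -
  have "D 0 \<noteq> 0" "D 1 \<noteq> 0" using assms(2) by simp_all
  moreover have False if "D 0 \<le> 0" "0 \<le> D 1"
    using IVT' [of D 0 0 1] that assms by force
  moreover have False if "0 \<le> D 0" "D 1 \<le> 0"
    using IVT2' [of D 1 0 0] that assms by force
  ultimately show ?thesis by (meson linorder_not_le nle_le)
qed

lemma continuous_on_unit_interval_lipschitz:
  fixes f :: "real \<Rightarrow> real"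
  assumes "\<And>r s. r \<in> {0..1} \<Longrightarrow> s \<in> {0..1} \<Longrightarrow> \<bar>f r - f s\<bar> \<le> C * \<bar>r - s\<bar>"
  shows "continuous_on {0..1} f"
proof -
  have "0 \<le> C" using assms [of 0 1] by simp
  then have "C-lipschitz_on {0..1} f"
    using assms by (intro lipschitz_onI) (simp_all add: dist_real_def)
  then show ?thesis by (rule lipschitz_on_continuous_on)
qed

section \<open>Heights of sets and the weight function\<close>

text \<open>\<open>A\<close> is only an upper bound, so the empty chain always counts and the
  maximum in \<open>height\<close> is over a nonempty set.\<close>

definition chains_below :: "'b set set \<Rightarrow> 'b set \<Rightarrow> 'b set set set"
  where "chains_below X A = {C. C \<subseteq> X \<and> (\<forall>B\<in>C. B \<subseteq> A) \<and> (\<forall>B\<in>C. \<forall>B'\<in>C. B \<subseteq> B' \<or> B' \<subseteq> B)}"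

definition height :: "'b set set \<Rightarrow> 'b set \<Rightarrow> nat"
  where "height X A = Max (card ` chains_below X A)"

context
  fixes X :: "'b set set"
  assumes fin: "finite X"
begin

lemma finite_chains_below: "finite (chains_below X A)"
  by (rule finite_subset [of _ "Pow X"]) (use fin in \<open>auto simp: chains_below_def\<close>)

lemma height_ge: "C \<in> chains_below X A \<Longrightarrow> card C \<le> height X A"
  unfolding height_def using finite_chains_below by simp

lemma height_attained: obtains C where "C \<in> chains_below X A" "card C = height X A"
proof -
  have "{} \<in> chains_below X A" by (simp add: chains_below_def)
  then have "height X A \<in> card ` chains_below X A"
    unfolding height_def using finite_chains_below by (intro Max_in) auto
  then show ?thesis using that by auto
qed

lemma height_pos: "A \<in> X \<Longrightarrow> 1 \<le> height X A"
  using height_ge [of "{A}" A] by (simp add: chains_below_def)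

lemma height_strict:
  assumes "A \<in> X" "A' \<in> X" "A \<subset> A'" shows "height X A < height X A'"
proof -
  obtain C where C: "C \<in> chains_below X A" "card C = height X A" by (rule height_attained)
  have "finite C" using C(1) fin finite_subset by (auto simp: chains_below_def)
  have "B \<subseteq> A'" "B \<noteq> A'" if "B \<in> C" for B
    using that C(1) assms(3) by (auto simp: chains_below_def)
  then have "insert A' C \<in> chains_below X A'" "A' \<notin> C"
    using C(1) assms(2) by (auto simp: chains_below_def)
  then show ?thesis using height_ge [of "insert A' C" A'] C(2) \<open>finite C\<close> by simp
qed

text \<open>Nested members have different heights, so a level of \<open>height\<close> is an
  antichain and has at most \<open>N\<close> members.\<close>

lemma sum_height_le:
  assumes anti: "\<And>F. F \<subseteq> X \<Longrightarrow> (\<And>A B. A \<in> F \<Longrightarrow> B \<in> F \<Longrightarrow> \<not> A \<subset> B) \<Longrightarrow> card F \<le> N"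
    and g: "\<And>k. 0 \<le> g k" and m: "\<And>A. A \<in> X \<Longrightarrow> height X A < m"
  shows "(\<Sum>A\<in>X. g (height X A)) \<le> real N * (\<Sum>k<m. g k)"
proof -
  let ?L = "\<lambda>k. {A \<in> X. height X A = k}"
  have lev: "card (?L k) \<le> N" for k
  proof (rule anti)
    show "\<not> A \<subset> B" if "A \<in> ?L k" "B \<in> ?L k" for A B
      using that height_strict [of A B] by auto
  qed auto
  have "(\<Sum>A\<in>X. g (height X A)) = (\<Sum>k<m. \<Sum>A\<in>?L k. g (height X A))"
    using m fin by (intro sum.group [symmetric]) auto
  also have "\<dots> = (\<Sum>k<m. real (card (?L k)) * g k)"
    by (intro sum.cong refl) simp
  also have "\<dots> \<le> (\<Sum>k<m. real N * g k)"
    using lev g by (intro sum_mono mult_right_mono) auto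
  finally show ?thesis by (simp add: sum_distrib_left)
qed

text \<open>The height of a member of a chain is at least its rank in the chain.\<close>

lemma sum_height_chain_ge:
  assumes D: "D \<subseteq> X" "\<And>A B. A \<in> D \<Longrightarrow> B \<in> D \<Longrightarrow> A \<subseteq> B \<or> B \<subseteq> A"
    and g: "\<And>k l. k \<le> l \<Longrightarrow> g k \<le> (g l :: real)"
  shows "(\<Sum>k=1..card D. g k) \<le> (\<Sum>A\<in>D. g (height X A))"
proof -
  have finD: "finite D" using D(1) fin by (rule finite_subset)
  define rk where "rk A = card {B \<in> D. B \<subseteq> A}" for A
  have strict: "rk A < rk A'" if "A \<in> D" "A' \<in> D" "A \<subset> A'" for A A'
  proof -
    have "{B \<in> D. B \<subseteq> A} \<subset> {B \<in> D. B \<subseteq> A'}" using that by blast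
    then show ?thesis unfolding rk_def using finD by (intro psubset_card_mono) auto
  qed
  have inj: "inj_on rk D"
  proof (rule inj_onI, rule ccontr)
    fix A B assume "A \<in> D" "B \<in> D" "rk A = rk B" "A \<noteq> B"
    then show False using strict [of A B] strict [of B A] D(2) [of A B] by auto
  qed
  have "rk A \<in> {1..card D}" if "A \<in> D" for A
  proof -
    have "{A} \<subseteq> {B \<in> D. B \<subseteq> A}" "{B \<in> D. B \<subseteq> A} \<subseteq> D" using that by auto
    then show ?thesis
      unfolding rk_def using finD card_mono [of "{B \<in> D. B \<subseteq> A}" "{A}"] card_mono [of D "{B \<in> D. B \<subseteq> A}"] by simp
  qed
  then have img: "rk ` D = {1..card D}"
    using inj by (intro card_subset_eq) (auto simp: card_image)
  have "(\<Sum>k=1..card D. g k) = (\<Sum>A\<in>D. g (rk A))"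
    unfolding img [symmetric] by (rule sum.reindex_cong [OF inj refl refl])
  also have "\<dots> \<le> (\<Sum>A\<in>D. g (height X A))"
  proof (rule sum_mono)
    fix A assume "A \<in> D"
    have "{B \<in> D. B \<subseteq> A} \<in> chains_below X A" using D by (auto simp: chains_below_def)
    then show "g (rk A) \<le> g (height X A)" unfolding rk_def by (intro g height_ge)
  qed
  finally show ?thesis .
qed

end

text \<open>Removing \<open>B\<close> from a longest chain costs at most one member.\<close>

lemma height_insert:
  assumes "finite X" shows "height (insert B X) A \<le> Suc (height X A)"
proof -
  obtain C where C: "C \<in> chains_below (insert B X) A" "card C = height (insert B X) A"
    using height_attained [of "insert B X" A] assms by blast
  have "C - {B} \<in> chains_below X A" using C(1) by (auto simp: chains_below_def)
  then have "card (C - {B}) \<le> height X A" by (rule height_ge [OF assms])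
  then show ?thesis using C(2) by (cases "B \<in> C") (auto simp: card_Diff_singleton)
qed

lemma height_mono:
  assumes "finite X" "Y \<subseteq> X" shows "height Y A \<le> height X A"
proof -
  obtain C where C: "C \<in> chains_below Y A" "card C = height Y A"
    using height_attained [OF finite_subset [OF assms(2,1)]] .
  have "C \<in> chains_below X A" using C(1) assms(2) by (auto simp: chains_below_def)
  then show ?thesis using height_ge [OF assms(1)] C(2) by metis
qed

section \<open>Slowly growing weights with square summable increments\<close>

definition decay :: "real \<Rightarrow> real"
  where "decay x = x * ln x * (ln (ln x))\<^sup>2"

text \<open>A discrete antiderivative of 1 / sqrt (decay x), so that squared increments are values
  of 1 / decay. The shift by 4 exceeds e, which keeps ln (ln x) positive.\<close>

definition weight :: "nat \<Rightarrow> real"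
  where "weight k = (\<Sum>j<k. 1 / sqrt (decay (real j + 4)))"

lemma ln_gt_one:
  assumes "4 \<le> (x :: real)" shows "1 < ln x"
proof -
  have "exp 1 < x" using exp_le assms by linarith
  then have "ln (exp 1) < ln x" using assms by (subst ln_less_cancel_iff) auto
  then show ?thesis by simp
qed

lemma lnln_pos: "4 \<le> x \<Longrightarrow> 0 < ln (ln (x :: real))"
  using ln_gt_one by (simp add: ln_gt_zero)

lemma decay_pos: "4 \<le> x \<Longrightarrow> 0 < decay x"
  unfolding decay_def using ln_gt_one [of x] lnln_pos [of x] by (intro mult_pos_pos zero_less_power) auto

lemma decay_mono:
  assumes "4 \<le> x" "x \<le> y" shows "decay x \<le> decay y"
proof -
  have "1 < ln x" "ln x \<le> ln y" using assms ln_gt_one by auto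
  moreover have "0 < ln (ln x)" "ln (ln x) \<le> ln (ln y)" using calculation lnln_pos assms by auto
  ultimately show ?thesis
    unfolding decay_def using assms by (intro mult_mono power_mono) auto
qed

text \<open>The derivative of \<open>- 1 / ln (ln x)\<close> is \<open>1 / decay x\<close>.\<close>

lemma inverse_decay_le:
  assumes "4 \<le> x" shows "1 / decay (x + 1) \<le> 1 / ln (ln x) - 1 / ln (ln (x + 1))"
proof -
  let ?f = "\<lambda>x :: real. - (1 / ln (ln x))"
  have der: "(?f has_real_derivative 1 / decay t) (at t)" if "x \<le> t" for t
  proof -
    have "1 < ln t" "0 < ln (ln t)" "1 < t" using that assms ln_gt_one [of t] lnln_pos [of t] by auto
    then show ?thesis
      unfolding decay_def by (auto intro!: derivative_eq_intros simp: field_simps power2_eq_square)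
  qed
  obtain z where z: "x < z" "z < x + 1" "?f (x + 1) - ?f x = (x + 1 - x) * (1 / decay z)"
    using MVT2 [of x "x + 1" ?f "\<lambda>t. 1 / decay t"] der by auto
  have "1 / decay (x + 1) \<le> 1 / decay z"
    using decay_mono [of z "x + 1"] decay_pos [of z] z assms by (intro frac_le) auto
  then show ?thesis using z by simp
qed

lemma weight_increment: "weight (Suc k) - weight k = 1 / sqrt (decay (real k + 4))"
  by (simp add: weight_def)

lemma weight_mono: "k \<le> l \<Longrightarrow> weight k \<le> weight l"
  unfolding weight_def using decay_pos by (intro sum_mono2) (auto simp: less_imp_le)

lemma weight_nonneg: "0 \<le> weight k"
  using weight_mono [of 0 k] by (simp add: weight_def)

lemma weight_one_pos: "0 < weight 1"
  using decay_pos [of 4] by (simp add: weight_def)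

lemma weight_increment_mono:
  assumes "k \<le> l" "l \<le> Suc k" shows "(weight l - weight k)\<^sup>2 \<le> (weight (Suc k) - weight k)\<^sup>2"
  using assms weight_mono by (intro power_mono) auto

text \<open>The values of 1 / decay at 5, 6, ... telescope by \<open>inverse_decay_le\<close>, which
  bounds the value at \<open>x + 1\<close> for \<open>x\<close> from 4 on; the value at 4 is
  therefore kept apart.\<close>

lemma sum_weight_increments_le:
  "(\<Sum>k<n. (weight (Suc k) - weight k)\<^sup>2) \<le> 1 / decay 4 + 1 / ln (ln 4)"
proof -
  have sq: "(weight (Suc k) - weight k)\<^sup>2 = 1 / decay (real k + 4)" for k
    unfolding weight_increment using decay_pos [of "real k + 4"] by (simp add: power_divide)
  have "(\<Sum>k<Suc n. 1 / decay (real k + 4)) \<le> 1 / decay 4 + (1 / ln (ln 4) - 1 / ln (ln (real n + 4)))"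
  proof (induction n)
    case (Suc n)
    have "1 / decay (real n + 4 + 1) \<le> 1 / ln (ln (real n + 4)) - 1 / ln (ln (real n + 4 + 1))"
      by (rule inverse_decay_le) simp
    then show ?case using Suc by (simp add: algebra_simps)
  qed simp
  moreover have "0 \<le> 1 / ln (ln (real n + 4))" using lnln_pos [of "real n + 4"] by simp
  ultimately have le: "(\<Sum>k<Suc n. 1 / decay (real k + 4)) \<le> 1 / decay 4 + 1 / ln (ln 4)"
    by linarith
  have "(\<Sum>k<n. 1 / decay (real k + 4)) \<le> (\<Sum>k<Suc n. 1 / decay (real k + 4))"
    using decay_pos [of "real n + 4"] by simp
  then show ?thesis unfolding sq using le by linarith
qed

lemma weight_ge: "real k / sqrt (decay (real k + 4)) \<le> weight k"
proof -
  have "(\<Sum>j<k. 1 / sqrt (decay (real k + 4))) \<le> (\<Sum>j<k. 1 / sqrt (decay (real j + 4)))"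
    using decay_mono decay_pos by (intro sum_mono frac_le) auto
  then show ?thesis by (simp add: weight_def)
qed

definition weight_sum :: "nat \<Rightarrow> real" where "weight_sum m = (\<Sum>k=1..m. (weight k)\<^sup>2)"

lemma weight_sum_mono: "m \<le> n \<Longrightarrow> weight_sum m \<le> weight_sum n"
  unfolding weight_sum_def by (intro sum_mono2) auto

lemma weight_sum_nonneg: "0 \<le> weight_sum m"
  unfolding weight_sum_def by (intro sum_nonneg) auto

text \<open>Far below the true growth, but enough to make the lower control function tend to
  infinity.\<close>

lemma weight_sum_ge_linear: "real m * (weight 1)\<^sup>2 \<le> weight_sum m"
proof -
  have "(\<Sum>k=1..m. (weight 1)\<^sup>2) \<le> weight_sum m"
    unfolding weight_sum_def using weight_mono weight_nonneg by (intro sum_mono power_mono) auto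
  then show ?thesis by simp
qed

text \<open>Put a = t / (8 N). At least \<open>a\<close> summands have index about \<open>a\<close>
  or more, and each of them is at least a^2 / decay t. This gives a^3 / decay t, and t^3 / decay t
  is the square of the required rate.\<close>

lemma weight_sum_growth:
  fixes N :: nat and t :: real
  assumes N: "1 \<le> N" and t: "4 * real N + 6 \<le> t"
  shows "(t / (sqrt (ln t) * ln (ln t)))\<^sup>2 \<le> (8 * real N) ^ 3 * weight_sum (nat \<lceil>(t - 2 * real N) / (2 * real N)\<rceil>)"
proof -
  define n where "n = nat \<lceil>(t - 2 * real N) / (2 * real N)\<rceil>"
  define k where "k = nat \<lceil>t / (8 * real N)\<rceil>"
  define a where "a = t / (8 * real N)"
  have N': "1 \<le> real N" using N by simp
  have t0: "10 \<le> t" using t N' by linarith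
  have a: "0 < a" using t0 N' by (simp add: a_def)
  have "(t - 2 * real N) / (2 * real N) = 4 * a - 1" using N' by (simp add: a_def field_simps)
  then have n1: "4 * a - 1 \<le> real n" unfolding n_def by linarith
  have a2: "1 / 2 \<le> a" using t N' by (simp add: a_def field_simps)
  have k1: "a \<le> real k" "real k < a + 1" "1 \<le> k"
    using a unfolding k_def a_def [symmetric] by linarith+
  have "a \<le> t / 8" unfolding a_def using t0 N' by (intro frac_le) auto
  then have k4: "real k + 4 \<le> t" using k1(2) t0 by linarith
  have "a / sqrt (decay t) \<le> weight k"
  proof -
    have "a / sqrt (decay t) \<le> real k / sqrt (decay (real k + 4))"
      using k1 k4 a decay_mono [of "real k + 4" t] decay_pos [of "real k + 4"] by (intro frac_le) auto
    then show ?thesis using weight_ge order_trans by blast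
  qed
  then have "(a / sqrt (decay t))\<^sup>2 \<le> (weight k)\<^sup>2"
    using a decay_pos [of t] t0 by (intro power_mono) auto
  then have wk: "a\<^sup>2 / decay t \<le> (weight k)\<^sup>2" using decay_pos [of t] t0 by (simp add: power_divide)
  have "real (card {k..n}) \<ge> a"
  proof -
    \<comment> \<open>The right-hand side is at least \<open>3 * a - 1\<close>, which is at least
      \<open>a\<close> because \<open>a\<close> is at least 1/2.\<close>
    have "a \<le> real n + 1 - real k" using n1 k1(2) a2 by linarith
    then show ?thesis using k1 a by (cases "k \<le> n") (auto simp: of_nat_diff)
  qed
  then have "a * (a\<^sup>2 / decay t) \<le> real (card {k..n}) * (weight k)\<^sup>2"
    using wk a decay_pos [of t] t0 by (intro mult_mono) auto
  also have "\<dots> = (\<Sum>l\<in>{k..n}. (weight k)\<^sup>2)" by simp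
  also have "\<dots> \<le> (\<Sum>l\<in>{k..n}. (weight l)\<^sup>2)"
    using weight_mono weight_nonneg by (intro sum_mono power_mono) auto
  also have "\<dots> \<le> weight_sum n"
    unfolding weight_sum_def using k1(3) by (intro sum_mono2) auto
  finally have main: "a * (a\<^sup>2 / decay t) \<le> weight_sum n" .
  have ln: "1 < ln t" "0 < ln (ln t)" using t0 ln_gt_one lnln_pos by auto
  have "(t / (sqrt (ln t) * ln (ln t)))\<^sup>2 = t ^ 3 / decay t"
    using ln t0 by (simp add: decay_def power_divide power_mult_distrib power2_eq_square power3_eq_cube)
  also have "\<dots> = (8 * real N) ^ 3 * (a * (a\<^sup>2 / decay t))"
    using N' by (simp add: a_def power2_eq_square power3_eq_cube)
  also have "\<dots> \<le> (8 * real N) ^ 3 * weight_sum n"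
    using main by (intro mult_left_mono) auto
  finally show ?thesis unfolding n_def .
qed

text \<open>The index type of the target is prescribed, so families indexed by sets are carried over
  by an injection and extended by zero. Finite supports turn the infinite sum in the norm into a
  finite one.\<close>

lemma ell2_finite_support_realization:
  fixes \<iota> :: "'b \<Rightarrow> 'i" and X :: "'x \<Rightarrow> 'b set" and g :: "'x \<Rightarrow> 'b \<Rightarrow> real"
  assumes inj: "inj_on \<iota> H" and X: "\<And>x. x \<in> V \<Longrightarrow> finite (X x)" "\<And>x. x \<in> V \<Longrightarrow> X x \<subseteq> H"
    and g: "\<And>x A. x \<in> V \<Longrightarrow> A \<notin> X x \<Longrightarrow> g x A = 0"
  shows "\<exists>F :: 'x \<Rightarrow> 'i ell2. \<forall>x\<in>V. \<forall>y\<in>V. (dist (F x) (F y))\<^sup>2 = (\<Sum>A\<in>X x \<union> X y. (g x A - g y A)\<^sup>2)"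
proof -
  define h where "h x q = (if q \<in> \<iota> ` X x then g x (inv_into H \<iota> q) else 0)" for x q
  define F where "F x = Abs_ell2 (h x)" for x
  have hz: "h x q = 0" if "q \<notin> \<iota> ` X x" for x q using that by (simp add: h_def)
  have hval: "h x (\<iota> A) = g x A" if "x \<in> V" "A \<in> H" for x A
  proof (cases "A \<in> X x")
    case True
    then show ?thesis using inv_into_f_f [OF inj that(2)] by (simp add: h_def)
  next
    case False
    then have "\<iota> A \<notin> \<iota> ` X x" using inj_on_image_mem_iff [OF inj that(2) X(2) [OF that(1)]] by simp
    then show ?thesis using g [OF that(1) False] by (simp add: h_def)
  qed
  have summ: "(\<lambda>q. (h x q)\<^sup>2) summable_on UNIV" if "x \<in> V" for x
  proof -
    have "(\<lambda>q. (h x q)\<^sup>2) summable_on \<iota> ` X x" using X(1) [OF that] by simp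
    moreover have "(\<lambda>q. (h x q)\<^sup>2) summable_on UNIV \<longleftrightarrow> (\<lambda>q. (h x q)\<^sup>2) summable_on \<iota> ` X x"
      by (rule summable_on_cong_neutral) (auto simp: hz)
    ultimately show ?thesis by blast
  qed
  have coordF: "coord (F x) = h x" if "x \<in> V" for x
    unfolding F_def using summ [OF that] by (simp add: Abs_ell2_inverse)
  have "(dist (F x) (F y))\<^sup>2 = (\<Sum>A\<in>X x \<union> X y. (g x A - g y A)\<^sup>2)" if x: "x \<in> V" and y: "y \<in> V" for x y
  proof -
    let ?U = "X x \<union> X y"
    have UH: "?U \<subseteq> H" using X(2) x y by blast
    have "(dist (F x) (F y))\<^sup>2 = (\<Sum>\<^sub>\<infinity>q. (h x q - h y q)\<^sup>2)"
      unfolding dist_norm norm_ell2_square coord_diff coordF [OF x] coordF [OF y] ..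
    also have "\<dots> = (\<Sum>\<^sub>\<infinity>q\<in>\<iota> ` ?U. (h x q - h y q)\<^sup>2)"
      by (rule infsum_cong_neutral) (auto simp: hz image_Un)
    also have "\<dots> = (\<Sum>q\<in>\<iota> ` ?U. (h x q - h y q)\<^sup>2)"
      using X(1) x y by simp
    also have "\<dots> = (\<Sum>A\<in>?U. (h x (\<iota> A) - h y (\<iota> A))\<^sup>2)"
      by (rule sum.reindex_cong [OF inj_on_subset [OF inj UH] refl refl])
    also have "\<dots> = (\<Sum>A\<in>?U. (g x A - g y A)\<^sup>2)"
    proof (rule sum.cong [OF refl])
      fix A assume "A \<in> ?U"
      then show "(h x (\<iota> A) - h y (\<iota> A))\<^sup>2 = (g x A - g y A)\<^sup>2" using UH hval x y by (simp add: subset_eq)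
    qed
    finally show ?thesis .
  qed
  then show ?thesis by blast
qed

section \<open>CAT(0) cube complexes: cubes, strings and the local metric\<close>

locale cat0_cubes =
  fixes K :: "('c, 'a) cube_complex" and N :: nat
  assumes cat0_K: "CAT0_cubical_complex K"
    and dim_le: "\<And>c. c \<in> cubes K \<Longrightarrow> cdim K c \<le> N"
begin

abbreviation d :: "'a \<Rightarrow> 'a \<Rightarrow> real" where "d \<equiv> intrinsic_dist K"

abbreviation cd :: "'c \<Rightarrow> (nat \<Rightarrow> real) \<Rightarrow> (nat \<Rightarrow> real) \<Rightarrow> real"
  where "cd c \<equiv> cube_dist (cdim K c)"

lemma complex_K: "cubical_complex K" and cat0_points: "CAT0_space (points K) d"
  using cat0_K by (simp_all add: CAT0_cubical_complex_def)

lemma metric_points: "Metric_space (points K) d"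
  using cat0_points by (simp add: CAT0_space_def geodesic_space_def)

lemma d_nonneg [simp]: "0 \<le> d x y"
  by (rule Metric_space.nonneg [OF metric_points])

lemma d_commute: "d x y = d y x"
  by (rule Metric_space.commute [OF metric_points])

lemma d_zero: "x \<in> points K \<Longrightarrow> y \<in> points K \<Longrightarrow> d x y = 0 \<longleftrightarrow> x = y"
  by (rule Metric_space.zero [OF metric_points])

lemma d_self [simp]: "x \<in> points K \<Longrightarrow> d x x = 0"
  by (simp add: d_zero)

lemma d_triangle: "x \<in> points K \<Longrightarrow> y \<in> points K \<Longrightarrow> z \<in> points K \<Longrightarrow> d x z \<le> d x y + d y z"
  by (rule Metric_space.triangle [OF metric_points])

lemma chart_in_points [simp]: "c \<in> cubes K \<Longrightarrow> u \<in> cube_of K c \<Longrightarrow> chart K c u \<in> points K"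
  by (auto simp: points_def)

lemma pointsE:
  assumes "x \<in> points K"
  obtains c u where "c \<in> cubes K" "u \<in> cube_of K c" "x = chart K c u"
  using assms by (auto simp: points_def)

lemma chart_inj: "c \<in> cubes K \<Longrightarrow> u \<in> cube_of K c \<Longrightarrow> v \<in> cube_of K c \<Longrightarrow> chart K c u = chart K c v \<Longrightarrow> u = v"
  using complex_K unfolding cubical_complex_def by (meson inj_onD)

lemma cube_upd: "u \<in> cube_of K c \<Longrightarrow> i < cdim K c \<Longrightarrow> 0 \<le> s \<Longrightarrow> s \<le> 1 \<Longrightarrow> u(i := s) \<in> cube_of K c"
  unfolding cube_of_def by (rule unit_cube_upd) auto

lemma cube_flip_upd: "u \<in> cube_of K c \<Longrightarrow> i < cdim K c \<Longrightarrow> s \<in> {0..1} \<Longrightarrow> u(i := flip b s) \<in> cube_of K c"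
  unfolding cube_of_def by (rule unit_cube_upd) (simp_all only: flip_mem)

lemma cube_mem: "u \<in> cube_of K c \<Longrightarrow> i < cdim K c \<Longrightarrow> 0 \<le> u i \<and> u i \<le> 1"
  unfolding cube_of_def by (rule unit_cube_mem)

lemma string_length_props:
  assumes "string_length K x y L"
  shows "x \<in> points K" "y \<in> points K" "0 \<le> L"
  using assms by (induction rule: string_length.induct) auto

lemma d_le_string:
  assumes "string_length K x y L" shows "d x y \<le> L"
proof -
  have "d x y = Inf {L. string_length K x y L}"
    using assms unfolding intrinsic_dist_def by auto
  also have "\<dots> \<le> L"
    using assms string_length_props(3) by (intro cInf_lower bdd_belowI [of _ 0]) auto
  finally show ?thesis .
qed

lemma string_near_d:
  assumes "x \<in> points K" "y \<in> points K" "d x y < r"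
  obtains L where "string_length K x y L" "L < r" "d x y \<le> L"
proof -
  have ex: "\<exists>L. string_length K x y L"
    using complex_K assms unfolding cubical_complex_def by blast
  then have "Inf {L. string_length K x y L} < r"
    using assms(3) by (simp add: intrinsic_dist_def)
  then obtain L where "string_length K x y L" "L < r"
    using ex cInf_lessD [of "{L. string_length K x y L}" r] by blast
  then show ?thesis using that d_le_string by blast
qed

lemma d_le_cd:
  assumes "c \<in> cubes K" "u \<in> cube_of K c" "v \<in> cube_of K c"
  shows "d (chart K c u) (chart K c v) \<le> cd c u v"
  using d_le_string [OF string_step [OF string_refl assms]] assms by simp

text \<open>The common face of \<open>c\<close> and \<open>c'\<close> as seen from a shared point
  with coordinates \<open>u\<close> and \<open>u'\<close>: \<open>I\<close> lists the directions in
  which the face is free, \<open>\<pi>\<close> and \<open>b\<close> are the permutation and the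
  reflections of the gluing. The last clause transports every point reached from \<open>u\<close> by
  changing coordinates in \<open>I\<close> only.\<close>

definition cube_match ::
  "'c \<Rightarrow> (nat \<Rightarrow> real) \<Rightarrow> 'c \<Rightarrow> (nat \<Rightarrow> real) \<Rightarrow> nat set \<Rightarrow> (nat \<Rightarrow> nat) \<Rightarrow> (nat \<Rightarrow> bool) \<Rightarrow> bool"
  where "cube_match c u c' u' I \<pi> b \<longleftrightarrow>
    I \<subseteq> {..<cdim K c} \<and> inj_on \<pi> I \<and> \<pi> ` I \<subseteq> {..<cdim K c'} \<and>
    (\<forall>i<cdim K c. i \<notin> I \<longrightarrow> u i = 0 \<or> u i = 1) \<and>
    (\<forall>i\<in>I. u' (\<pi> i) = flip (b i) (u i)) \<and>
    (\<forall>v\<in>cube_of K c. (\<forall>i<cdim K c. i \<notin> I \<longrightarrow> u i = v i) \<longrightarrow>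
      (\<exists>v'\<in>cube_of K c'. chart K c v = chart K c' v' \<and> (\<forall>i\<in>I. v' (\<pi> i) = flip (b i) (v i)) \<and>
        (\<forall>j<cdim K c'. j \<notin> \<pi> ` I \<longrightarrow> v' j = u' j) \<and> cd c' v' u' = cd c v u))"

lemma cube_matchD:
  assumes "cube_match c u c' u' I \<pi> b"
  shows "I \<subseteq> {..<cdim K c}" "inj_on \<pi> I" "\<pi> ` I \<subseteq> {..<cdim K c'}"
    "\<And>i. i < cdim K c \<Longrightarrow> i \<notin> I \<Longrightarrow> u i = 0 \<or> u i = 1"
    "\<And>i. i \<in> I \<Longrightarrow> u' (\<pi> i) = flip (b i) (u i)"
  using assms by (simp_all add: cube_match_def)

lemma cube_match_extend:
  assumes "cube_match c u c' u' I \<pi> b" "v \<in> cube_of K c" "\<And>i. i < cdim K c \<Longrightarrow> i \<notin> I \<Longrightarrow> u i = v i"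
  obtains v' where "v' \<in> cube_of K c'" "chart K c v = chart K c' v'"
    "\<forall>i\<in>I. v' (\<pi> i) = flip (b i) (v i)"
    "\<forall>j<cdim K c'. j \<notin> \<pi> ` I \<longrightarrow> v' j = u' j" "cd c' v' u' = cd c v u"
proof -
  have "\<exists>v'\<in>cube_of K c'. chart K c v = chart K c' v' \<and> (\<forall>i\<in>I. v' (\<pi> i) = flip (b i) (v i)) \<and>
        (\<forall>j<cdim K c'. j \<notin> \<pi> ` I \<longrightarrow> v' j = u' j) \<and> cd c' v' u' = cd c v u"
    using assms by (simp add: cube_match_def)
  then show ?thesis using that by blast
qed

lemma cubes_meet:
  assumes c: "c \<in> cubes K" "u \<in> cube_of K c" and c': "c' \<in> cubes K" "u' \<in> cube_of K c'"
    and eq: "chart K c u = chart K c' u'"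
  obtains I \<pi> b where "cube_match c u c' u' I \<pi> b"
proof -
  have "chart K c u \<in> chart K c ` cube_of K c \<inter> chart K c' ` cube_of K c'"
    using c(2) c'(2) unfolding eq by (metis IntI imageI eq)
  then have "chart K c ` cube_of K c \<inter> chart K c' ` cube_of K c' \<noteq> {}"
    by (metis empty_iff)
  note complex_K [unfolded cubical_complex_def, THEN conjunct2, THEN conjunct1, THEN bspec, OF c(1),
    THEN bspec, OF c'(1), THEN mp, OF this]
  then obtain T T' h where fi: "face_isometry (cdim K c) T (cdim K c') T' h"
    and h: "\<And>u u'. u \<in> cube_of K c \<Longrightarrow> u' \<in> cube_of K c' \<Longrightarrow>
          chart K c u = chart K c' u' \<longleftrightarrow> u \<in> T \<and> u' = h u"
    by auto
  have bij: "bij_betw h T T'"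
    and iso: "\<And>u v. u \<in> T \<Longrightarrow> v \<in> T \<Longrightarrow> cd c' (h u) (h v) = cd c u v"
    and cf: "cube_face (cdim K c') T'"
    using fi by (simp_all add: face_isometry_def)
  have T': "w \<in> cube_of K c'" if "w \<in> T'" for w
    using cube_face_normal_form [OF cf] that unfolding cube_of_def by blast
  obtain I J \<pi> b where I: "I \<subseteq> {..<cdim K c}" and J: "J \<subseteq> {..<cdim K c'}" and bij\<pi>: "bij_betw \<pi> I J"
    and f1: "\<forall>u\<in>T. \<forall>i<cdim K c. i \<notin> I \<longrightarrow> u i = 0 \<or> u i = 1"
    and f2: "\<forall>u\<in>T. \<forall>v\<in>unit_cube (cdim K c). (\<forall>i<cdim K c. i \<notin> I \<longrightarrow> u i = v i) \<longrightarrow> v \<in> T"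
    and f3: "\<forall>w\<in>T'. \<forall>w'\<in>T'. \<forall>j<cdim K c'. j \<notin> J \<longrightarrow> w j = w' j"
    and f5: "\<forall>u\<in>T. \<forall>i\<in>I. h u (\<pi> i) = flip (b i) (u i)"
    using face_isometry_coordinates [OF fi] by (elim exE conjE) (rule that; assumption)
  have \<pi>I: "\<pi> ` I = J" "inj_on \<pi> I" using bij\<pi> by (simp_all add: bij_betw_def)
  have u: "u \<in> T" "u' = h u" using h [OF c(2) c'(2)] eq by simp_all
  have hT: "h v \<in> T'" if "v \<in> T" for v using bij that bij_betwE by blast
  have ext: "\<exists>v'\<in>cube_of K c'. chart K c v = chart K c' v' \<and> (\<forall>i\<in>I. v' (\<pi> i) = flip (b i) (v i)) \<and>
          (\<forall>j<cdim K c'. j \<notin> \<pi> ` I \<longrightarrow> v' j = u' j) \<and> cd c' v' u' = cd c v u"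
    if v: "v \<in> cube_of K c" "\<And>i. i < cdim K c \<Longrightarrow> i \<notin> I \<Longrightarrow> u i = v i" for v
  proof -
    have "v \<in> unit_cube (cdim K c)" using v(1) by (simp add: cube_of_def)
    then have vT: "v \<in> T"
      by (rule f2 [THEN bspec, OF u(1), THEN bspec, THEN mp]) (use v(2) in simp)
    have 1: "chart K c v = chart K c' (h v)"
      using h [OF v(1) T' [OF hT [OF vT]]] vT by simp
    have 2: "\<forall>j<cdim K c'. j \<notin> \<pi> ` I \<longrightarrow> h v j = u' j"
      using f3 [THEN bspec, OF hT [OF vT], THEN bspec, OF hT [OF u(1)]] unfolding u(2) \<pi>I(1) .
    have 3: "cd c' (h v) u' = cd c v u"
      using iso [OF vT u(1)] u(2) by simp
    show ?thesis
      using 1 2 3 f5 [THEN bspec, OF vT] by (intro bexI [OF _ T' [OF hT [OF vT]]] conjI)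
  qed
  have g1: "\<pi> ` I \<subseteq> {..<cdim K c'}" using \<pi>I J by simp
  have g2: "\<forall>i\<in>I. u' (\<pi> i) = flip (b i) (u i)"
    using f5 u by simp
  have g3: "\<forall>i<cdim K c. i \<notin> I \<longrightarrow> u i = 0 \<or> u i = 1"
    using f1 [THEN bspec, OF u(1)] .
  have "cube_match c u c' u' I \<pi> b"
    unfolding cube_match_def
  proof (intro conjI I \<pi>I(2) g1 g2 g3 ballI impI)
    fix v assume "v \<in> cube_of K c" "\<forall>i<cdim K c. i \<notin> I \<longrightarrow> u i = v i"
    then show "\<exists>v'\<in>cube_of K c'. chart K c v = chart K c' v' \<and> (\<forall>i\<in>I. v' (\<pi> i) = flip (b i) (v i)) \<and>
        (\<forall>j<cdim K c'. j \<notin> \<pi> ` I \<longrightarrow> v' j = u' j) \<and> cd c' v' u' = cd c v u"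
      by (intro ext) blast+
  qed
  then show ?thesis by (rule that)
qed

text \<open>Coordinates off \<open>I\<close> are 0 or 1, so a coordinate strictly between them is
  free in the common face, which then contains the whole segment in direction
  \<open>i\<close>.\<close>

lemma direction_transfer:
  assumes c: "c \<in> cubes K" "u \<in> cube_of K c" and c': "c' \<in> cubes K" "u' \<in> cube_of K c'"
    and eq: "chart K c u = chart K c' u'" and i: "i < cdim K c" "0 < u i" "u i < 1"
  obtains i' b where "i' < cdim K c'" "0 < u' i'" "u' i' < 1" "u' i' = flip b (u i)"
    "\<And>s. s \<in> {0..1} \<Longrightarrow> chart K c (u(i := s)) = chart K c' (u'(i' := flip b s))"
proof -
  obtain I \<pi> b where match: "cube_match c u c' u' I \<pi> b"
    using cubes_meet [OF c c' eq] by blast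
  note I = cube_matchD(1-3) [OF match] and f1 = cube_matchD(4) [OF match] and f2 = cube_matchD(5) [OF match]
  have iI: "i \<in> I" using f1 [OF i(1)] i by auto
  then have j: "\<pi> i < cdim K c'" using I(3) by auto
  have "chart K c (u(i := s)) = chart K c' (u'(\<pi> i := flip (b i) s))" if s: "s \<in> {0..1}" for s
  proof -
    have us: "u(i := s) \<in> cube_of K c" using c(2) i(1) s by (intro cube_upd) auto
    have "u k = (u(i := s)) k" if "k \<notin> I" for k using that iI by auto
    then obtain v' where v': "v' \<in> cube_of K c'" "chart K c (u(i := s)) = chart K c' v'"
        "\<forall>k\<in>I. v' (\<pi> k) = flip (b k) ((u(i := s)) k)" "\<forall>j<cdim K c'. j \<notin> \<pi> ` I \<longrightarrow> v' j = u' j"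
      by (rule cube_match_extend [OF match us]) (assumption | rule that)+
    have "v' = u'(\<pi> i := flip (b i) s)"
    proof (rule unit_cube_eqI)
      show "v' \<in> unit_cube (cdim K c')" using v'(1) by (simp add: cube_of_def)
      show "u'(\<pi> i := flip (b i) s) \<in> unit_cube (cdim K c')"
        using cube_flip_upd [OF c'(2) j s] by (simp add: cube_of_def)
      fix k assume k: "k < cdim K c'"
      show "v' k = (u'(\<pi> i := flip (b i) s)) k"
      proof (cases "k \<in> \<pi> ` I")
        case True
        then obtain l where l: "l \<in> I" "k = \<pi> l" by blast
        have "\<pi> l \<noteq> \<pi> i" if "l \<noteq> i" using that l iI I(2) by (auto dest: inj_onD)
        then show ?thesis using v'(3) [THEN bspec, OF l(1)] f2 [OF l(1)] l(2) by (cases "l = i") simp_all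
      next
        case False
        then show ?thesis using v'(4) k iI by auto
      qed
    qed
    then show ?thesis using v'(2) by simp
  qed
  moreover have "0 < u' (\<pi> i) \<and> u' (\<pi> i) < 1" using f2 [OF iI] i by simp
  ultimately show ?thesis using that [of "\<pi> i" "b i"] j f2 [OF iI] by blast
qed

section \<open>Vertices and the metric near a point\<close>

definition corner :: "'c \<Rightarrow> (nat \<Rightarrow> real) \<Rightarrow> bool"
  where "corner c u \<longleftrightarrow> c \<in> cubes K \<and> u \<in> cube_of K c \<and> (\<forall>i<cdim K c. u i = 0 \<or> u i = 1)"

definition verts :: "'a set" where "verts = {chart K c u | c u. corner c u}"

lemma verts_points: "x \<in> verts \<Longrightarrow> x \<in> points K"
  by (auto simp: verts_def corner_def)

text \<open>A fractional coordinate in one cube would transfer to a fractional coordinate in the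
  other; hence being a corner depends on the point alone.\<close>

lemma corner_transfer:
  assumes "corner c u" "c' \<in> cubes K" "u' \<in> cube_of K c'" "chart K c u = chart K c' u'"
  shows "corner c' u'"
proof (rule ccontr)
  assume "\<not> corner c' u'"
  then obtain i where i: "i < cdim K c'" "u' i \<noteq> 0" "u' i \<noteq> 1"
    using assms by (auto simp: corner_def)
  then have "0 < u' i" "u' i < 1" using cube_mem [OF assms(3) i(1)] by auto
  moreover have "c \<in> cubes K" "u \<in> cube_of K c" using assms by (auto simp: corner_def)
  ultimately obtain i' where "i' < cdim K c" "0 < u i'" "u i' < 1"
    using direction_transfer [OF assms(2,3) _ _ assms(4) [symmetric] i(1)] by metis
  then show False using assms(1) by (auto simp: corner_def)
qed

lemma vert_corner: "c \<in> cubes K \<Longrightarrow> u \<in> cube_of K c \<Longrightarrow> chart K c u \<in> verts \<Longrightarrow> corner c u"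
  unfolding verts_def using corner_transfer by fastforce

text \<open>Setting the free coordinates of the common face to 0 yields a corner of it. This lets an
  edge path follow a string from cube to cube.\<close>

lemma common_corner:
  assumes c: "c \<in> cubes K" "u \<in> cube_of K c" and c': "c' \<in> cubes K" "u' \<in> cube_of K c'"
    and eq: "chart K c u = chart K c' u'"
  obtains w w' where "corner c w" "corner c' w'" "chart K c w = chart K c' w'"
proof -
  obtain I \<pi> b where match: "cube_match c u c' u' I \<pi> b"
    using cubes_meet [OF c c' eq] by blast
  note I = cube_matchD(1-3) [OF match] and f1 = cube_matchD(4) [OF match] and f2 = cube_matchD(5) [OF match]
  define w where "w = (\<lambda>i. if i \<in> I then 0 else u i)"
  have w: "w \<in> cube_of K c"
    using c(2) I(1) by (auto simp: w_def cube_of_def unit_cube_def PiE_iff extensional_def)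
  have cw: "corner c w" using w c f1 by (auto simp: corner_def w_def)
  obtain w' where "w' \<in> cube_of K c'" "chart K c w = chart K c' w'"
  proof (rule cube_match_extend [OF match w])
    show "u i = w i" if "i \<notin> I" for i using that by (simp add: w_def)
  qed (rule that)
  then show ?thesis using that cw corner_transfer [OF cw c'(1)] by blast
qed

text \<open>For \<open>e \<le> 1\<close> this says that the faces of the cube that miss the point
  are at distance at least \<open>e\<close> from it.\<close>

definition margin :: "real \<Rightarrow> 'c \<Rightarrow> (nat \<Rightarrow> real) \<Rightarrow> bool"
  where "margin e c u \<longleftrightarrow> (\<forall>i<cdim K c. u i = 0 \<or> u i = 1 \<or> (e \<le> u i \<and> e \<le> 1 - u i))"

lemma margin_transfer:
  assumes c: "c \<in> cubes K" "u \<in> cube_of K c" and c': "c' \<in> cubes K" "u' \<in> cube_of K c'"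
    and eq: "chart K c u = chart K c' u'" and "margin e c u"
  shows "margin e c' u'"
  unfolding margin_def
proof (intro allI impI)
  fix i assume i: "i < cdim K c'"
  show "u' i = 0 \<or> u' i = 1 \<or> (e \<le> u' i \<and> e \<le> 1 - u' i)"
  proof (cases "0 < u' i \<and> u' i < 1")
    case True
    then obtain i' b where i': "i' < cdim K c" "0 < u i'" "u i' < 1" "u i' = flip b (u' i)"
      using direction_transfer [OF c' c eq [symmetric] i] by blast
    then have "e \<le> u i' \<and> e \<le> 1 - u i'" using \<open>margin e c u\<close> by (auto simp: margin_def)
    then show ?thesis using i'(4) by (auto simp: flip_def split: if_splits)
  next
    case False
    then show ?thesis using cube_mem [OF c'(2) i] by auto
  qed
qed

text \<open>A string issuing from \<open>x\<close> that is too short to reach a face missing \<open>x\<close> stays in the open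
  star of \<open>x\<close>; all its points then lie in cubes containing \<open>x\<close>.\<close>

lemma string_local:
  assumes "string_length K x y L" "c0 \<in> cubes K" "u0 \<in> cube_of K c0" "x = chart K c0 u0"
    and "margin e c0 u0" "e \<le> 1" "L < e" "c \<in> cubes K" "w \<in> cube_of K c" "y = chart K c w"
  shows "\<exists>u\<in>cube_of K c. x = chart K c u \<and> cd c u w \<le> L"
  using assms
proof (induction arbitrary: c w rule: string_length.induct)
  case (string_refl x)
  show ?case by (rule bexI [of _ w]) (use string_refl.prems(7-9) in simp_all)
next
  case (string_step x c1 u1 L v1)
  have le: "0 \<le> L" using string_length_props [OF string_step.hyps(1)] by simp
  have "L < e" using string_step.prems(6) cube_dist_nonneg [of "cdim K c1" u1 v1] by linarith
  then obtain u where u: "u \<in> cube_of K c1" "x = chart K c1 u" "cd c1 u u1 \<le> L"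
    using string_step.IH [OF string_step.prems(1-5) _ string_step.hyps(2,3) refl] by blast
  then have uv: "cd c1 u v1 \<le> L + cd c1 u1 v1"
    using cube_dist_triangle [of "cdim K c1" u v1 u1] by linarith
  have mu: "margin e c1 u"
    using margin_transfer [OF string_step.prems(1,2) string_step.hyps(2) u(1)] string_step.prems u by simp
  obtain I \<pi> b where match: "cube_match c1 v1 c w I \<pi> b"
    using cubes_meet [OF string_step.hyps(2,4) string_step.prems(7,8,9)] by blast
  note I = cube_matchD(1-3) [OF match] and f1 = cube_matchD(4) [OF match] and f2 = cube_matchD(5) [OF match]
  have "v1 i = u i" if i: "i < cdim K c1" "i \<notin> I" for i
  proof -
    have "\<bar>u i - v1 i\<bar> < e"
      using coord_diff_le_cube_dist [OF i(1), of u v1] uv string_step.prems(6) by linarith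
    then show ?thesis
      using f1 [OF i] mu i(1) \<open>e \<le> 1\<close> unfolding margin_def by force
  qed
  then obtain v' where "v' \<in> cube_of K c" "chart K c1 u = chart K c v'" "cd c v' w = cd c1 u v1"
    by (rule cube_match_extend [OF match u(1)]) (assumption | rule that)+
  then show ?case using u(2) uv by auto
qed

text \<open>Near-optimal strings between the two points are local, so they bound the distance inside
  \<open>c\<close>; letting their excess tend to 0 gives equality.\<close>

lemma d_local:
  assumes "c0 \<in> cubes K" "u0 \<in> cube_of K c0" "margin e c0 u0" "e \<le> 1"
    and "c \<in> cubes K" "w \<in> cube_of K c" "d (chart K c0 u0) (chart K c w) < e"
  obtains u where "u \<in> cube_of K c" "chart K c0 u0 = chart K c u" "cd c u w = d (chart K c0 u0) (chart K c w)"
proof -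
  let ?x = "chart K c0 u0" and ?y = "chart K c w"
  have ex: "\<exists>u\<in>cube_of K c. ?x = chart K c u \<and> cd c u w < r" if r: "d ?x ?y < r" "r \<le> e" for r
  proof -
    obtain L where "string_length K ?x ?y L" "L < r"
      using string_near_d [of ?x ?y r] assms r by auto
    then show ?thesis
      using string_local [of ?x ?y L c0 u0 e c w] assms r by fastforce
  qed
  obtain u where u: "u \<in> cube_of K c" "?x = chart K c u"
    using ex [OF assms(7)] by blast
  \<comment> \<open>\<open>ex\<close> may produce a different representative for each
    \<open>r\<close>; injectivity of the chart identifies them all with \<open>u\<close>.\<close>
  have "cd c u w < r" if "d ?x ?y < r" "r \<le> e" for r
    using ex [OF that] u chart_inj [OF assms(5) u(1)] by metis
  then have "cd c u w \<le> d ?x ?y"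
    using assms(7) by (meson dense linorder_not_le order_less_imp_le less_le_trans order.strict_trans)
  moreover have "d ?x ?y \<le> cd c u w"
    using d_le_cd [OF assms(5) u(1) assms(6)] u(2) by simp
  ultimately show ?thesis using that u by simp
qed

subsection \<open>Convexity along edges\<close>

text \<open>CAT(0) comparison between the vertex \<open>p\<close> and a point of the opposite side,
  the Euclidean distance being given by Stewart's theorem. For t = 1/2 it is the Bruhat-Tits
  inequality.\<close>

lemma cn_inequality:
  assumes p: "p \<in> points K" and seg: "geodesic_segment (points K) d q r S"
    and qr: "q \<in> points K" "r \<in> points K"
    and m: "m \<in> S" "d q m = t * d q r" and t: "0 \<le> t" "t \<le> 1"
  shows "(d p m)\<^sup>2 \<le> (1 - t) * (d p q)\<^sup>2 + t * (d p r)\<^sup>2 - t * (1 - t) * (d q r)\<^sup>2"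
proof -
  have geo: "\<forall>x\<in>points K. \<forall>y\<in>points K. \<exists>S. geodesic_segment (points K) d x y S"
    using cat0_points unfolding CAT0_space_def geodesic_space_def by (elim conjE)
  obtain A where A: "geodesic_segment (points K) d p q A" using geo p qr by blast
  obtain C where C: "geodesic_segment (points K) d r p C" using geo p qr by blast
  obtain p' q' r' :: "real^2" where pqr: "dist p' q' = d p q" "dist q' r' = d q r" "dist r' p' = d r p"
  proof (rule comparison_triangle_exists [of "d p q" "d q r" "d r p"])
    show "d p q \<le> d q r + d r p" "d q r \<le> d p q + d r p" "d r p \<le> d p q + d q r"
      using d_triangle [of p r q] d_triangle [of q p r] d_triangle [of r q p] p qr
        d_commute [of p r] d_commute [of q p] d_commute [of r q] by simp_all
  qed (auto intro: that)
  have pA: "p \<in> A"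
    using A unfolding geodesic_segment_def by (metis atLeastAtMost_iff d_nonneg image_eqI order_refl)
  have cp: "comparison_point d p A p' q' p p'"
    using pA p unfolding comparison_point_def by simp
  define m' where "m' = q' + t *\<^sub>R (r' - q')"
  have m'seg: "m' \<in> closed_segment q' r'"
    unfolding closed_segment_def mem_Collect_eq using t
    by (intro exI [of _ t]) (simp add: m'_def algebra_simps)
  have "dist q' m' = t * dist q' r'"
    using t by (simp add: m'_def dist_norm norm_minus_commute)
  then have cm: "comparison_point d q S q' r' m m'"
    using m m'seg pqr by (simp add: comparison_point_def)
  have "\<forall>x x' y y'. (comparison_point d p A p' q' x x' \<or> comparison_point d q S q' r' x x' \<or>
      comparison_point d r C r' p' x x') \<and> (comparison_point d p A p' q' y y' \<or>
      comparison_point d q S q' r' y y' \<or> comparison_point d r C r' p' y y') \<longrightarrow> d x y \<le> dist x' y'"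
    using cat0_points p qr A C seg pqr unfolding CAT0_space_def Let_def by blast
  then have "d p m \<le> dist p' m'" using cp cm by blast
  then have "(d p m)\<^sup>2 \<le> (dist p' m')\<^sup>2" by (intro power_mono) simp_all
  then show ?thesis
    unfolding m'_def stewart using pqr d_commute by (simp add: dist_commute)
qed

section \<open>Unit segments parallel to a coordinate direction\<close>

definition dirn :: "'c \<Rightarrow> (nat \<Rightarrow> real) \<Rightarrow> nat \<Rightarrow> bool"
  where "dirn c u i \<longleftrightarrow> c \<in> cubes K \<and> u \<in> cube_of K c \<and> i < cdim K c"

text \<open>The value of \<open>u\<close> at \<open>i\<close> is overwritten. The bit
  \<open>b\<close> fixes the orientation, so that a direction can pass through a gluing that
  reverses it without a change of the parameter \<open>s\<close>.\<close>

definition line :: "'c \<Rightarrow> (nat \<Rightarrow> real) \<Rightarrow> nat \<Rightarrow> bool \<Rightarrow> real \<Rightarrow> 'a"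
  where "line c u i b s = chart K c (u(i := flip b s))"

lemma line_in_points [simp]: "dirn c u i \<Longrightarrow> s \<in> {0..1} \<Longrightarrow> line c u i b s \<in> points K"
  unfolding line_def dirn_def by (elim conjE) (intro chart_in_points cube_flip_upd)

text \<open>Pythagoras in the cube. The pair consists of the distance orthogonal to direction
  \<open>i\<close> and the difference of the parameters; later estimates keep this planar
  picture.\<close>

lemma d_parallel_lines_le:
  assumes "dirn c u i" "v \<in> cube_of K c" "s \<in> {0..1}" "t \<in> {0..1}"
  shows "d (line c u i b s) (line c v i b t) \<le> norm (cd c (u(i := 0)) (v(i := 0)), t - s)"
proof -
  have "(flip b s - flip b t)\<^sup>2 = (t - s)\<^sup>2" by (simp add: flip_def power2_commute)
  then have "(cd c (u(i := flip b s)) (v(i := flip b t)))\<^sup>2 = (norm (cd c (u(i := 0)) (v(i := 0)), t - s))\<^sup>2"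
    using cube_dist_upd [of i "cdim K c" u "flip b s" v "flip b t"] assms(1)
    by (simp add: dirn_def norm_Pair)
  then have "cd c (u(i := flip b s)) (v(i := flip b t)) = norm (cd c (u(i := 0)) (v(i := 0)), t - s)"
    by simp
  moreover have "u(i := flip b s) \<in> cube_of K c" "v(i := flip b t) \<in> cube_of K c" "c \<in> cubes K"
    using assms cube_flip_upd unfolding dirn_def by blast+
  ultimately show ?thesis unfolding line_def using d_le_cd by metis
qed

lemma margin_exists:
  assumes u: "u \<in> cube_of K c"
  obtains e where "0 < e" "e \<le> 1" "margin e c u"
proof -
  define F where "F = {j. j < cdim K c \<and> 0 < u j \<and> u j < 1}"
  define E where "E = insert 1 (u ` F \<union> (\<lambda>j. 1 - u j) ` F)"
  have "finite F" unfolding F_def by simp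
  then have fin: "finite E" by (simp add: E_def)
  have pos: "0 < Min E" using fin by (subst Min_gr_iff) (auto simp: E_def F_def)
  have le: "Min E \<le> x" if "x \<in> E" for x using fin that by simp
  have "u j = 0 \<or> u j = 1 \<or> (Min E \<le> u j \<and> Min E \<le> 1 - u j)" if j: "j < cdim K c" for j
  proof (cases "j \<in> F")
    case True
    then show ?thesis using le [of "u j"] le [of "1 - u j"] by (simp add: E_def)
  next
    case False
    then show ?thesis using cube_mem [OF u j] j by (auto simp: F_def)
  qed
  then have "margin (Min E) c u" by (simp add: margin_def)
  moreover have "Min E \<le> 1" using le [of 1] by (simp add: E_def)
  ultimately show ?thesis using that pos by blast
qed

lemma d_line_le:
  assumes "dirn c u i" "s \<in> {0..1}" "t \<in> {0..1}"
  shows "d (line c u i b s) (line c u i b t) \<le> \<bar>s - t\<bar>"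
  using d_parallel_lines_le [OF assms(1) _ assms(2,3), of u b] assms(1)
  by (simp add: dirn_def norm_Pair abs_minus_commute)

text \<open>Interior pieces of a segment in a cube are uniformly far from the faces that miss them, hence
  locally isometric; in a CAT(0) space local geodesics are geodesics.\<close>

lemma d_line_interior:
  assumes l: "dirn c u i" and st: "0 < s" "s < t" "t < 1"
  shows "d (line c u i False s) (line c u i False t) = t - s"
proof -
  let ?l = "line c u i False"
  have c: "c \<in> cubes K" and u: "u \<in> cube_of K c" and i: "i < cdim K c"
    using l by (simp_all add: dirn_def)
  obtain e where e: "0 < e" "e \<le> 1" "margin e c u" using margin_exists [OF u] by blast
  \<comment> \<open>A margin valid at every point of the piece from \<open>s\<close> to
    \<open>t\<close>, where the moving coordinate stays at least \<open>s\<close> and at most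
    \<open>t\<close>.\<close>
  define g where "g = min e (min s (1 - t))"
  have g: "0 < g" "g \<le> 1" using e st by (simp_all add: g_def)
  have loc: "d (?l x) (?l y) = \<bar>x - y\<bar>" if xy: "s \<le> x" "x \<le> t" "s \<le> y" "y \<le> t" "\<bar>x - y\<bar> < g" for x y
  proof -
    have 01: "x \<in> {0..1}" "y \<in> {0..1}" using xy st by auto
    have ux: "u(i := x) \<in> cube_of K c" "u(i := y) \<in> cube_of K c"
      using cube_upd [OF u i] 01 by simp_all
    have mx: "margin g c (u(i := x))"
      unfolding margin_def
    proof (intro allI impI)
      fix j assume "j < cdim K c"
      then have "u j = 0 \<or> u j = 1 \<or> (e \<le> u j \<and> e \<le> 1 - u j)" using e(3) by (simp add: margin_def)
      moreover have "g \<le> e" "g \<le> x" "g \<le> 1 - x" using xy by (simp_all add: g_def)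
      ultimately show "(u(i := x)) j = 0 \<or> (u(i := x)) j = 1 \<or> (g \<le> (u(i := x)) j \<and> g \<le> 1 - (u(i := x)) j)"
        by (cases "j = i") auto
    qed
    have le: "d (?l x) (?l y) \<le> \<bar>x - y\<bar>" by (rule d_line_le [OF l 01])
    then have "d (chart K c (u(i := x))) (chart K c (u(i := y))) < g"
      using xy by (simp add: line_def)
    then obtain w where w: "w \<in> cube_of K c" "chart K c (u(i := x)) = chart K c w"
      "cd c w (u(i := y)) = d (chart K c (u(i := x))) (chart K c (u(i := y)))"
      using d_local [OF c ux(1) mx g(2) c ux(2)] by blast
    have "w = u(i := x)" using chart_inj [OF c ux(1) w(1)] w(2) by simp
    then show ?thesis using w(3) cube_dist_upd_same [OF i] by (simp add: line_def)
  qed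
  obtain n :: nat where n: "2 * (t - s) / g < real n" using reals_Archimedean2 by blast
  have n0: "0 < real n" using n g st by (smt (verit) divide_pos_pos)
  define h where "h = (t - s) / real n"
  have h: "0 < h" "2 * h < g" "s + real n * h = t"
    using n n0 g st by (simp_all add: h_def field_simps)
  \<comment> \<open>In the inductive step the point at \<open>q + h\<close> is the midpoint of a
    geodesic of length \<open>2 * h\<close>. Its distance from the start is known, and convexity
    then forces the far end to be at least k + 2 steps away.\<close>
  have ext: "s + real k * h \<le> t \<longrightarrow> d (?l s) (?l (s + real k * h)) = real k * h" for k
  proof (induction k rule: induct_nat_012)
    case 0
    have "?l s \<in> points K" using line_in_points [OF l] st by simp
    then show ?case by simp
  next
    case 1
    have "d (?l s) (?l (s + h)) = h" if "s + h \<le> t"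
    proof -
      have "\<bar>s - (s + h)\<bar> = h" "h < g" using h by auto
      then show ?thesis using loc [of s "s + h"] that st h by simp
    qed
    then show ?case by simp
  next
    case (ge2 k)
    show ?case
    proof
      assume kt: "s + real (Suc (Suc k)) * h \<le> t"
      define q where "q = s + real k * h"
      have eq: "s + real (Suc k) * h = q + h" "s + real (Suc (Suc k)) * h = q + 2 * h"
        by (simp_all add: q_def algebra_simps)
      have kt: "q + 2 * h \<le> t" using kt eq by simp
      have sq: "s \<le> q" using h by (simp add: q_def)
      have dist_loc: "d (?l (q + x)) (?l (q + y)) = \<bar>x - y\<bar>" if "x \<in> {0..2 * h}" "y \<in> {0..2 * h}" for x y
      proof -
        have "\<bar>(q + x) - (q + y)\<bar> < g" using that h by auto
        then have "d (?l (q + x)) (?l (q + y)) = \<bar>(q + x) - (q + y)\<bar>"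
          using that sq kt by (intro loc) auto
        then show ?thesis by simp
      qed
      have pts: "?l (q + x) \<in> points K" if "x \<in> {0..2 * h}" for x
        using that sq kt st by (intro line_in_points [OF l]) auto
      have "?l s \<in> points K" using st by (intro line_in_points [OF l]) auto
      have "d (?l s) (?l q) = real k * h" "d (?l s) (?l (q + h)) = real (Suc k) * h"
        using ge2 kt h unfolding q_def [symmetric] eq by auto
      moreover have dqr: "d (?l q) (?l (q + 2 * h)) = 2 * h" using dist_loc [of 0 "2 * h"] h by auto
      moreover have dqm: "d (?l q) (?l (q + h)) = h" using dist_loc [of 0 h] h by auto
      moreover have "(d (?l s) (?l (q + h)))\<^sup>2 \<le> (1 - 1/2) * (d (?l s) (?l q))\<^sup>2 + 1/2 * (d (?l s) (?l (q + 2 * h)))\<^sup>2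
          - 1/2 * (1 - 1/2) * (d (?l q) (?l (q + 2 * h)))\<^sup>2"
      proof (rule cn_inequality)
        show "geodesic_segment (points K) d (?l q) (?l (q + 2 * h)) ((\<lambda>x. ?l (q + x)) ` {0..2 * h})"
          unfolding geodesic_segment_def dqr
          by (intro exI [of _ "\<lambda>x. ?l (q + x)"]) (use pts dist_loc in auto)
        show "?l (q + h) \<in> (\<lambda>x. ?l (q + x)) ` {0..2 * h}"
          using h by (intro image_eqI [of _ _ h]) auto
        show "d (?l q) (?l (q + h)) = 1/2 * d (?l q) (?l (q + 2 * h))" using dqr dqm by simp
        show "?l s \<in> points K" by fact
        show "?l q \<in> points K" using pts [of 0] h by simp
        show "?l (q + 2 * h) \<in> points K" using pts [of "2 * h"] h by simp
      qed simp_all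
      ultimately have "(real (Suc (Suc k)) * h)\<^sup>2 \<le> (d (?l s) (?l (q + 2 * h)))\<^sup>2"
        by (simp add: power2_eq_square algebra_simps)
      then have "real (Suc (Suc k)) * h \<le> d (?l s) (?l (q + 2 * h))"
        by (rule power2_le_imp_le) simp
      moreover have "d (?l s) (?l (q + 2 * h)) \<le> \<bar>s - (q + 2 * h)\<bar>"
        using st sq kt h by (intro d_line_le [OF l]) auto
      moreover have "\<bar>s - (q + 2 * h)\<bar> = q + 2 * h - s" using sq h by simp
      moreover have "q + 2 * h - s = real (Suc (Suc k)) * h" by (simp add: q_def algebra_simps)
      ultimately show "d (?l s) (?l (s + real (Suc (Suc k)) * h)) = real (Suc (Suc k)) * h"
        unfolding eq by linarith
    qed
  qed
  then show ?thesis using ext [of n] h(3) by simp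
qed

lemma d_line:
  assumes l: "dirn c u i" and st: "s \<in> {0..1}" "t \<in> {0..1}"
  shows "d (line c u i b s) (line c u i b t) = \<bar>s - t\<bar>"
proof -
  let ?l = "line c u i False"
  have main: "t - s \<le> d (?l s) (?l t)" if st: "0 \<le> s" "s < t" "t \<le> 1" for s t
  proof (rule field_le_epsilon)
    fix e :: real assume e: "0 < e"
    \<comment> \<open>Moving both ends inwards by \<open>x\<close> costs \<open>4 * x\<close>
      altogether, hence at most \<open>e\<close>; the other bound keeps the two points in
      order.\<close>
    define x where "x = min (e / 4) ((t - s) / 3)"
    have x: "0 < x" "4 * x \<le> e" "3 * x \<le> t - s" using e st by (simp_all add: x_def min_def)
    have "d (?l (s + x)) (?l (t - x)) = (t - x) - (s + x)"
      using x st by (intro d_line_interior [OF l]) auto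
    moreover have "d (?l (s + x)) (?l (t - x)) \<le> d (?l (s + x)) (?l s) + d (?l s) (?l (t - x))"
      "d (?l s) (?l (t - x)) \<le> d (?l s) (?l t) + d (?l t) (?l (t - x))"
      using x st by (auto intro!: d_triangle line_in_points [OF l])
    moreover have "d (?l (s + x)) (?l s) \<le> x" "d (?l t) (?l (t - x)) \<le> x"
      using d_line_le [OF l, of "s + x" s False] d_line_le [OF l, of t "t - x" False] x st by auto
    ultimately show "t - s \<le> d (?l s) (?l t) + e" using x by linarith
  qed
  have "d (?l s) (?l t) = \<bar>s - t\<bar>" if "s \<in> {0..1}" "t \<in> {0..1}" for s t
  proof -
    consider "s = t" | "s < t" | "t < s" by linarith
    then show ?thesis
    proof cases
      case 1 then show ?thesis using line_in_points [OF l that(1)] by simp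
    next
      case 2 then show ?thesis using main [of s t] d_line_le [OF l that, of False] that by auto
    next
      case 3 then show ?thesis using main [of t s] d_line_le [OF l that, of False] that d_commute [of "?l s"] by auto
    qed
  qed
  moreover have "flip b s \<in> {0..1}" "flip b t \<in> {0..1}" using st by (simp_all only: flip_mem)
  ultimately have "d (?l (flip b s)) (?l (flip b t)) = \<bar>flip b s - flip b t\<bar>" by blast
  then show ?thesis by (auto simp: line_def flip_def)
qed

lemma line_segment:
  assumes l: "dirn c u i"
  shows "geodesic_segment (points K) d (line c u i b 0) (line c u i b 1) (line c u i b ` {0..1})"
proof -
  have "d (line c u i b 0) (line c u i b 1) = 1" using d_line [OF l, of 0 1] by simp
  then show ?thesis
    unfolding geodesic_segment_def
    by (intro exI [of _ "line c u i b"]) (auto simp: d_line [OF l] intro!: line_in_points [OF l])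
qed

lemma d_to_line:
  assumes l: "dirn c u i" and q: "q \<in> points K" and s: "s \<in> {0..1}"
  shows "(d q (line c u i b s))\<^sup>2 \<le> (1 - s) * (d q (line c u i b 0))\<^sup>2 + s * (d q (line c u i b 1))\<^sup>2 - s * (1 - s)"
proof -
  have "(d q (line c u i b s))\<^sup>2 \<le> (1 - s) * (d q (line c u i b 0))\<^sup>2 + s * (d q (line c u i b 1))\<^sup>2
      - s * (1 - s) * (d (line c u i b 0) (line c u i b 1))\<^sup>2"
    using s by (intro cn_inequality [OF q line_segment [OF l]]) (auto simp: d_line [OF l] intro!: line_in_points [OF l])
  then show ?thesis by (simp add: d_line [OF l])
qed

subsection \<open>Strings and carriers of hyperplanes\<close>

lemma line_transfer:
  assumes l: "dirn c u i" and t: "0 < t" "t < 1" and c': "c' \<in> cubes K" "u' \<in> cube_of K c'"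
    and eq: "line c u i b t = chart K c' u'"
  obtains i' b' where "dirn c' u' i'" "u' i' = flip b' t"
    "\<And>s. s \<in> {0..1} \<Longrightarrow> line c u i b s = line c' u' i' b' s"
proof -
  have c: "c \<in> cubes K" and u: "u \<in> cube_of K c" and i: "i < cdim K c"
    using l by (simp_all add: dirn_def)
  let ?u = "u(i := flip b t)"
  have t': "0 < flip b t" "flip b t < 1" using t flip_pos [of b t] by blast+
  have u': "?u \<in> cube_of K c" using t' by (intro cube_upd [OF u i]) simp_all
  obtain i' b' where *: "i' < cdim K c'" "u' i' = flip b' (?u i)"
    "\<And>s. s \<in> {0..1} \<Longrightarrow> chart K c (?u(i := s)) = chart K c' (u'(i' := flip b' s))"
    by (rule direction_transfer [OF c u' c' eq [unfolded line_def] i]) (use t' in \<open>simp_all add: that\<close>)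
  have "line c u i b s = line c' u' i' (b' \<noteq> b) s" if "s \<in> {0..1}" for s
  proof -
    have "flip b s \<in> {0..1}" using that by (simp only: flip_mem)
    then show ?thesis using *(3) [of "flip b s"] by (simp add: line_def)
  qed
  moreover have "dirn c' u' i'" using c' * by (simp add: dirn_def)
  moreover have "u' i' = flip (b' \<noteq> b) t" using *(2) by simp
  ultimately show ?thesis using that by blast
qed

text \<open>Generates the segments crossing one hyperplane by translations inside single cubes.
  Lines of different cubes are compared on the unit interval only, where the charts are
  meaningful.\<close>

inductive par :: "(real \<Rightarrow> 'a) \<Rightarrow> (real \<Rightarrow> 'a) \<Rightarrow> bool"
  for l :: "real \<Rightarrow> 'a"
  where
  par_refl: "par l l"
| par_step: "\<lbrakk>par l l'; dirn c u i; v \<in> cube_of K c; \<And>s. s \<in> {0..1} \<Longrightarrow> l' s = line c u i b s\<rbrakk>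
    \<Longrightarrow> par l (line c v i b)"

text \<open>The alternative for a string of length \<open>L\<close> from \<open>l s0\<close> to \<open>q\<close>: it stays inside the open carrier of
  the hyperplane dual to \<open>l\<close>, or it leaves the carrier on the side \<open>e\<close>.  In both cases
  straightening the coordinate along \<open>l\<close> bounds the distance to \<open>q\<close> from the other points of \<open>l\<close>,
  \<open>A\<close> being the length of the projection of the string to the hyperplane.\<close>

definition carried :: "(real \<Rightarrow> 'a) \<Rightarrow> real \<Rightarrow> 'a \<Rightarrow> real \<Rightarrow> bool"
  where "carried l s0 q L \<longleftrightarrow> (\<exists>c u i b t. \<exists>A :: real. dirn c u i \<and> par l (line c u i b) \<and> 0 < t \<and> t < 1 \<and>
    q = line c u i b t \<and> 0 \<le> A \<and> norm (A, t - s0) \<le> L \<and>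
    (\<forall>r\<in>{0..1}. \<forall>s\<in>{0..1}. d (l r) (line c u i b s) \<le> norm (A, s - r)))"

definition leaves :: "(real \<Rightarrow> 'a) \<Rightarrow> real \<Rightarrow> 'a \<Rightarrow> real \<Rightarrow> real \<Rightarrow> bool"
  where "leaves l s0 q L e \<longleftrightarrow> (\<exists>(A :: real) (R :: real). 0 \<le> A \<and> 0 \<le> R \<and> norm (A, s0 - e) + R \<le> L \<and>
    (\<forall>r\<in>{0..1}. d (l r) q \<le> norm (A, r - e) + R))"

text \<open>While the parameter along the line is strictly between 0 and 1, the next cube contains
  the same direction, and the new piece is appended to the unfolded strip. Once it reaches 0 or 1
  the string has left, and later pieces only enlarge \<open>R\<close>. The freely chosen crossing
  parameter in \<open>straighten\<close> gives the bound for every start \<open>r\<close>, not only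
  for \<open>s0\<close>.\<close>

lemma string_from_line:
  assumes "string_length K p q L" "dirn c0 u0 i0" "p = line c0 u0 i0 b0 s0" "0 < s0" "s0 < 1"
  shows "carried (line c0 u0 i0 b0) s0 q L \<or> leaves (line c0 u0 i0 b0) s0 q L 0 \<or> leaves (line c0 u0 i0 b0) s0 q L 1"
  using assms
proof (induction rule: string_length.induct)
  case (string_refl x)
  have "carried (line c0 u0 i0 b0) s0 x 0"
    unfolding carried_def
  proof (intro exI conjI ballI)
    show "dirn c0 u0 i0" "par (line c0 u0 i0 b0) (line c0 u0 i0 b0)" "0 < s0" "s0 < 1"
      "x = line c0 u0 i0 b0 s0"
      using string_refl.prems by (simp_all add: par_refl)
    show "d (line c0 u0 i0 b0 r) (line c0 u0 i0 b0 s) \<le> norm (0 :: real, s - r)"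
      if "r \<in> {0..1}" "s \<in> {0..1}" for r s
      using d_line [OF string_refl.prems(1) that] by (simp add: norm_Pair abs_minus_commute)
  qed (simp_all add: norm_Pair)
  then show ?case by blast
next
  case (string_step x c1 u1 L v1)
  let ?l = "line c0 u0 i0 b0"
  have l0: "?l r \<in> points K" if "r \<in> {0..1}" for r
    using line_in_points [OF string_step.prems(1) that] .
  have v1p: "chart K c1 v1 \<in> points K" "chart K c1 u1 \<in> points K" using string_step.hyps by simp_all
  consider "carried ?l s0 (chart K c1 u1) L" | e where "e = 0 \<or> e = 1" "leaves ?l s0 (chart K c1 u1) L e"
    using string_step.IH [OF string_step.prems] by blast
  then show ?case
  proof cases
    case 1
    then obtain c u i b t and A :: real where l: "dirn c u i" "par ?l (line c u i b)" and t: "0 < t" "t < 1"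
      and q: "chart K c1 u1 = line c u i b t" and A: "0 \<le> A" "norm (A, t - s0) \<le> L"
      and dl: "\<forall>r\<in>{0..1}. \<forall>s\<in>{0..1}. d (?l r) (line c u i b s) \<le> norm (A, s - r)"
      unfolding carried_def by (elim exE conjE) (rule that; assumption)
    obtain i' b' where l': "dirn c1 u1 i'" "u1 i' = flip b' t"
      and tr: "\<And>s. s \<in> {0..1} \<Longrightarrow> line c u i b s = line c1 u1 i' b' s"
      using line_transfer [OF l(1) t string_step.hyps(2,3) q [symmetric]] by blast
    \<comment> \<open>\<open>a\<close> is the length of the new piece projected along the direction
      of the line, and \<open>t'\<close> below is the parameter at its end.\<close>
    define a where "a = cd c1 (u1(i' := 0)) (v1(i' := 0))"
    have a: "0 \<le> a" by (simp add: a_def)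
    define t' where "t' = flip b' (v1 i')"
    have i': "i' < cdim K c1" using l' by (simp add: dirn_def)
    have "(cd c1 u1 v1)\<^sup>2 = a\<^sup>2 + (u1 i' - v1 i')\<^sup>2"
      using cube_dist_upd [OF i', of u1 "u1 i'" v1 "v1 i'"] by (simp add: a_def)
    moreover have "(u1 i' - v1 i')\<^sup>2 = (t' - t)\<^sup>2"
      unfolding l'(2) t'_def by (auto simp: flip_def power2_eq_square algebra_simps)
    ultimately have "(cd c1 u1 v1)\<^sup>2 = (norm (a, t' - t))\<^sup>2" by (simp add: norm_Pair)
    then have step: "cd c1 u1 v1 = norm (a, t' - t)" by simp
    have "norm (A + a, t' - s0) \<le> norm (A, t - s0) + norm (a, t' - t)"
      using norm_triangle_ineq [of "(A, t - s0)" "(a, t' - t)"] by simp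
    then have len: "norm (A + a, t' - s0) \<le> L + cd c1 u1 v1" using A step by linarith
    have t'01: "t' \<in> {0..1}"
      unfolding t'_def flip_mem using cube_mem [OF string_step.hyps(4) i'] by simp
    have v1: "chart K c1 v1 = line c1 v1 i' b' t'" by (simp add: line_def t'_def)
    have dirv: "dirn c1 v1 i'" using l' string_step.hyps(4) by (simp add: dirn_def)
    have dist: "d (?l r) (line c1 v1 i' b' s) \<le> norm (A + a, s - r)" if r: "r \<in> {0..1}" and s: "s \<in> {0..1}" for r s
    proof -
      obtain m where m: "m \<in> {0..1}" "norm (A, m - r) + norm (a, s - m) = norm (A + a, s - r)"
        using straighten [OF A(1) a r s] .
      have "d (?l r) (line c1 v1 i' b' s) \<le> d (?l r) (line c1 u1 i' b' m) + d (line c1 u1 i' b' m) (line c1 v1 i' b' s)"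
        by (rule d_triangle [OF l0 [OF r] line_in_points [OF l'(1) m(1)] line_in_points [OF dirv s]])
      moreover have "d (?l r) (line c1 u1 i' b' m) \<le> norm (A, m - r)"
        using dl [THEN bspec, OF r, THEN bspec, OF m(1)] tr [OF m(1)] by simp
      moreover have "d (line c1 u1 i' b' m) (line c1 v1 i' b' s) \<le> norm (a, s - m)"
        unfolding a_def by (rule d_parallel_lines_le [OF l'(1) string_step.hyps(4) m(1) s])
      ultimately show ?thesis using m(2) by linarith
    qed
    show ?thesis
    proof (cases "0 < t' \<and> t' < 1")
      case True
      have "carried ?l s0 (chart K c1 v1) (L + cd c1 u1 v1)"
        unfolding carried_def
      proof (intro exI conjI ballI)
        show "par ?l (line c1 v1 i' b')"
          by (rule par_step [OF l(2) l'(1) string_step.hyps(4) tr])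
      qed (use True A a len dist v1 dirv in simp_all)
      then show ?thesis by blast
    next
      case False
      then have e: "t' = 0 \<or> t' = 1" using t'01 by auto
      have "leaves ?l s0 (chart K c1 v1) (L + cd c1 u1 v1) t'"
        unfolding leaves_def
      proof (intro exI conjI ballI)
        show "norm (A + a, s0 - t') + 0 \<le> L + cd c1 u1 v1"
          using len norm_Pair_minus_commute [of "A + a" s0 t'] by simp
        show "d (?l r) (chart K c1 v1) \<le> norm (A + a, r - t') + 0" if "r \<in> {0..1}" for r
          using dist [OF that t'01] v1 norm_Pair_minus_commute [of "A + a" r t'] by simp
      qed (use A a in simp_all)
      then show ?thesis using e by blast
    qed
  next
    case 2
    then obtain A R :: real where AR: "0 \<le> A" "0 \<le> R" "norm (A, s0 - e) + R \<le> L"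
      and dl: "\<forall>r\<in>{0..1}. d (?l r) (chart K c1 u1) \<le> norm (A, r - e) + R"
      unfolding leaves_def by (elim exE conjE) (rule that; assumption)
    have "leaves ?l s0 (chart K c1 v1) (L + cd c1 u1 v1) e"
      unfolding leaves_def
    proof (intro exI conjI ballI)
      show "norm (A, s0 - e) + (R + cd c1 u1 v1) \<le> L + cd c1 u1 v1" using AR by simp
      show "d (?l r) (chart K c1 v1) \<le> norm (A, r - e) + (R + cd c1 u1 v1)" if r: "r \<in> {0..1}" for r
        using d_triangle [OF l0 [OF r] v1p(2) v1p(1)] dl [THEN bspec, OF r]
          d_le_cd [OF string_step.hyps(2-4)] by linarith
    qed (use AR in simp_all)
    then show ?thesis using 2(1) by blast
  qed
qed

definition off_carrier :: "(real \<Rightarrow> 'a) \<Rightarrow> 'a \<Rightarrow> bool"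
  where "off_carrier l q \<longleftrightarrow> (\<forall>c u i b t. dirn c u i \<longrightarrow> par l (line c u i b) \<longrightarrow> 0 < t \<longrightarrow> t < 1 \<longrightarrow> q \<noteq> line c u i b t)"

lemma off_carrier_leaves:
  assumes "off_carrier (line c u i b) q" "q \<in> points K" "dirn c u i" "0 < s" "s < 1"
    "d (line c u i b s) q < r"
  obtains e L where "e = 0 \<or> e = 1" "L < r" "leaves (line c u i b) s q L e"
proof -
  have "line c u i b s \<in> points K" using assms by (intro line_in_points) auto
  then obtain L where L: "string_length K (line c u i b s) q L" "L < r"
    using string_near_d [OF _ assms(2,6)] by blast
  have "\<not> carried (line c u i b) s q L"
    using assms(1) unfolding off_carrier_def carried_def by blast
  then show ?thesis
    using string_from_line [OF L(1) assms(3) refl assms(4,5)] L(2) that by blast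
qed

text \<open>A nearly shortest string from the interior point must leave the carrier through an end
  \<open>e\<close>. It has then paid norm (A, s - e), whereas from the end itself \<open>A\<close>
  suffices, and this saving is bounded away from 0.\<close>

lemma off_carrier_end_closer:
  assumes off: "off_carrier (line c u i b) q" and q: "q \<in> points K" and l: "dirn c u i"
    and s: "0 < s" "s < 1"
  shows "d q (line c u i b 0) < d q (line c u i b s) \<or> d q (line c u i b 1) < d q (line c u i b s)"
proof (rule ccontr)
  let ?l = "line c u i b"
  let ?g = "d (?l s) q"
  assume "\<not> ?thesis"
  then have ge: "?g \<le> d (?l e) q" if "e = 0 \<or> e = 1" for e :: real
    using that d_commute [of q] by auto
  \<comment> \<open>A lower bound for the saving: either end is at least min s (1 - s) away along
    the line, and \<open>A\<close> stays below \<open>?g + 1\<close> because the string has excess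
    less than 1.\<close>
  define k where "k = (min s (1 - s))\<^sup>2 / (2 * ?g + 3)"
  have g0: "0 \<le> ?g" by simp
  have "0 < min s (1 - s)" using s by simp
  then have k: "0 < k" unfolding k_def using g0 by (intro divide_pos_pos zero_less_power) linarith+
  obtain e L where e: "e = 0 \<or> e = 1" and L: "L < ?g + min k 1" "leaves ?l s q L e"
    using off_carrier_leaves [OF off q l s, of "?g + min k 1"] k by auto
  obtain A R :: real where AR: "0 \<le> A" "0 \<le> R" "norm (A, s - e) + R \<le> L"
    and dl: "\<forall>r\<in>{0..1}. d (?l r) q \<le> norm (A, r - e) + R"
    using L(2) unfolding leaves_def by (elim exE conjE) (rule that; assumption)
  have "d (?l e) q \<le> A + R"
    using dl [THEN bspec, of e] e AR(1) by (auto simp: norm_Pair)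
  then have 1: "?g \<le> A + R" using ge [OF e] by simp
  have gap: "A + (s - e)\<^sup>2 / (2 * A + 1) \<le> norm (A, s - e)"
    using e s by (intro norm_Pair_gap AR) auto
  have "0 \<le> (s - e)\<^sup>2 / (2 * A + 1)" using AR by simp
  then have "A < ?g + 1" using AR L gap by linarith
  then have "k \<le> (s - e)\<^sup>2 / (2 * A + 1)"
    unfolding k_def
  proof (intro frac_le)
    have "\<bar>min s (1 - s)\<bar> \<le> \<bar>s - e\<bar>" using e s by auto
    then show "(min s (1 - s))\<^sup>2 \<le> (s - e)\<^sup>2" by (simp add: abs_le_square_iff)
  qed (use AR in auto)
  then show False using 1 AR L gap by linarith
qed

text \<open>If the ends were equally far, convexity would put the midpoint closer than both, yet by
  \<open>off_carrier_end_closer\<close> some end is closer than the midpoint.\<close>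

lemma off_carrier_ends_differ:
  assumes "off_carrier (line c u i b) q" "q \<in> points K" "dirn c u i"
  shows "d q (line c u i b 0) \<noteq> d q (line c u i b 1)"
proof
  assume eq: "d q (line c u i b 0) = d q (line c u i b 1)"
  have "d q (line c u i b 1) < d q (line c u i b (1/2))"
    using off_carrier_end_closer [OF assms, of "1/2"] eq by simp
  then have "(d q (line c u i b 1))\<^sup>2 < (d q (line c u i b (1/2)))\<^sup>2"
    by (intro power_strict_mono) simp_all
  then show False using d_to_line [OF assms(3,2), of "1/2" b] eq by simp
qed

lemma off_carrier_monotone:
  assumes "off_carrier (line c u i b) q" "q \<in> points K" "dirn c u i" "0 < s" "s < 1"
    and "d q (line c u i b s) < d q (line c u i b 0)"
  shows "d q (line c u i b 1) < d q (line c u i b 0)"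
  using off_carrier_end_closer [OF assms(1-5)] assms(6) by linarith

lemma line_interior_not_vert:
  assumes "dirn c u i" "0 < t" "t < 1"
  shows "line c u i b t \<notin> verts"
proof
  assume "line c u i b t \<in> verts"
  have t': "0 < flip b t" "flip b t < 1" using assms flip_pos [of b t] by blast+
  then have "corner c (u(i := flip b t))"
    using vert_corner [of c "u(i := flip b t)"] cube_upd assms(1) \<open>line c u i b t \<in> verts\<close>
    by (simp add: dirn_def line_def)
  then have "flip b t = 0 \<or> flip b t = 1"
    using assms(1) by (auto simp: corner_def dirn_def)
  then show False using t' by auto
qed

lemma vert_off_carrier: "x \<in> verts \<Longrightarrow> off_carrier l x"
  unfolding off_carrier_def using line_interior_not_vert by blast

lemma d_lipschitz:
  assumes "x \<in> points K" "y \<in> points K" "q \<in> points K"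
  shows "\<bar>d q x - d q y\<bar> \<le> d x y"
  using d_triangle [of q x y] d_triangle [of q y x] d_commute [of x y] assms by linarith

text \<open>Translate the line along the straight segment from \<open>u\<close> to \<open>v\<close>.
  The distances from \<open>x\<close> to its two ends vary continuously and never agree, because a
  vertex is off every carrier; so their order persists.\<close>

lemma side_invariant_in_cube:
  assumes l: "dirn c u i" and v: "v \<in> cube_of K c" and x: "x \<in> verts"
  shows "d x (line c u i b 0) < d x (line c u i b 1) \<longleftrightarrow> d x (line c v i b 0) < d x (line c v i b 1)"
proof -
  have c: "c \<in> cubes K" and u: "u \<in> cube_of K c" and i: "i < cdim K c"
    using l by (simp_all add: dirn_def)
  define w where "w r = (\<lambda>j. if j < cdim K c then (1 - r) * u j + r * v j else undefined)" for r
  have w: "w r \<in> cube_of K c" if "r \<in> {0..1}" for r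
  proof -
    have "0 \<le> (1 - r) * u j + r * v j \<and> (1 - r) * u j + r * v j \<le> 1" if "j < cdim K c" for j
      using convexD_alt [of "{0..1::real}" "u j" "v j" r] cube_mem [OF u that] cube_mem [OF v that] \<open>r \<in> {0..1}\<close>
      by simp
    then show ?thesis by (auto simp: w_def cube_of_def unit_cube_def PiE_iff extensional_def)
  qed
  have w0: "w 0 = u" and w1: "w 1 = v"
    using u v by (auto simp: w_def cube_of_def unit_cube_def PiE_iff extensional_def)
  have wd: "cd c (w r) (w s) = \<bar>r - s\<bar> * cd c u v" for r s
  proof -
    have "(\<Sum>j<cdim K c. (w r j - w s j)\<^sup>2) = (\<Sum>j<cdim K c. (r - s)\<^sup>2 * (u j - v j)\<^sup>2)"
      by (intro sum.cong refl) (simp add: w_def power2_eq_square algebra_simps)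
    then have "(cd c (w r) (w s))\<^sup>2 = (\<bar>r - s\<bar> * cd c u v)\<^sup>2"
      by (simp add: cube_dist_square power_mult_distrib sum_distrib_left)
    then show ?thesis by simp
  qed
  have xp: "x \<in> points K" using verts_points [OF x] .
  have dw: "dirn c (w r) i" if "r \<in> {0..1}" for r using w [OF that] c i by (simp add: dirn_def)
  define D where "D r = d x (line c (w r) i b 1) - d x (line c (w r) i b 0)" for r
  have near: "\<bar>d x (line c (w r) i b e) - d x (line c (w s) i b e)\<bar> \<le> \<bar>r - s\<bar> * cd c u v"
    if "r \<in> {0..1}" "s \<in> {0..1}" "e \<in> {0..1}" for r s e
  proof -
    have "d (line c (w r) i b e) (line c (w s) i b e) \<le> cd c ((w r)(i := flip b e)) ((w s)(i := flip b e))"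
      unfolding line_def using that by (intro d_le_cd c cube_flip_upd w i) auto
    also have "\<dots> \<le> \<bar>r - s\<bar> * cd c u v" using cube_dist_upd_le [OF i] wd by metis
    finally show ?thesis
      using d_lipschitz [OF line_in_points [OF dw [OF that(1)] that(3)] line_in_points [OF dw [OF that(2)] that(3)] xp, of b b]
      by linarith
  qed
  have "continuous_on {0..1} D"
  proof (rule continuous_on_unit_interval_lipschitz [of _ "2 * cd c u v"])
    fix r s :: real assume rs: "r \<in> {0..1}" "s \<in> {0..1}"
    show "\<bar>D r - D s\<bar> \<le> 2 * cd c u v * \<bar>r - s\<bar>"
      using near [OF rs, of 0] near [OF rs, of 1] unfolding D_def by (simp add: algebra_simps)
  qed
  moreover have "D r \<noteq> 0" if "r \<in> {0..1}" for r
    using off_carrier_ends_differ [OF vert_off_carrier [OF x] xp dw [OF that], of b] unfolding D_def by simp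
  ultimately have "0 < D 0 \<longleftrightarrow> 0 < D 1" by (rule nonzero_same_sign)
  then show ?thesis unfolding D_def w0 w1 by simp
qed

lemma side_invariant:
  assumes "par l l'" "x \<in> verts"
  shows "d x (l 0) < d x (l 1) \<longleftrightarrow> d x (l' 0) < d x (l' 1)"
  using assms
proof (induction rule: par.induct)
  case par_refl
  then show ?case by simp
next
  case (par_step l' c u i v b)
  have "l' 0 = line c u i b 0" "l' 1 = line c u i b 1" by (simp_all add: par_step.hyps(4))
  then show ?case
    using par_step.IH [OF par_step.prems] side_invariant_in_cube [OF par_step.hyps(2,3) par_step.prems] by simp
qed

subsection \<open>Halfspaces\<close>

definition adj :: "'a \<Rightarrow> 'a \<Rightarrow> bool"
  where "adj x y \<longleftrightarrow> (\<exists>c u i. corner c u \<and> i < cdim K c \<and> x = chart K c u \<and> y = chart K c (u(i := 1 - u i)))"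

definition hs :: "'a \<Rightarrow> 'a \<Rightarrow> 'a set"
  where "hs a b = {z \<in> verts. d z a < d z b}"

lemma corner_flip: "corner c u \<Longrightarrow> i < cdim K c \<Longrightarrow> corner c (u(i := 1 - u i))"
  using cube_upd [of u c i "1 - u i"] unfolding corner_def by auto

lemma corner_vert [simp]: "corner c u \<Longrightarrow> chart K c u \<in> verts"
  unfolding verts_def by blast

lemma corner_dirn: "corner c u \<Longrightarrow> i < cdim K c \<Longrightarrow> dirn c u i"
  by (simp add: corner_def dirn_def)

lemma corner_line:
  assumes "corner c u" "i < cdim K c"
  shows "line c u i (u i = 1) 0 = chart K c u" "line c u i (u i = 1) 1 = chart K c (u(i := 1 - u i))"
proof -
  have "u i = 0 \<or> u i = 1" using assms by (simp add: corner_def)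
  then have "flip (u i = 1) 0 = u i" "flip (u i = 1) 1 = 1 - u i" by (auto simp: flip_def)
  then show "line c u i (u i = 1) 0 = chart K c u" "line c u i (u i = 1) 1 = chart K c (u(i := 1 - u i))"
    by (simp_all add: line_def)
qed

lemma adjE:
  assumes "adj x y"
  obtains c u i b where "corner c u" "dirn c u i" "x = chart K c u" "y = chart K c (u(i := 1 - u i))"
    "line c u i b 0 = x" "line c u i b 1 = y"
proof -
  obtain c u i where "corner c u" "i < cdim K c" "x = chart K c u" "y = chart K c (u(i := 1 - u i))"
    using assms unfolding adj_def by blast
  then show ?thesis using that [of c u i "u i = 1"] corner_line corner_dirn by simp
qed

lemma adj_corner: "corner c u \<Longrightarrow> i < cdim K c \<Longrightarrow> adj (chart K c u) (chart K c (u(i := 1 - u i)))"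
  unfolding adj_def by blast

lemma adj_sym: "adj x y \<Longrightarrow> adj y x"
proof -
  assume "adj x y"
  then obtain c u i b where "corner c u" "dirn c u i" "x = chart K c u" "y = chart K c (u(i := 1 - u i))"
    by (rule adjE)
  then show "adj y x"
    using adj_corner [OF corner_flip, of c u i i] by (simp add: dirn_def)
qed

lemma adj_verts: "adj x y \<Longrightarrow> x \<in> verts" "adj x y \<Longrightarrow> y \<in> verts"
  using corner_flip by (auto elim!: adjE simp: dirn_def)

lemma adj_dist:
  assumes "adj x y" shows "d x y = 1"
  using assms
proof (rule adjE)
  fix c u i b assume "dirn c u i" "line c u i b 0 = x" "line c u i b 1 = y"
  then show ?thesis using d_line [of c u i 0 1 b] by simp
qed

lemma ends_differ:
  assumes "adj x y" "p \<in> verts" shows "d p x \<noteq> d p y"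
  using assms(1)
proof (rule adjE)
  fix c u i b assume "dirn c u i" "line c u i b 0 = x" "line c u i b 1 = y"
  then show ?thesis
    using off_carrier_ends_differ [OF vert_off_carrier [OF assms(2)] verts_points [OF assms(2)], of c u i b]
    by simp
qed

lemma hs_subset: "hs a b \<subseteq> verts" by (auto simp: hs_def)

lemma hs_complement:
  assumes "adj a b" shows "hs b a = verts - hs a b"
proof -
  have "d z b < d z a \<longleftrightarrow> \<not> d z a < d z b" if "z \<in> verts" for z
    using ends_differ [OF assms that] by linarith
  then show ?thesis unfolding hs_def by blast
qed

lemma mem_hs:
  assumes "adj a b" shows "a \<in> hs a b" "b \<notin> hs a b"
  using adj_dist [OF assms] adj_verts [OF assms] verts_points by (simp_all add: hs_def not_less)

lemma line_upd_same [simp]: "line c (u(i := t)) i b s = line c u i b s"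
  by (simp add: line_def)

lemma hs_parallel:
  assumes "corner c u" "corner c v" "i < cdim K c" "u i = v i"
  shows "hs (chart K c u) (chart K c (u(i := 1 - u i))) = hs (chart K c v) (chart K c (v(i := 1 - v i)))"
proof -
  have "v \<in> cube_of K c" using assms by (simp add: corner_def)
  then have "d x (chart K c u) < d x (chart K c (u(i := 1 - u i))) \<longleftrightarrow> d x (chart K c v) < d x (chart K c (v(i := 1 - v i)))"
    if "x \<in> verts" for x
    using side_invariant_in_cube [OF corner_dirn [OF assms(1,3)] _ that, of v "u i = 1"]
      corner_line [OF assms(1,3)] corner_line [OF assms(2,3)] assms(4) by simp
  then show ?thesis unfolding hs_def by blast
qed

text \<open>Somewhere on the edge from \<open>u\<close> to \<open>v\<close> the distances to
  \<open>a\<close> and \<open>b\<close> agree, so that point lies in the carrier of the edge from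
  \<open>a\<close> to \<open>b\<close>. Only one direction passes through an interior point of an
  edge, hence the two edges are parallel.\<close>

lemma hs_unique:
  assumes ab: "adj a b" and uv: "adj u v" and u: "u \<in> hs a b" and v: "v \<notin> hs a b"
  shows "hs u v = hs a b"
proof -
  obtain c1 u1 i1 b1 where l: "dirn c1 u1 i1" "line c1 u1 i1 b1 0 = a" "line c1 u1 i1 b1 1 = b"
    using ab by (rule adjE)
  obtain c2 u2 i2 b2 where m: "corner c2 u2" "dirn c2 u2 i2" "line c2 u2 i2 b2 0 = u" "line c2 u2 i2 b2 1 = v"
    using uv by (rule adjE)
  let ?l = "line c1 u1 i1 b1" and ?m = "line c2 u2 i2 b2"
  have abp: "a \<in> points K" "b \<in> points K" and uvv: "u \<in> verts" "v \<in> verts"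
    using ab uv adj_verts verts_points by blast+
  define D where "D t = d b (?m t) - d a (?m t)" for t
  have mp: "?m t \<in> points K" if "t \<in> {0..1}" for t using line_in_points [OF m(2) that] .
  have "continuous_on {0..1} D"
  proof (rule continuous_on_unit_interval_lipschitz [of _ 2])
    fix r s :: real assume rs: "r \<in> {0..1}" "s \<in> {0..1}"
    have "D r - D s = (d b (?m r) - d b (?m s)) - (d a (?m r) - d a (?m s))" by (simp add: D_def)
    then have "\<bar>D r - D s\<bar> \<le> \<bar>d b (?m r) - d b (?m s)\<bar> + \<bar>d a (?m r) - d a (?m s)\<bar>"
      by (metis abs_triangle_ineq4)
    also have "\<dots> \<le> \<bar>r - s\<bar> + \<bar>r - s\<bar>"
      using d_lipschitz [OF mp [OF rs(1)] mp [OF rs(2)] abp(2)] d_lipschitz [OF mp [OF rs(1)] mp [OF rs(2)] abp(1)]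
      unfolding d_line [OF m(2) rs] by (rule add_mono)
    finally show "\<bar>D r - D s\<bar> \<le> 2 * \<bar>r - s\<bar>" by simp
  qed
  moreover have "0 < D 0" using u m unfolding D_def hs_def by (simp add: d_commute)
  moreover have "\<not> 0 < D 1" using v uvv m unfolding D_def hs_def by (simp add: d_commute)
  ultimately obtain t where t: "t \<in> {0..1}" "D t = 0" using nonzero_same_sign by blast
  have "\<not> off_carrier ?l (?m t)"
    using off_carrier_ends_differ [OF _ mp [OF t(1)] l(1), of b1] t(2) l unfolding D_def by (auto simp: d_commute)
  then obtain c w k b' s where cw: "dirn c w k" "par ?l (line c w k b')" "0 < s" "s < 1" "?m t = line c w k b' s"
    unfolding off_carrier_def by blast
  have t01: "0 < t" "t < 1"
  proof -
    have "?m t \<notin> verts" using line_interior_not_vert [OF cw(1,3,4)] cw(5) by simp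
    then have "t \<noteq> 0" "t \<noteq> 1" using m uvv by auto
    then show "0 < t" "t < 1" using t(1) by auto
  qed
  have c2: "c2 \<in> cubes K" "u2(i2 := flip b2 t) \<in> cube_of K c2"
    using m(2) t(1) cube_flip_upd unfolding dirn_def by blast+
  obtain i' b'' where tr: "dirn c2 (u2(i2 := flip b2 t)) i'" "(u2(i2 := flip b2 t)) i' = flip b'' s"
    "\<And>s. s \<in> {0..1} \<Longrightarrow> line c w k b' s = line c2 (u2(i2 := flip b2 t)) i' b'' s"
    using line_transfer [OF cw(1,3,4) c2 cw(5) [symmetric, unfolded line_def [of c2 u2]]] by metis
  \<comment> \<open>As \<open>u2\<close> is a corner, \<open>i2\<close> is the only coordinate of
    the point that can be fractional.\<close>
  have "i' = i2"
  proof (rule ccontr)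
    assume "i' \<noteq> i2"
    then have "u2 i' = flip b'' s" "i' < cdim K c2" using tr(1,2) by (simp_all add: dirn_def)
    moreover have "0 < flip b'' s \<and> flip b'' s < 1" using cw flip_pos by blast
    ultimately show False using m(1) unfolding corner_def by fastforce
  qed
  then have tr': "line c w k b' s = line c2 u2 i2 b'' s" if "s \<in> {0..1}" for s
    using tr(3) [OF that] by simp
  have side: "d x a < d x b \<longleftrightarrow> d x (line c2 u2 i2 b'' 0) < d x (line c2 u2 i2 b'' 1)" if "x \<in> verts" for x
    using side_invariant [OF cw(2) that] l tr' [of 0] tr' [of 1] by simp
  \<comment> \<open>The opposite orientation would make \<open>u\<close> closer to \<open>v\<close>
    than to itself.\<close>
  have "b'' = b2"
  proof (rule ccontr)
    assume "b'' \<noteq> b2"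
    then have "line c2 u2 i2 b'' 0 = v" "line c2 u2 i2 b'' 1 = u"
      using m(3,4) by (auto simp: line_def flip_def)
    then have "d u v < d u u" using side [OF uvv(1)] u by (simp add: hs_def)
    then show False using verts_points [OF uvv(1)] d_nonneg [of u v] by simp
  qed
  then show ?thesis using side m(3,4) unfolding hs_def by auto
qed

section \<open>Initial pieces of geodesics issuing from a vertex\<close>

lemma corner_margin: "corner c u \<Longrightarrow> margin 1 c u"
  unfolding corner_def margin_def by blast

lemma d_local_vert:
  assumes "x \<in> verts" "c \<in> cubes K" "w \<in> cube_of K c" "d x (chart K c w) < 1"
  obtains u where "corner c u" "x = chart K c u" "cd c u w = d x (chart K c w)"
proof -
  obtain c0 u0 where x: "corner c0 u0" "x = chart K c0 u0" using assms(1) unfolding verts_def by blast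
  then have "c0 \<in> cubes K" "u0 \<in> cube_of K c0" by (simp_all add: corner_def)
  then obtain u where u: "u \<in> cube_of K c" "chart K c0 u0 = chart K c u" "cd c u w = d (chart K c0 u0) (chart K c w)"
    using d_local [OF _ _ corner_margin [OF x(1)] order_refl assms(2,3)] assms(4) x(2) by metis
  then show ?thesis
    using that [of u] corner_transfer [OF x(1) assms(2) u(1,2)] x(2) by simp
qed

lemma verts_separated:
  assumes "x \<in> verts" "y \<in> verts" "d x y < 1"
  shows "x = y"
proof -
  obtain c w where y: "corner c w" "y = chart K c w" using assms(2) unfolding verts_def by blast
  then have c: "c \<in> cubes K" "w \<in> cube_of K c" by (simp_all add: corner_def)
  obtain u where u: "corner c u" "x = chart K c u" "cd c u w = d x y"
    using d_local_vert [OF assms(1) c] assms(3) y(2) by metis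
  have "u i = w i" if i: "i < cdim K c" for i
  proof -
    have "\<bar>u i - w i\<bar> < 1" using coord_diff_le_cube_dist [OF i, of u w] u(3) assms(3) by simp
    moreover have "u i = 0 \<or> u i = 1" "w i = 0 \<or> w i = 1" using u(1) y(1) i by (simp_all add: corner_def)
    ultimately show ?thesis by auto
  qed
  then have "u = w"
    using u(1) c(2) by (intro unit_cube_eqI [of u "cdim K c"]) (simp_all add: corner_def cube_of_def)
  then show ?thesis using u y by simp
qed

text \<open>A short initial piece of the geodesic ends in a cube having \<open>x\<close> as a
  corner. The bound 1/4 also leaves room for the short strings in
  \<open>descending_edges_in_cube\<close>; the convexity inequality is recorded because the rest of
  the geodesic is not kept.\<close>

lemma germ:
  assumes x: "x \<in> verts" and p: "p \<in> verts" and ne: "x \<noteq> p"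
  obtains c u w r where "corner c u" "x = chart K c u" "w \<in> cube_of K c" "0 < r" "r < 1/4"
    "cd c u w = r" "d x (chart K c w) = r" "d (chart K c w) p = d x p - r"
    "\<And>q. q \<in> points K \<Longrightarrow> (d q (chart K c w))\<^sup>2 \<le>
      (1 - r / d x p) * (d q x)\<^sup>2 + r / d x p * (d q p)\<^sup>2 - r / d x p * (1 - r / d x p) * (d x p)\<^sup>2"
proof -
  have xp: "x \<in> points K" "p \<in> points K" using x p verts_points by blast+
  have geo: "\<forall>x\<in>points K. \<forall>y\<in>points K. \<exists>S. geodesic_segment (points K) d x y S"
    using cat0_points unfolding CAT0_space_def geodesic_space_def by (elim conjE)
  then obtain S where S: "geodesic_segment (points K) d x p S" using xp by blast
  then obtain g where g: "g 0 = x" "g (d x p) = p" "g ` {0..d x p} = S" "S \<subseteq> points K"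
    and iso: "\<forall>s\<in>{0..d x p}. \<forall>t\<in>{0..d x p}. d (g s) (g t) = \<bar>s - t\<bar>"
    unfolding geodesic_segment_def by blast
  have D: "0 < d x p" using d_zero [OF xp] ne d_nonneg [of x p] by linarith
  define r where "r = min (1/5) (d x p)"
  have r: "0 < r" "r < 1/4" "r \<le> d x p" using D by (simp_all add: r_def)
  have rD: "r \<in> {0..d x p}" "0 \<in> {0..d x p}" "d x p \<in> {0..d x p}" using r D by simp_all
  have z: "g r \<in> S" "g r \<in> points K" using g rD by blast+
  have dxz: "d x (g r) = r" using iso [THEN bspec, OF rD(2), THEN bspec, OF rD(1)] g(1) r by simp
  have dzp: "d (g r) p = d x p - r" using iso [THEN bspec, OF rD(1), THEN bspec, OF rD(3)] g(2) r by simp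
  obtain c w where cw: "c \<in> cubes K" "w \<in> cube_of K c" "g r = chart K c w" using z(2) by (rule pointsE)
  obtain u where u: "corner c u" "x = chart K c u" "cd c u w = d x (chart K c w)"
    using d_local_vert [OF x cw(1,2)] dxz cw(3) r by auto
  have cn: "(d q (chart K c w))\<^sup>2 \<le>
      (1 - r / d x p) * (d q x)\<^sup>2 + r / d x p * (d q p)\<^sup>2 - r / d x p * (1 - r / d x p) * (d x p)\<^sup>2"
    if q: "q \<in> points K" for q
    by (rule cn_inequality [OF q S xp]) (use z cw dxz D r in \<open>simp_all add: divide_le_eq_1\<close>)
  show ?thesis
    by (rule that [OF u(1,2) cw(2) r(1,2)]) (use u dxz dzp cw cn in simp_all)
qed

text \<open>The geodesic changes some coordinate \<open>i\<close> of the cube it enters. Changing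
  \<open>i\<close> alone already leads closer to the geodesic point than \<open>x\<close> is, hence
  closer to \<open>p\<close>, and \<open>off_carrier_monotone\<close> extends this to the far end of
  the edge.\<close>

lemma descending_edge_exists:
  assumes x: "x \<in> verts" and p: "p \<in> verts" and ne: "x \<noteq> p"
  obtains y where "adj x y" "d p y < d p x"
proof -
  obtain c u w r where u: "corner c u" "x = chart K c u" and w: "w \<in> cube_of K c" and r: "0 < r" "r < 1/4"
    "cd c u w = r" and z: "d x (chart K c w) = r" "d (chart K c w) p = d x p - r"
    using germ [OF x p ne] by metis
  have c: "c \<in> cubes K" "u \<in> cube_of K c" using u by (simp_all add: corner_def)
  have pp: "p \<in> points K" using p verts_points by blast
  have "\<exists>i<cdim K c. u i \<noteq> w i"
  proof (rule ccontr)
    assume "\<not> ?thesis"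
    then have "cd c u w = 0" by (simp add: cube_dist_def L2_set_def)
    then show False using r by simp
  qed
  then obtain i where i: "i < cdim K c" "u i \<noteq> w i" by blast
  define b where "b = (u i = 1)"
  define t where "t = flip b (w i)"
  have ui: "u i = 0 \<or> u i = 1" using u(1) i by (simp add: corner_def)
  have "\<bar>u i - w i\<bar> < 1" using coord_diff_le_cube_dist [OF i(1), of u w] r by linarith
  then have t: "0 < t" "t < 1"
    using ui i cube_mem [OF w i(1)] by (auto simp: t_def b_def flip_def)
  have ft: "flip b t = w i" by (simp add: t_def)
  let ?q = "chart K c (u(i := w i))"
  have q: "u(i := w i) \<in> cube_of K c" using cube_mem [OF w i(1)] by (intro cube_upd [OF c(2) i(1)]) simp_all
  have "(cd c (u(i := w i)) w)\<^sup>2 < (cd c u w)\<^sup>2"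
    using cube_dist_upd [OF i(1), of u "w i" w "w i"] cube_dist_upd [OF i(1), of u "u i" w "w i"] i(2) by simp
  then have "cd c (u(i := w i)) w < r" using r by (intro power2_less_imp_less [of _ r]) simp_all
  then have "d ?q (chart K c w) < r" using d_le_cd [OF c(1) q w] by linarith
  then have "d ?q p < d x p"
    using d_triangle [of ?q "chart K c w" p] z q w c pp by (simp)
  moreover have "line c u i b t = ?q" by (simp add: line_def ft)
  moreover have l0: "line c u i b 0 = x" and l1: "line c u i b 1 = chart K c (u(i := 1 - u i))"
    using corner_line [OF u(1) i(1)] u(2) by (simp_all add: b_def)
  ultimately have "d p (line c u i b t) < d p (line c u i b 0)" by (simp add: d_commute)
  then have "d p (line c u i b 1) < d p (line c u i b 0)"
    using off_carrier_monotone [OF vert_off_carrier [OF p] pp corner_dirn [OF u(1) i(1)] t] by simp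
  then show ?thesis
    using that [of "chart K c (u(i := 1 - u i))"] adj_corner [OF u(1) i(1)] u(2) l0 l1 by simp
qed

text \<open>The cube is the one into which the geodesic from \<open>x\<close> to \<open>p\<close> departs: an edge at \<open>x\<close> outside it makes
  an angle of at least \<open>\<pi>/2\<close> with the geodesic, so it cannot descend towards \<open>p\<close>.\<close>

lemma descending_edges_in_cube:
  assumes x: "x \<in> verts" and p: "p \<in> verts"
  obtains c u where "corner c u" "x = chart K c u"
    "\<And>y. adj x y \<Longrightarrow> d p y < d p x \<Longrightarrow> \<exists>i<cdim K c. y = chart K c (u(i := 1 - u i))"
proof (cases "x = p")
  case True
  obtain c u where cu: "corner c u" "x = chart K c u" using x unfolding verts_def by blast
  have no: "\<not> d p y < d p x" for y using True verts_points [OF p] by (simp add: not_less)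
  show ?thesis by (rule that [OF cu]) (use no in blast)
next
  case ne: False
  obtain c u w r where u: "corner c u" "x = chart K c u" and w: "w \<in> cube_of K c" and r: "0 < r" "r < 1/4"
    "cd c u w = r" and z: "d x (chart K c w) = r" "d (chart K c w) p = d x p - r"
    and cn: "\<And>q. q \<in> points K \<Longrightarrow> (d q (chart K c w))\<^sup>2 \<le>
      (1 - r / d x p) * (d q x)\<^sup>2 + r / d x p * (d q p)\<^sup>2 - r / d x p * (1 - r / d x p) * (d x p)\<^sup>2"
    using germ [OF x p ne] by metis
  have c: "c \<in> cubes K" "u \<in> cube_of K c" using u by (simp_all add: corner_def)
  have pp: "p \<in> points K" "x \<in> points K" using p x verts_points by blast+
  let ?z = "chart K c w"
  have zp: "?z \<in> points K" using c w by simp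
  have D: "0 < d x p" using d_zero [OF pp(2,1)] ne d_nonneg [of x p] by linarith
  have main: "\<exists>i<cdim K c. y = chart K c (u(i := 1 - u i))" if xy: "adj x y" and less: "d p y < d p x" for y
  proof -
    obtain c1 u1 i1 b1 where l: "dirn c1 u1 i1" "line c1 u1 i1 b1 0 = x" "line c1 u1 i1 b1 1 = y"
      using xy by (rule adjE)
    let ?l = "line c1 u1 i1 b1"
    have lp: "?l t \<in> points K" if "t \<in> {0..1}" for t using line_in_points [OF l(1) that] .
    have yv: "y \<in> verts" using adj_verts xy by blast
    \<comment> \<open>Together with \<open>r < 1/4\<close> this keeps \<open>norm (r, s)\<close>
      below 3/8: too short to reach the far end of the edge, and short enough for twice that length
      to be less than 1.\<close>
    define s :: real where "s = 1/8"
    let ?q = "?l s"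
    have s: "s \<in> {0..1}" "0 < s" "s < 1" by (simp_all add: s_def)
    have qx: "d ?q x = s" using d_line [OF l(1) s(1), of 0 b1] l(2) by (simp add: s_def)
    \<comment> \<open>Convexity along the geodesic is combined with convexity along the edge. Since
      \<open>y\<close> is closer to \<open>p\<close> than \<open>x\<close> is, the angle at
      \<open>x\<close> is acute and the distance falls below the hypotenuse.\<close>
    have short: "d ?q ?z < norm (r, s)"
    proof -
      define m where "m = r / d x p"
      have m: "0 < m" "m * d x p = r" using r D by (simp_all add: m_def)
      have 1: "(d ?q ?z)\<^sup>2 \<le> (1 - m) * s\<^sup>2 + m * (d ?q p)\<^sup>2 - m * (1 - m) * (d x p)\<^sup>2"
        using cn [OF lp [OF s(1)]] qx by (simp add: m_def)
      have "(d p ?q)\<^sup>2 \<le> (1 - s) * (d p x)\<^sup>2 + s * (d p y)\<^sup>2 - s * (1 - s)"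
        using d_to_line [OF l(1) pp(1) s(1), of b1] l by simp
      then have 2: "m * (d ?q p)\<^sup>2 \<le> m * ((1 - s) * (d x p)\<^sup>2 + s * (d y p)\<^sup>2 - s * (1 - s))"
        using m(1) by (intro mult_left_mono) (simp_all add: d_commute)
      have "(d y p)\<^sup>2 < (d x p)\<^sup>2"
        using less by (intro power_strict_mono) (simp_all add: d_commute)
      then have 3: "0 < m * s * ((d x p)\<^sup>2 - (d y p)\<^sup>2 + 1)" using m s by simp
      have "(d ?q ?z)\<^sup>2 \<le> (1 - m) * s\<^sup>2 + m * ((1 - s) * (d x p)\<^sup>2 + s * (d y p)\<^sup>2 - s * (1 - s)) - m * (1 - m) * (d x p)\<^sup>2"
        using 1 2 by linarith
      also have "\<dots> = s\<^sup>2 + (m * d x p)\<^sup>2 - m * s * ((d x p)\<^sup>2 - (d y p)\<^sup>2 + 1)"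
        by (simp add: power2_eq_square algebra_simps)
      also have "\<dots> < s\<^sup>2 + r\<^sup>2" using 3 m(2) by simp
      finally have "(d ?q ?z)\<^sup>2 < (norm (r, s))\<^sup>2" by (simp add: norm_Pair)
      then show ?thesis by (rule power2_less_imp_less) simp
    qed
    have "norm (r, s) \<le> r + s"
      using norm_triangle_ineq [of "(r, 0 :: real)" "(0 :: real, s)"] r s by (simp add: norm_Pair)
    then have rs: "norm (r, s) < 3/8" using r by (simp add: s_def)
    obtain L where L: "string_length K ?q ?z L" "L < norm (r, s)"
      using string_near_d [OF lp [OF s(1)] zp short] by blast
    consider "carried ?l s ?z L" | "leaves ?l s ?z L 0" | "leaves ?l s ?z L 1"
      using string_from_line [OF L(1) l(1) refl s(2,3)] by blast
    then show ?thesis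
    proof cases
      \<comment> \<open>The string carries the edge direction into \<open>c\<close> as coordinate
        \<open>i\<close>. The start of the line there is within distance 1 of \<open>x\<close>,
        which determines \<open>u i\<close>; its far end is within \<open>A\<close> of both
        \<open>y\<close> and the neighbour of \<open>u\<close>, so these two vertices
        coincide.\<close>
      case 1
      then obtain c2 u2 i2 b2 t and A :: real where l2: "dirn c2 u2 i2" "0 < t" "t < 1"
        and q: "?z = line c2 u2 i2 b2 t" and A: "0 \<le> A" "norm (A, t - s) \<le> L"
        and dl: "\<forall>r\<in>{0..1}. \<forall>s\<in>{0..1}. d (?l r) (line c2 u2 i2 b2 s) \<le> norm (A, s - r)"
        unfolding carried_def by (elim exE conjE) (rule that; assumption)
      obtain i b where ib: "dirn c w i" "w i = flip b t"
        and tr: "\<And>s. s \<in> {0..1} \<Longrightarrow> line c2 u2 i2 b2 s = line c w i b s"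
        using line_transfer [OF l2 c(1) w q [symmetric]] by blast
      have i: "i < cdim K c" using ib by (simp add: dirn_def)
      have AL: "A < 3/8"
        using A L rs norm_fst_le [of A "t - s"] by simp
      have dl': "d (?l e) (line c w i b e) \<le> A" if "e \<in> {0..1}" for e
        using dl [THEN bspec, OF that, THEN bspec, OF that] tr [OF that] A(1) by (simp add: norm_Pair)
      have w0: "w(i := flip b 0) \<in> cube_of K c" "w(i := flip b 1) \<in> cube_of K c"
        using cube_flip_upd [OF w i] by simp_all
      have close: "d x (chart K c (w(i := flip b 0))) \<le> A"
        using dl' [of 0] l(2) by (simp add: line_def)
      have lt1: "d x (chart K c (w(i := flip b 0))) < 1" using close AL by linarith
      obtain u' where u': "corner c u'" "x = chart K c u'" "cd c u' (w(i := flip b 0)) = d x (chart K c (w(i := flip b 0)))"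
        using d_local_vert [OF x c(1) w0(1) lt1] by blast
      have "u' = u" using chart_inj [OF c(1) _ c(2)] u' u(2) by (simp add: corner_def)
      then have uw: "cd c u (w(i := flip b 0)) \<le> A" using u'(3) close by simp
      have ui: "u i = flip b 0"
      proof -
        have "\<bar>u i - flip b 0\<bar> < 1" using coord_diff_le_cube_dist [OF i, of u "w(i := flip b 0)"] uw AL by simp
        moreover have "u i = 0 \<or> u i = 1" using u(1) i by (simp add: corner_def)
        ultimately show ?thesis by (auto simp: flip_def split: if_splits)
      qed
      have f1: "flip b 1 = 1 - u i" using ui by (auto simp: flip_def)
      let ?y = "chart K c (u(i := 1 - u i))"
      have cu': "corner c (u(i := 1 - u i))" using corner_flip [OF u(1) i] .
      have "d y (line c w i b 1) \<le> A" using dl' [of 1] l(3) by simp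
      moreover have "d (line c w i b 1) ?y \<le> A"
      proof -
        have "(cd c (w(i := flip b 1)) (u(i := flip b 1)))\<^sup>2 = (cd c (w(i := flip b 0)) u)\<^sup>2"
          using cube_dist_upd [OF i, of w "flip b 1" u "flip b 1"] cube_dist_upd [OF i, of w "flip b 0" u "u i"] ui
          by (metis diff_self fun_upd_triv)
        then have "cd c (w(i := flip b 1)) (u(i := flip b 1)) \<le> A"
          using uw by (simp add: cube_dist_commute)
        moreover have "u(i := flip b 1) \<in> cube_of K c" using cu' f1 by (simp add: corner_def)
        ultimately show ?thesis
          using d_le_cd [OF c(1) w0(2), of "u(i := flip b 1)"] f1 by (simp add: line_def)
      qed
      moreover have "line c w i b 1 \<in> points K" using line_in_points [OF ib(1), of 1] by simp
      ultimately have "d y ?y < 1"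
        using d_triangle [of y "line c w i b 1" ?y] verts_points [OF yv] verts_points [OF corner_vert [OF cu']] AL
        by simp
      then have "y = ?y" by (rule verts_separated [OF yv corner_vert [OF cu']])
      then show ?thesis using i by blast
    next
      \<comment> \<open>A string leaving on the side of \<open>x\<close> is at least as long as the
        hypotenuse, against the choice of \<open>L\<close>.\<close>
      case 2
      then obtain A R :: real where AR: "0 \<le> A" "0 \<le> R" "norm (A, s - 0) + R \<le> L"
        and dl: "\<forall>r\<in>{0..1}. d (?l r) ?z \<le> norm (A, r - 0) + R"
        unfolding leaves_def by (elim exE conjE) (rule that; assumption)
      have "r \<le> A + R" using dl [THEN bspec, of 0] l(2) z(1) AR by (simp add: norm_Pair)
      then have "norm (r, s) \<le> norm (A + R, s)" using r by (simp add: norm_Pair power_mono)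
      also have "\<dots> \<le> norm (A, s) + R"
        using norm_triangle_ineq [of "(A, s)" "(R, 0 :: real)"] AR by (simp add: norm_Pair)
      finally show ?thesis using AR L by simp
    next
      \<comment> \<open>Reaching the far end of the edge alone costs 7/8.\<close>
      case 3
      then obtain A R :: real where AR: "0 \<le> A" "0 \<le> R" "norm (A, s - 1) + R \<le> L"
        unfolding leaves_def by blast
      have "\<bar>s - 1\<bar> \<le> norm (A, s - 1)" using norm_snd_le [of "s - 1" A] by simp
      then show ?thesis using AR L rs by (simp add: s_def)
    qed
  qed
  show ?thesis by (rule that [OF u]) (rule main)
qed

subsection \<open>Counting separating halfspaces\<close>

lemma descending_iff: "adj x y \<Longrightarrow> p \<in> verts \<Longrightarrow> p \<notin> hs x y \<longleftrightarrow> d p y < d p x"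
  using ends_differ [of x y p] unfolding hs_def by auto

lemma card_descending:
  assumes "x \<in> verts" "p \<in> verts"
  shows "finite {y. adj x y \<and> p \<notin> hs x y}" "card {y. adj x y \<and> p \<notin> hs x y} \<le> N"
proof -
  obtain c u where cu: "corner c u"
    and ex: "\<And>y. adj x y \<Longrightarrow> d p y < d p x \<Longrightarrow> \<exists>i<cdim K c. y = chart K c (u(i := 1 - u i))"
    using descending_edges_in_cube [OF assms] by metis
  have sub: "{y. adj x y \<and> p \<notin> hs x y} \<subseteq> (\<lambda>i. chart K c (u(i := 1 - u i))) ` {..<cdim K c}"
    using ex descending_iff [OF _ assms(2)] by blast
  then show "finite {y. adj x y \<and> p \<notin> hs x y}" by (rule finite_subset) simp
  have "card {y. adj x y \<and> p \<notin> hs x y} \<le> card {..<cdim K c}"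
    using surj_card_le [OF _ sub] by simp
  also have "\<dots> \<le> N" using dim_le cu by (simp add: corner_def)
  finally show "card {y. adj x y \<and> p \<notin> hs x y} \<le> N" .
qed

text \<open>Both edges lie in the one cube given by \<open>descending_edges_in_cube\<close>, so
  flipping both coordinates there completes the square.\<close>

lemma descending_square:
  assumes x: "x \<in> verts" and p: "p \<in> verts" and xy: "adj x y" "p \<notin> hs x y" and xz: "adj x z" "p \<notin> hs x z"
    and ne: "y \<noteq> z"
  obtains w where "adj y w" "adj z w" "hs z w = hs x y" "hs y w = hs x z"
proof -
  obtain c u where cu: "corner c u" "x = chart K c u"
    and ex: "\<And>y. adj x y \<Longrightarrow> d p y < d p x \<Longrightarrow> \<exists>i<cdim K c. y = chart K c (u(i := 1 - u i))"
    using descending_edges_in_cube [OF x p] by metis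
  obtain i where i: "i < cdim K c" "y = chart K c (u(i := 1 - u i))"
    using ex xy descending_iff [OF xy(1) p] by blast
  obtain j where j: "j < cdim K c" "z = chart K c (u(j := 1 - u j))"
    using ex xz descending_iff [OF xz(1) p] by blast
  have ij: "i \<noteq> j" using ne i j by auto
  have ci: "corner c (u(i := 1 - u i))" and cj: "corner c (u(j := 1 - u j))"
    using corner_flip cu i j by blast+
  let ?w = "chart K c (u(i := 1 - u i, j := 1 - u j))"
  have tw: "u(i := 1 - u i, j := 1 - u j) = u(j := 1 - u j, i := 1 - u i)"
    using ij by (rule fun_upd_twist)
  have w1: "?w = chart K c ((u(i := 1 - u i))(j := 1 - (u(i := 1 - u i)) j))"
    using ij by simp
  have w2: "?w = chart K c ((u(j := 1 - u j))(i := 1 - (u(j := 1 - u j)) i))"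
    using ij tw by simp
  have "adj y ?w" "adj z ?w"
    unfolding i(2) j(2) by (simp only: w1 adj_corner [OF ci j(1)], simp only: w2 adj_corner [OF cj i(1)])
  moreover have "hs z ?w = hs x y"
    using hs_parallel [OF cj cu(1) i(1)] ij unfolding w2 i(2) j(2) cu(2) by simp
  moreover have "hs y ?w = hs x z"
    using hs_parallel [OF ci cu(1) j(1)] ij unfolding w1 i(2) j(2) cu(2) by simp
  ultimately show ?thesis using that by blast
qed

lemma cube_path:
  assumes "corner c u" "corner c w"
  shows "(adj ^^ card {i. i < cdim K c \<and> u i \<noteq> w i}) (chart K c u) (chart K c w)"
  using assms(1)
proof (induction "card {i. i < cdim K c \<and> u i \<noteq> w i}" arbitrary: u)
  case 0
  then have "u i = w i" if "i < cdim K c" for i using that by auto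
  then have "u = w"
    using 0(2) assms(2) by (intro unit_cube_eqI [of u "cdim K c" w]) (simp_all add: corner_def cube_of_def)
  then show ?case by simp
next
  case (Suc k)
  let ?X = "\<lambda>u. {i. i < cdim K c \<and> u i \<noteq> w i}"
  have fin: "finite (?X u)" for u by simp
  have "?X u \<noteq> {}" using Suc(2) by (metis card.empty nat.distinct(1))
  then obtain i where i: "i < cdim K c" "u i \<noteq> w i" by blast
  let ?u = "u(i := 1 - u i)"
  have c': "corner c ?u" using corner_flip [OF Suc(3) i(1)] .
  have "u i = 0 \<or> u i = 1" "w i = 0 \<or> w i = 1" using Suc(3) assms(2) i by (simp_all add: corner_def)
  then have "1 - u i = w i" using i by auto
  then have X: "?X ?u = ?X u - {i}" using i by auto
  have "k = card (?X ?u)" unfolding X using Suc(2) i fin by simp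
  then have "(adj ^^ k) (chart K c ?u) (chart K c w)" using Suc(1) [of ?u] c' by simp
  then have "(adj ^^ Suc k) (chart K c u) (chart K c w)"
    using relpowp_Suc_I2 [of adj "chart K c u" "chart K c ?u" k "chart K c w"] adj_corner [OF Suc(3) i(1)] by blast
  then show ?case using Suc(2) by simp
qed

lemma corner_difference_sum:
  assumes "corner c u" "corner c w"
  shows "real (card {i. i < cdim K c \<and> u i \<noteq> w i}) = (\<Sum>i<cdim K c. \<bar>u i - w i\<bar>)"
proof -
  have eq: "\<bar>u i - w i\<bar> = (if u i \<noteq> w i then 1 else 0)" if i: "i < cdim K c" for i
  proof -
    have "u i = 0 \<or> u i = 1" "w i = 0 \<or> w i = 1" using assms i by (simp_all add: corner_def)
    then show ?thesis by auto
  qed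
  have "(\<Sum>i<cdim K c. \<bar>u i - w i\<bar>) = (\<Sum>i<cdim K c. if u i \<noteq> w i then 1 else 0)"
    by (rule sum.cong [OF refl]) (simp add: eq)
  also have "\<dots> = real (card {i. i < cdim K c \<and> u i \<noteq> w i})"
    by (simp add: sum.If_cases Int_def)
  finally show ?thesis by simp
qed

text \<open>Consecutive cubes of a string share a corner, and the corners of one cube are joined by
  edges of that cube.\<close>

lemma verts_connected:
  assumes "x \<in> verts" "p \<in> verts"
  shows "adj\<^sup>*\<^sup>* x p"
proof -
  have "adj\<^sup>*\<^sup>* x (chart K c w)"
    if "string_length K x q L" "c \<in> cubes K" "u \<in> cube_of K c" "q = chart K c u" "corner c w" "x \<in> verts" for q L c u w
    using that
  proof (induction arbitrary: c u w rule: string_length.induct)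
    case (string_refl x)
    have "corner c u" using vert_corner [OF string_refl.prems(1,2)] string_refl.prems by simp
    then show ?case
      using relpowp_imp_rtranclp [OF cube_path [OF _ string_refl.prems(4)]] string_refl.prems(3) by simp
  next
    case (string_step x c1 u1 L v1)
    obtain a a' where a: "corner c1 a" "corner c a'" "chart K c1 a = chart K c a'"
      using common_corner [OF string_step.hyps(2,4) string_step.prems(1-3)] by blast
    have "adj\<^sup>*\<^sup>* x (chart K c1 a)"
      using string_step.IH [OF string_step.hyps(2,3) refl a(1) string_step.prems(5)] .
    also have "adj\<^sup>*\<^sup>* (chart K c1 a) (chart K c w)"
      unfolding a(3) by (rule relpowp_imp_rtranclp [OF cube_path [OF a(2) string_step.prems(4)]])
    finally show ?case .
  qed
  moreover obtain L where "string_length K x p L"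
    using string_near_d [of x p "d x p + 1"] assms verts_points by auto
  moreover obtain c w where "corner c w" "p = chart K c w" using assms(2) unfolding verts_def by blast
  ultimately show ?thesis using assms(1) unfolding corner_def by blast
qed

section \<open>Halfspaces separating two vertices\<close>

definition halfspaces :: "'a set set" where "halfspaces = {hs a b | a b. adj a b}"

definition sep :: "'a \<Rightarrow> 'a \<Rightarrow> 'a set set"
  where "sep x p = {A \<in> halfspaces. x \<in> A \<and> p \<notin> A}"

lemma sep_self [simp]: "sep x x = {}" by (auto simp: sep_def)

text \<open>By \<open>hs_unique\<close> a halfspace containing exactly one end of the edge is
  \<open>hs x y\<close> or its complement, and the complement contains \<open>p\<close>.\<close>

lemma sep_step:
  assumes xy: "adj x y" and p: "p \<in> verts" "p \<notin> hs x y"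
  shows "sep x p = insert (hs x y) (sep y p)" "hs x y \<notin> sep y p"
proof -
  have H: "hs x y \<in> halfspaces" unfolding halfspaces_def using xy by blast
  have 1: "A = hs x y \<or> y \<in> A" if "A \<in> halfspaces" "x \<in> A" for A
    using that hs_unique [OF _ xy] unfolding halfspaces_def by blast
  have 2: "x \<in> A" if A: "A \<in> halfspaces" "y \<in> A" "p \<notin> A" for A
  proof (rule ccontr)
    assume "x \<notin> A"
    then have "hs y x = A" using A hs_unique [OF _ adj_sym [OF xy]] unfolding halfspaces_def by blast
    then show False using A p hs_complement [OF xy] by blast
  qed
  show "sep x p = insert (hs x y) (sep y p)"
    unfolding sep_def using 1 2 H mem_hs [OF xy] p by blast
  show "hs x y \<notin> sep y p" using mem_hs [OF xy] by (simp add: sep_def)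
qed

text \<open>Induction along an edge path from \<open>p\<close>, where nothing separates; every edge
  changes the set by one member.\<close>

lemma finite_sep:
  assumes "x \<in> verts" "p \<in> verts" shows "finite (sep x p)"
  using verts_connected [OF assms(2,1)]
proof (induction rule: rtranclp_induct)
  case (step y z)
  show ?case
  proof (cases "p \<in> hs z y")
    case True
    then have "p \<notin> hs y z" using hs_complement [OF adj_sym [OF step(2)]] by blast
    then show ?thesis using sep_step(1) [OF step(2) assms(2)] step(3) by simp
  next
    case False
    then show ?thesis using sep_step(1) [OF adj_sym [OF step(2)] assms(2)] step(3) by simp
  qed
qed simp

lemma card_sep_step:
  assumes "adj x y" "p \<in> verts" "p \<notin> hs x y"
  shows "card (sep x p) = Suc (card (sep y p))"
  using sep_step [OF assms] finite_sep [OF adj_verts(2) [OF assms(1)] assms(2)] by simp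

lemma card_sep_adj:
  assumes "adj x y" "p \<in> verts" shows "card (sep y p) \<le> card (sep x p) + 1"
proof (cases "p \<in> hs x y")
  case True
  then have "p \<notin> hs y x" using hs_complement [OF assms(1)] by blast
  then show ?thesis using card_sep_step [OF adj_sym [OF assms(1)] assms(2)] by simp
next
  case False
  then show ?thesis using card_sep_step [OF assms] by simp
qed

lemma card_sep_path:
  assumes "(adj ^^ k) x y" "p \<in> verts" shows "card (sep y p) \<le> card (sep x p) + k"
  using assms(1)
proof (induction k arbitrary: y)
  case (Suc k)
  then obtain z where "(adj ^^ k) x z" "adj z y" by auto
  then show ?case using Suc.IH card_sep_adj [OF _ assms(2), of z y] by fastforce
qed simp

lemma descending_neighbour:
  assumes "x \<in> verts" "p \<in> verts" "x \<noteq> p"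
  obtains y where "adj x y" "p \<notin> hs x y"
  using descending_edge_exists [OF assms] descending_iff [OF _ assms(2)] by metis

lemma sep_nonempty:
  assumes "x \<in> verts" "p \<in> verts" "x \<noteq> p" shows "sep x p \<noteq> {}"
proof -
  obtain y where "adj x y" "p \<notin> hs x y" using descending_neighbour [OF assms] .
  then show ?thesis using sep_step(1) [OF _ assms(2)] by simp
qed

text \<open>From every vertex other than \<open>p\<close> an edge of length 1 descends towards
  \<open>p\<close>, and crossing it removes exactly one separating halfspace.\<close>

lemma d_le_card_sep:
  assumes "x \<in> verts" "p \<in> verts" shows "d x p \<le> card (sep x p)"
  using assms(1)
proof (induction "card (sep x p)" arbitrary: x)
  case 0
  then have "x = p" using sep_nonempty [OF 0(2) assms(2)] finite_sep [OF 0(2) assms(2)] by auto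
  then show ?case using verts_points [OF assms(2)] by simp
next
  case (Suc k)
  then have "x \<noteq> p" by auto
  then obtain y where y: "adj x y" "p \<notin> hs x y" using descending_neighbour [OF Suc(3) assms(2)] by blast
  have k: "card (sep x p) = Suc (card (sep y p))" using card_sep_step [OF y(1) assms(2) y(2)] .
  have yv: "y \<in> verts" using adj_verts y by blast
  have "d x p \<le> d x y + d y p" using d_triangle verts_points Suc(3) assms(2) yv by blast
  moreover have "d y p \<le> card (sep y p)" using Suc(1) [of y] Suc(2) k yv by simp
  ultimately show ?case using adj_dist [OF y(1)] k by simp
qed

text \<open>If a minimal \<open>A\<close> is dual to no edge at \<open>x\<close>, move to a neighbour \<open>y\<close> towards \<open>p\<close>; by induction
  \<open>A\<close> is dual to an edge \<open>y z\<close>.  Seen from a point separated from \<open>y\<close> by both \<open>A\<close> and \<open>hs x y\<close>, the edges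
  \<open>y x\<close> and \<open>y z\<close> span a square.\<close>

lemma minimal_sep_dual_edge:
  assumes "x \<in> verts" "p \<in> verts" "A \<in> sep x p" "\<And>B. B \<in> sep x p \<Longrightarrow> \<not> B \<subset> A"
  shows "\<exists>y. adj x y \<and> hs x y = A"
  using assms(1,3,4)
proof (induction "card (sep x p)" arbitrary: x rule: less_induct)
  case less
  have "x \<noteq> p" using less.prems by auto
  then obtain y where y: "adj x y" "p \<notin> hs x y" using descending_neighbour [OF less.prems(1) assms(2)] by blast
  have yv: "y \<in> verts" using adj_verts y by blast
  note step = sep_step [OF y(1) assms(2) y(2)]
  show ?case
  proof (cases "A = hs x y")
    case True
    then show ?thesis using y by blast
  next
    case ne: False
    then have Ay: "A \<in> sep y p" using less.prems(2) step by blast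
    have "card (sep y p) < card (sep x p)" using card_sep_step [OF y(1) assms(2) y(2)] by simp
    then obtain z where z: "adj y z" "hs y z = A"
      using less.hyps [OF _ yv Ay] less.prems(3) step(1) by blast
    have "\<not> hs x y \<subseteq> A" using less.prems(3) [of "hs x y"] step(1) ne by blast
    then obtain v where v: "v \<in> hs x y" "v \<notin> A" by blast
    have vv: "v \<in> verts" using v hs_subset by blast
    have v1: "v \<notin> hs y x" using hs_complement [OF y(1)] v by blast
    have v2: "v \<notin> hs y z" using v z by blast
    have "p \<in> hs y x" using hs_complement [OF y(1)] y assms(2) by blast
    then have "x \<noteq> z" using z Ay by (auto simp: sep_def)
    then obtain w where "adj x w" "hs x w = hs y z"
      using descending_square [OF yv vv adj_sym [OF y(1)] v1 z(1) v2] by metis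
    then show ?thesis using z by blast
  qed
qed

text \<open>Crossing a minimal halfspace below the antichain reduces to the case where the whole antichain is
  dual to edges at \<open>x\<close>.\<close>

lemma antichain_sep_card:
  assumes "x \<in> verts" "p \<in> verts" "F \<subseteq> sep x p" "\<And>A B. A \<in> F \<Longrightarrow> B \<in> F \<Longrightarrow> \<not> A \<subset> B"
  shows "card F \<le> N"
  using assms(1,3)
proof (induction "card (sep x p)" arbitrary: x rule: less_induct)
  case less
  have fin: "finite (sep x p)" using finite_sep [OF less.prems(1) assms(2)] .
  show ?case
  proof (cases "\<forall>A\<in>F. \<forall>B\<in>sep x p. \<not> B \<subset> A")
    case True
    have "F \<subseteq> hs x ` {y. adj x y \<and> p \<notin> hs x y}"
    proof
      fix A assume A: "A \<in> F"
      have AS: "A \<in> sep x p" using A less.prems(2) by blast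
      have "\<not> B \<subset> A" if "B \<in> sep x p" for B using True A that by blast
      then have "\<exists>y. adj x y \<and> hs x y = A"
        by (rule minimal_sep_dual_edge [OF less.prems(1) assms(2) AS])
      moreover have "p \<notin> A" using A less.prems(2) by (auto simp: sep_def)
      ultimately show "A \<in> hs x ` {y. adj x y \<and> p \<notin> hs x y}" by blast
    qed
    then have "card F \<le> card {y. adj x y \<and> p \<notin> hs x y}"
      by (rule surj_card_le [OF card_descending(1) [OF less.prems(1) assms(2)]])
    then show ?thesis using card_descending(2) [OF less.prems(1) assms(2)] by linarith
  next
    case False
    then obtain A B where AB: "A \<in> F" "B \<in> sep x p" "B \<subset> A" by blast
    obtain M where M: "M \<in> sep x p" "M \<subseteq> B" "\<forall>C\<in>sep x p. C \<subseteq> M \<longrightarrow> M = C"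
      using finite_has_minimal2 [OF fin AB(2)] by blast
    have "\<not> C \<subset> M" if "C \<in> sep x p" for C using M(3) that by blast
    then have "\<exists>y. adj x y \<and> hs x y = M"
      by (rule minimal_sep_dual_edge [OF less.prems(1) assms(2) M(1)])
    then obtain y where y: "adj x y" "hs x y = M" by blast
    have py: "p \<notin> hs x y" using y M(1) by (simp add: sep_def)
    have "M \<notin> F" using assms(4) [of M A] AB M(2) by blast
    moreover have "F \<subseteq> insert M (sep y p)"
      using less.prems(2) unfolding sep_step(1) [OF y(1) assms(2) py] y(2) .
    ultimately have Fy: "F \<subseteq> sep y p" by (rule subset_insert [THEN iffD1])
    have "card (sep y p) < card (sep x p)" using card_sep_step [OF y(1) assms(2) py] by simp
    then show ?thesis by (rule less.hyps [OF _ adj_verts(2) [OF y(1)] Fy])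
  qed
qed

text \<open>On each cube the number of halfspaces between \<open>x\<close> and a corner is the restriction of an affine
  function; along a string this function grows at most \<open>N\<close> times as fast as the length.\<close>

lemma card_sep_string:
  assumes "string_length K x q L" "x \<in> verts" "c \<in> cubes K" "u \<in> cube_of K c" "q = chart K c u" "corner c w"
  shows "card (sep (chart K c w) x) \<le> real N * L + (\<Sum>i<cdim K c. \<bar>u i - w i\<bar>)"
  using assms
proof (induction arbitrary: c u w rule: string_length.induct)
  case (string_refl x)
  have cu: "corner c u" using vert_corner [OF string_refl.prems(2,3)] string_refl.prems by simp
  have "card (sep (chart K c w) x) \<le> card (sep x x) + card {i. i < cdim K c \<and> u i \<noteq> w i}"
    using card_sep_path [OF cube_path [OF cu string_refl.prems(5)] string_refl.prems(1)] string_refl.prems(4) by simp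
  then show ?case using corner_difference_sum [OF cu string_refl.prems(5)] by simp
next
  case (string_step x c1 u1 L v1)
  note c = string_step.prems(2,3) and c1 = string_step.hyps(2)
  obtain I \<pi> b where match: "cube_match c u c1 v1 I \<pi> b"
    using cubes_meet [OF c c1 string_step.hyps(4) string_step.prems(4) [symmetric]] by blast
  note I = cube_matchD(1-3) [OF match] and f1 = cube_matchD(4) [OF match] and f2 = cube_matchD(5) [OF match]
  \<comment> \<open>\<open>v\<close> agrees with \<open>w\<close> in the free directions of the
    common face and with \<open>u\<close> in the others, so it is a corner of both cubes. The free
    directions are charged to \<open>c1\<close>, the others to an edge path in
    \<open>c\<close>.\<close>
  define v where "v = (\<lambda>j. if j \<in> I then w j else u j)"
  have wc: "w \<in> cube_of K c" and w01: "\<And>j. j < cdim K c \<Longrightarrow> w j = 0 \<or> w j = 1"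
    using string_step.prems(5) by (simp_all add: corner_def)
  have vc: "v \<in> cube_of K c"
  proof -
    have "0 \<le> v j \<and> v j \<le> 1" if "j < cdim K c" for j
      using cube_mem [OF wc that] cube_mem [OF c(2) that] by (simp add: v_def)
    moreover have "v j = undefined" if "\<not> j < cdim K c" for j
      using that wc c(2) by (simp add: v_def cube_of_def unit_cube_def PiE_iff extensional_def)
    ultimately show ?thesis by (auto simp: cube_of_def unit_cube_def PiE_iff extensional_def)
  qed
  have v: "corner c v" using vc c f1 w01 by (simp add: corner_def v_def)
  have "u j = v j" if "j \<notin> I" for j using that by (simp add: v_def)
  then obtain v' where v': "v' \<in> cube_of K c1" "chart K c v = chart K c1 v'"
    "\<forall>i\<in>I. v' (\<pi> i) = flip (b i) (v i)" "\<forall>j<cdim K c1. j \<notin> \<pi> ` I \<longrightarrow> v' j = v1 j"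
    by (rule cube_match_extend [OF match vc]) (assumption | rule that)+
  have cv': "corner c1 v'" using corner_transfer [OF v c1 v'(1,2)] .
  have finI: "finite I" using I(1) finite_subset by blast
  have "(\<Sum>k<cdim K c1. \<bar>v1 k - v' k\<bar>) = (\<Sum>k\<in>\<pi> ` I. \<bar>v1 k - v' k\<bar>)"
    using I v'(4) by (intro sum.mono_neutral_right) auto
  also have "\<dots> = (\<Sum>i\<in>I. \<bar>v1 (\<pi> i) - v' (\<pi> i)\<bar>)"
    by (rule sum.reindex_cong [OF I(2) refl refl])
  also have "\<dots> = (\<Sum>i\<in>I. \<bar>u i - w i\<bar>)"
  proof (rule sum.cong [OF refl])
    fix i assume i: "i \<in> I"
    show "\<bar>v1 (\<pi> i) - v' (\<pi> i)\<bar> = \<bar>u i - w i\<bar>"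
      unfolding f2 [OF i] v'(3) [THEN bspec, OF i] using i by (auto simp: v_def flip_def)
  qed
  finally have s1: "(\<Sum>k<cdim K c1. \<bar>v1 k - v' k\<bar>) = (\<Sum>i\<in>I. \<bar>u i - w i\<bar>)" .
  have "(\<Sum>j<cdim K c. \<bar>v j - w j\<bar>) = (\<Sum>j\<in>{..<cdim K c} - I. \<bar>u j - w j\<bar>)"
    by (rule sum.mono_neutral_cong_right) (auto simp: v_def)
  then have s2: "(\<Sum>i\<in>I. \<bar>u i - w i\<bar>) + (\<Sum>j<cdim K c. \<bar>v j - w j\<bar>) = (\<Sum>j<cdim K c. \<bar>u j - w j\<bar>)"
    using sum.subset_diff [OF I(1), of "\<lambda>j. \<bar>u j - w j\<bar>"] by simp
  have "(\<Sum>k<cdim K c1. \<bar>u1 k - v' k\<bar>) \<le> (\<Sum>k<cdim K c1. \<bar>u1 k - v1 k\<bar> + \<bar>v1 k - v' k\<bar>)"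
    by (intro sum_mono) linarith
  also have "\<dots> = (\<Sum>k<cdim K c1. \<bar>u1 k - v1 k\<bar>) + (\<Sum>k<cdim K c1. \<bar>v1 k - v' k\<bar>)"
    by (rule sum.distrib)
  also have "(\<Sum>k<cdim K c1. \<bar>u1 k - v1 k\<bar>) \<le> real (cdim K c1) * cd c1 u1 v1"
    by (rule sum_abs_le_cube_dist)
  also have "\<dots> \<le> real N * cd c1 u1 v1"
    using dim_le [OF c1] by (intro mult_right_mono) simp_all
  finally have s3: "(\<Sum>k<cdim K c1. \<bar>u1 k - v' k\<bar>) \<le> real N * cd c1 u1 v1 + (\<Sum>i\<in>I. \<bar>u i - w i\<bar>)"
    using s1 by simp
  have "card (sep (chart K c1 v') x) \<le> real N * L + (\<Sum>k<cdim K c1. \<bar>u1 k - v' k\<bar>)"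
    by (rule string_step.IH [OF string_step.prems(1) c1 string_step.hyps(3) refl cv'])
  moreover have "card (sep (chart K c w) x) \<le> card (sep (chart K c v) x) + card {i. i < cdim K c \<and> v i \<noteq> w i}"
    by (rule card_sep_path [OF cube_path [OF v string_step.prems(5)] string_step.prems(1)])
  moreover have "real (card {i. i < cdim K c \<and> v i \<noteq> w i}) = (\<Sum>j<cdim K c. \<bar>v j - w j\<bar>)"
    by (rule corner_difference_sum [OF v string_step.prems(5)])
  ultimately show ?case using s2 s3 v'(2) by (simp add: algebra_simps)
qed

lemma card_sep_le:
  assumes "x \<in> verts" "y \<in> verts" shows "card (sep y x) \<le> real N * d x y"
proof (rule field_le_epsilon)
  fix e :: real assume e: "0 < e"
  obtain c w where w: "corner c w" "y = chart K c w" using assms(2) unfolding verts_def by blast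
  have "d x y < d x y + e / (real N + 1)" using e by (simp add: add_pos_nonneg)
  then obtain L where L: "string_length K x y L" "L < d x y + e / (real N + 1)"
    using string_near_d [of x y] verts_points assms by metis
  have "card (sep y x) \<le> real N * L"
    using card_sep_string [OF L(1) assms(1) _ _ w(2) w(1)] w by (simp add: corner_def)
  also have "\<dots> \<le> real N * (d x y + e / (real N + 1))" using L(2) by (intro mult_left_mono) simp_all
  also have "\<dots> \<le> real N * d x y + e" using e by (simp add: field_simps)
  finally show "card (sep y x) \<le> real N * d x y + e" .
qed

subsection \<open>The embedding\<close>

text \<open>The coordinates of \<^typ>\<open>'a ell2\<close> are indexed by points, so a halfspace is represented by the
  midpoint of one of the edges dual to it.\<close>

definition dual_midpoint :: "'a set \<Rightarrow> 'a \<Rightarrow> bool"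
  where "dual_midpoint A q \<longleftrightarrow> (\<exists>c u i. corner c u \<and> i < cdim K c \<and>
    A = hs (chart K c u) (chart K c (u(i := 1 - u i))) \<and> q = chart K c (u(i := 1/2)))"

lemma dual_midpoint_exists: "A \<in> halfspaces \<Longrightarrow> \<exists>q. dual_midpoint A q"
  unfolding halfspaces_def adj_def dual_midpoint_def by blast

text \<open>The single fractional coordinate of the midpoint identifies the edge up to orientation;
  the two orientations give complementary halfspaces, and only one of these misses
  \<open>p\<close>.\<close>

lemma dual_midpoint_unique:
  assumes "dual_midpoint A q" "dual_midpoint A' q" "p \<in> verts" "p \<notin> A" "p \<notin> A'"
  shows "A = A'"
proof -
  obtain c u i where cu: "corner c u" "i < cdim K c"
    and A: "A = hs (chart K c u) (chart K c (u(i := 1 - u i)))" and q: "q = chart K c (u(i := 1/2))"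
    using assms(1) unfolding dual_midpoint_def by blast
  obtain c' u' i' where cu': "corner c' u'" "i' < cdim K c'"
    and A': "A' = hs (chart K c' u') (chart K c' (u'(i' := 1 - u' i')))" and q': "q = chart K c' (u'(i' := 1/2))"
    using assms(2) unfolding dual_midpoint_def by blast
  have c: "c \<in> cubes K" "u(i := 1/2) \<in> cube_of K c" and c': "c' \<in> cubes K" "u'(i' := 1/2) \<in> cube_of K c'"
    using cu cu' cube_upd [of u c i "1/2"] cube_upd [of u' c' i' "1/2"] by (simp_all add: corner_def)
  have eq: "chart K c (u(i := 1/2)) = chart K c' (u'(i' := 1/2))" using q q' by simp
  have half: "0 < (u(i := 1/2)) i" "(u(i := 1/2)) i < 1" by simp_all
  obtain j b where j: "j < cdim K c'" "0 < (u'(i' := 1/2)) j" "(u'(i' := 1/2)) j < 1"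
    and tr: "\<And>s. s \<in> {0..1} \<Longrightarrow> chart K c ((u(i := 1/2))(i := s)) = chart K c' ((u'(i' := 1/2))(j := flip b s))"
    by (rule direction_transfer [OF c c' eq cu(2) half]) (rule that)
  have "j = i'"
  proof (rule ccontr)
    assume "j \<noteq> i'"
    then have "u' j = 0 \<or> u' j = 1" using cu' j(1) by (simp add: corner_def)
    then show False using j(2,3) \<open>j \<noteq> i'\<close> by auto
  qed
  then have tr': "chart K c (u(i := s)) = chart K c' (u'(i' := flip b s))" if "s \<in> {0..1}" for s
    using tr [OF that] by simp
  have ui: "u i = 0 \<or> u i = 1" and ui': "u' i' = 0 \<or> u' i' = 1"
    using cu cu' by (simp_all add: corner_def)
  have 1: "chart K c u = chart K c' (u'(i' := flip b (u i)))"
    using tr' [of "u i"] ui by auto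
  have 2: "chart K c (u(i := 1 - u i)) = chart K c' (u'(i' := flip b (1 - u i)))"
    using tr' [of "1 - u i"] ui by auto
  have a': "adj (chart K c' u') (chart K c' (u'(i' := 1 - u' i')))" using adj_corner cu' by blast
  have "flip b (u i) = u' i' \<and> flip b (1 - u i) = 1 - u' i' \<or> flip b (u i) = 1 - u' i' \<and> flip b (1 - u i) = u' i'"
    using ui ui' by (auto simp: flip_def)
  then have "A = A' \<or> A = hs (chart K c' (u'(i' := 1 - u' i'))) (chart K c' u')"
    unfolding A A' 1 2 by auto
  then show ?thesis using hs_complement [OF a'] A' assms(3-5) by blast
qed

lemma wall_index:
  assumes "p \<in> verts"
  obtains \<iota> :: "'a set \<Rightarrow> 'a" where "inj_on \<iota> {A \<in> halfspaces. p \<notin> A}"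
proof
  define \<iota> where "\<iota> A = (SOME q. dual_midpoint A q)" for A
  have "dual_midpoint A (\<iota> A)" if "A \<in> halfspaces" for A
    unfolding \<iota>_def using dual_midpoint_exists [OF that] by (rule someI_ex)
  then show "inj_on \<iota> {A \<in> halfspaces. p \<notin> A}"
    using dual_midpoint_unique [OF _ _ assms] by (intro inj_onI) (metis (mono_tags, lifting) mem_Collect_eq)
qed

text \<open>Members of \<open>sep x p\<close> contain \<open>x\<close>, so a large height means a
  long nested sequence between \<open>x\<close> and the boundary of \<open>A\<close>. The base
  vertex receives the zero family.\<close>

definition wall_coord :: "'a \<Rightarrow> 'a \<Rightarrow> 'a set \<Rightarrow> real"
  where "wall_coord p x A = (if A \<in> sep x p then weight (height (sep x p) A) else 0)"

text \<open>The new halfspace \<open>hs x y\<close> contains no other member of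
  \<open>sep x p\<close>, as those contain \<open>y\<close>; so its height is at most 1. The other
  heights grow by at most one, and each level holds at most \<open>N\<close> halfspaces, which
  leaves \<open>N\<close> times the sum of the squared increments.\<close>

lemma wall_coord_adj:
  assumes xy: "adj x y" and p: "p \<in> verts" "p \<notin> hs x y"
  shows "(\<Sum>A\<in>sep x p \<union> sep y p. (wall_coord p x A - wall_coord p y A)\<^sup>2)
    \<le> (weight 1)\<^sup>2 + real N * (1 / decay 4 + 1 / ln (ln 4))"
proof -
  let ?B = "hs x y" and ?X = "sep x p" and ?Y = "sep y p"
  have X: "?X = insert ?B ?Y" and B: "?B \<notin> ?Y" using sep_step [OF xy p] by simp_all
  have yv: "y \<in> verts" using adj_verts xy by blast
  have finY: "finite ?Y" using finite_sep [OF yv p(1)] .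
  have finX: "finite ?X" using finY X by simp
  have "height ?X ?B \<le> 1"
  proof -
    obtain C where C: "C \<in> chains_below ?X ?B" "card C = height ?X ?B" using height_attained [OF finX] .
    have "C \<subseteq> {?B}"
    proof
      fix A assume A: "A \<in> C"
      then have "A \<in> insert ?B ?Y" "A \<subseteq> ?B" using C(1) X by (auto simp: chains_below_def)
      then show "A \<in> {?B}" using mem_hs(2) [OF xy] by (auto simp: sep_def)
    qed
    then show ?thesis using C(2) card_mono [of "{?B}" C] by simp
  qed
  then have wB: "(weight (height ?X ?B))\<^sup>2 \<le> (weight 1)\<^sup>2"
    using weight_mono weight_nonneg by (intro power_mono) auto
  define G where "G k = (weight (Suc k) - weight k)\<^sup>2" for k
  have anti: "card F \<le> N" if "F \<subseteq> ?Y" "\<And>A B. A \<in> F \<Longrightarrow> B \<in> F \<Longrightarrow> \<not> A \<subset> B" for F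
    using antichain_sep_card [OF yv p(1) that] .
  \<comment> \<open>Any upper bound on the heights serves, since the estimate for the increments is
    uniform in the number of terms.\<close>
  have bound: "height ?Y A < Suc (\<Sum>A\<in>?Y. height ?Y A)" if "A \<in> ?Y" for A
    using member_le_sum [OF that, of "height ?Y"] finY by simp
  have "(\<Sum>A\<in>?X \<union> ?Y. (wall_coord p x A - wall_coord p y A)\<^sup>2)
      = (\<Sum>A\<in>insert ?B ?Y. (wall_coord p x A - wall_coord p y A)\<^sup>2)"
    using X by (intro sum.cong) auto
  also have "\<dots> = (weight (height ?X ?B))\<^sup>2 + (\<Sum>A\<in>?Y. (weight (height ?X A) - weight (height ?Y A))\<^sup>2)"
    using B finY X by (simp add: wall_coord_def)
  also have "(\<Sum>A\<in>?Y. (weight (height ?X A) - weight (height ?Y A))\<^sup>2) \<le> (\<Sum>A\<in>?Y. G (height ?Y A))"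
  proof (rule sum_mono)
    fix A assume "A \<in> ?Y"
    have "height ?Y A \<le> height ?X A" using X by (intro height_mono [OF finX]) auto
    moreover have "height ?X A \<le> Suc (height ?Y A)" unfolding X by (rule height_insert [OF finY])
    ultimately show "(weight (height ?X A) - weight (height ?Y A))\<^sup>2 \<le> G (height ?Y A)"
      unfolding G_def by (rule weight_increment_mono)
  qed
  also have "(\<Sum>A\<in>?Y. G (height ?Y A)) \<le> real N * (\<Sum>k<Suc (\<Sum>A\<in>?Y. height ?Y A). G k)"
    by (rule sum_height_le [OF finY anti _ bound]) (simp_all add: G_def)
  also have "\<dots> \<le> real N * (1 / decay 4 + 1 / ln (ln 4))"
    unfolding G_def by (intro mult_left_mono sum_weight_increments_le) simp
  finally show ?thesis using wB by simp
qed

text \<open>On \<open>D\<close> the coordinates of \<open>y\<close> vanish, so each squared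
  difference is a squared weight at a height that is at least the rank in \<open>D\<close>.\<close>

lemma wall_coord_chain:
  assumes x: "x \<in> verts" and y: "y \<in> verts" and p: "p \<in> verts"
    and D: "D \<subseteq> sep x p" "D \<inter> sep y p = {}" "\<And>A B. A \<in> D \<Longrightarrow> B \<in> D \<Longrightarrow> A \<subseteq> B \<or> B \<subseteq> A"
  shows "weight_sum (card D) \<le> (\<Sum>A\<in>sep x p \<union> sep y p. (wall_coord p x A - wall_coord p y A)\<^sup>2)"
proof -
  have fin: "finite (sep x p)" "finite (sep y p)" using finite_sep x y p by blast+
  have "weight_sum (card D) \<le> (\<Sum>A\<in>D. (weight (height (sep x p) A))\<^sup>2)"
    unfolding weight_sum_def
    by (rule sum_height_chain_ge [OF fin(1) D(1,3)]) (use weight_mono weight_nonneg in \<open>auto intro: power_mono\<close>)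
  also have "\<dots> = (\<Sum>A\<in>D. (wall_coord p x A - wall_coord p y A)\<^sup>2)"
    using D(1,2) by (intro sum.cong) (auto simp: wall_coord_def)
  also have "\<dots> \<le> (\<Sum>A\<in>sep x p \<union> sep y p. (wall_coord p x A - wall_coord p y A)\<^sup>2)"
    using fin D(1) by (intro sum_mono2) auto
  finally show ?thesis .
qed

text \<open>Mirsky's argument: the levels of the height are antichains, so the number of separating
  halfspaces is at most \<open>N\<close> times the greatest height.\<close>

lemma long_chain_exists:
  assumes x: "x \<in> verts" and y: "y \<in> verts"
  obtains C where "C \<subseteq> sep x y" "\<And>A B. A \<in> C \<Longrightarrow> B \<in> C \<Longrightarrow> A \<subseteq> B \<or> B \<subseteq> A" "d x y \<le> real N * real (card C)"
proof (cases "sep x y = {}")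
  case True
  then show ?thesis using that [of "{}"] d_le_card_sep [OF x y] by simp
next
  case False
  let ?X = "sep x y"
  have fin: "finite ?X" using finite_sep [OF x y] .
  define M where "M = Max (height ?X ` ?X)"
  have "M \<in> height ?X ` ?X" unfolding M_def using fin False by (intro Max_in) auto
  then obtain A where A: "A \<in> ?X" "height ?X A = M" by auto
  obtain C where C: "C \<in> chains_below ?X A" "card C = height ?X A" using height_attained [OF fin] .
  have anti: "card F \<le> N" if "F \<subseteq> ?X" "\<And>A B. A \<in> F \<Longrightarrow> B \<in> F \<Longrightarrow> \<not> A \<subset> B" for F
    using antichain_sep_card [OF x y that] .
  have hM: "height ?X B \<le> M" if "B \<in> ?X" for B unfolding M_def using fin that by simp
  \<comment> \<open>Height 0 does not occur in \<open>?X\<close>; giving it the value 0 yields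
    \<open>M\<close> levels instead of \<open>M + 1\<close>.\<close>
  define g :: "nat \<Rightarrow> real" where "g k = (if k = 0 then 0 else 1)" for k
  have "real (card ?X) = (\<Sum>B\<in>?X. g (height ?X B))"
  proof -
    have "g (height ?X B) = 1" if "B \<in> ?X" for B using height_pos [OF fin that] by (simp add: g_def)
    then show ?thesis by simp
  qed
  also have "\<dots> \<le> real N * (\<Sum>k<Suc M. g k)"
    by (rule sum_height_le [OF fin anti]) (use hM in \<open>auto simp: g_def less_Suc_eq_le\<close>)
  also have "(\<Sum>k<Suc M. g k) = real M" by (simp add: g_def sum.lessThan_Suc_shift del: sum.lessThan_Suc)
  finally have "d x y \<le> real N * real (card C)" using d_le_card_sep [OF x y] C(2) A(2) by simp
  then show ?thesis using that [of C] C(1) by (auto simp: chains_below_def)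
qed

lemma halfspace_complement: "A \<in> halfspaces \<Longrightarrow> verts - A \<in> halfspaces"
  unfolding halfspaces_def using hs_complement adj_sym by blast

lemma halfspace_subset: "A \<in> halfspaces \<Longrightarrow> A \<subseteq> verts"
  unfolding halfspaces_def using hs_subset by blast

text \<open>Of the halfspaces in a long chain between \<open>x\<close> and \<open>y\<close>, those missing \<open>p\<close> are coordinates of \<open>x\<close>
  only; the complements of the others are coordinates of \<open>y\<close> only.\<close>

lemma wall_coord_lower:
  assumes x: "x \<in> verts" and y: "y \<in> verts" and p: "p \<in> verts"
  shows "weight_sum (nat \<lceil>d x y / (2 * real N)\<rceil>)
    \<le> (\<Sum>A\<in>sep x p \<union> sep y p. (wall_coord p x A - wall_coord p y A)\<^sup>2)" (is "_ \<le> ?S")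
proof -
  obtain C where C: "C \<subseteq> sep x y" "\<And>A B. A \<in> C \<Longrightarrow> B \<in> C \<Longrightarrow> A \<subseteq> B \<or> B \<subseteq> A"
    and d: "d x y \<le> real N * real (card C)" using long_chain_exists [OF x y] by blast
  have finC: "finite C" using C(1) finite_sep [OF x y] by (rule finite_subset)
  define D where "D = {A \<in> C. p \<notin> A}"
  define E where "E = {A \<in> C. p \<in> A}"
  have CH: "A \<in> halfspaces" "x \<in> A" "y \<notin> A" if "A \<in> C" for A using C(1) that by (auto simp: sep_def)
  have "C = D \<union> E" "D \<inter> E = {}" by (auto simp: D_def E_def)
  then have card: "card C = card D + card E" using finC by (metis card_Un_disjoint finite_Un)
  have Dsum: "weight_sum (card D) \<le> ?S"
  proof (rule wall_coord_chain [OF x y p])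
    show "D \<subseteq> sep x p" "D \<inter> sep y p = {}" using CH by (auto simp: D_def sep_def)
    show "A \<subseteq> B \<or> B \<subseteq> A" if "A \<in> D" "B \<in> D" for A B using that C(2) by (auto simp: D_def)
  qed
  let ?co = "\<lambda>A. verts - A"
  have inj: "inj_on ?co E"
  proof (rule inj_onI)
    fix A B assume "A \<in> E" "B \<in> E" "verts - A = verts - B"
    moreover have "A \<subseteq> verts" "B \<subseteq> verts"
      using calculation CH halfspace_subset by (auto simp: E_def)
    ultimately show "A = B" by blast
  qed
  have "weight_sum (card (?co ` E)) \<le> (\<Sum>A\<in>sep y p \<union> sep x p. (wall_coord p y A - wall_coord p x A)\<^sup>2)"
  proof (rule wall_coord_chain [OF y x p])
    show "?co ` E \<subseteq> sep y p" "?co ` E \<inter> sep x p = {}"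
      using CH halfspace_complement y p by (auto simp: E_def sep_def)
    show "A \<subseteq> B \<or> B \<subseteq> A" if AB: "A \<in> ?co ` E" "B \<in> ?co ` E" for A B
    proof -
      obtain A' B' where *: "A' \<in> E" "B' \<in> E" "A = verts - A'" "B = verts - B'" using AB by blast
      then have "A' \<subseteq> B' \<or> B' \<subseteq> A'" using C(2) by (simp add: E_def)
      then show ?thesis using * by blast
    qed
  qed
  then have Esum: "weight_sum (card E) \<le> ?S"
    unfolding card_image [OF inj] by (simp add: Un_commute power2_commute)
  let ?m = "max (card D) (card E)"
  have "d x y \<le> real N * (2 * real ?m)"
  proof -
    have "card C \<le> 2 * ?m" using card by simp
    then have "real (card C) \<le> 2 * real ?m" by linarith
    then have "real N * real (card C) \<le> real N * (2 * real ?m)" by (intro mult_left_mono) simp_all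
    then show ?thesis using d by linarith
  qed
  then have "d x y / (2 * real N) \<le> real ?m"
    by (cases "N = 0") (simp_all add: divide_le_eq mult_ac)
  then have "nat \<lceil>d x y / (2 * real N)\<rceil> \<le> ?m" by (simp add: nat_le_iff ceiling_le_iff)
  then have "weight_sum (nat \<lceil>d x y / (2 * real N)\<rceil>) \<le> weight_sum ?m" by (rule weight_sum_mono)
  also have "\<dots> \<le> ?S" using Dsum Esum by (simp add: max_def)
  finally show ?thesis .
qed

text \<open>For the Lipschitz bound, descend from \<open>x\<close> to \<open>y\<close> along
  \<open>card (sep x y)\<close> edges, a number that is at most \<open>N\<close> times the distance.
  The position of \<open>p\<close> only decides which end of an edge counts as the farther
  one.\<close>

lemma vertex_embedding:
  assumes p: "p \<in> verts"
  obtains F :: "'a \<Rightarrow> 'a ell2" and C :: real where "0 \<le> C"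
    "\<And>x y. x \<in> verts \<Longrightarrow> y \<in> verts \<Longrightarrow> dist (F x) (F y) \<le> C * d x y"
    "\<And>x y. x \<in> verts \<Longrightarrow> y \<in> verts \<Longrightarrow> sqrt (weight_sum (nat \<lceil>d x y / (2 * real N)\<rceil>)) \<le> dist (F x) (F y)"
proof -
  obtain \<iota> :: "'a set \<Rightarrow> 'a" where inj: "inj_on \<iota> {A \<in> halfspaces. p \<notin> A}" using wall_index [OF p] .
  have "\<exists>F :: 'a \<Rightarrow> 'a ell2. \<forall>x\<in>verts. \<forall>y\<in>verts.
      (dist (F x) (F y))\<^sup>2 = (\<Sum>A\<in>sep x p \<union> sep y p. (wall_coord p x A - wall_coord p y A)\<^sup>2)"
    by (rule ell2_finite_support_realization [OF inj finite_sep [OF _ p]]) (auto simp: sep_def wall_coord_def)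
  then obtain F :: "'a \<Rightarrow> 'a ell2" where F0: "\<forall>x\<in>verts. \<forall>y\<in>verts.
      (dist (F x) (F y))\<^sup>2 = (\<Sum>A\<in>sep x p \<union> sep y p. (wall_coord p x A - wall_coord p y A)\<^sup>2)"
    by blast
  note F = F0 [THEN bspec, THEN bspec]
  define C where "C = sqrt ((weight 1)\<^sup>2 + real N * (1 / decay 4 + 1 / ln (ln 4)))"
  have nn: "0 \<le> 1 / decay 4 + 1 / ln (ln (4 :: real))" using decay_pos [of 4] lnln_pos [of 4] by simp
  have C0: "0 \<le> C"
    unfolding C_def by (rule real_sqrt_ge_zero [OF add_nonneg_nonneg [OF zero_le_power2 mult_nonneg_nonneg [OF of_nat_0_le_iff nn]]])
  have desc: "dist (F x) (F y) \<le> C" if "adj x y" "p \<notin> hs x y" for x y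
  proof -
    have "(dist (F x) (F y))\<^sup>2 \<le> (weight 1)\<^sup>2 + real N * (1 / decay 4 + 1 / ln (ln 4))"
      unfolding F [OF adj_verts [OF that(1)]] by (rule wall_coord_adj [OF that(1) p that(2)])
    then show ?thesis unfolding C_def by (rule real_le_rsqrt)
  qed
  have step: "dist (F x) (F y) \<le> C" if xy: "adj x y" for x y
  proof (cases "p \<in> hs x y")
    case True
    then have "p \<notin> hs y x" using hs_complement [OF xy] by blast
    then show ?thesis using desc [OF adj_sym [OF xy]] by (simp add: dist_commute)
  next
    case False
    then show ?thesis using desc [OF xy] by simp
  qed
  have path: "dist (F x) (F y) \<le> C * card (sep x y)" if x: "x \<in> verts" and y: "y \<in> verts" for x y
    using x
  proof (induction "card (sep x y)" arbitrary: x)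
    case 0
    then have "x = y" using sep_nonempty [OF 0(2) y] finite_sep [OF 0(2) y] by auto
    then show ?case by simp
  next
    case (Suc k)
    then have "x \<noteq> y" by auto
    then obtain z where z: "adj x z" "y \<notin> hs x z" using descending_neighbour [OF Suc(3) y] by blast
    have k: "card (sep x y) = Suc (card (sep z y))" using card_sep_step [OF z(1) y z(2)] .
    have "dist (F z) (F y) \<le> C * card (sep z y)" using Suc(1) [of z] Suc(2) k adj_verts z by simp
    then show ?case using dist_triangle [of "F x" "F y" "F z"] step [OF z(1)] k by (simp add: algebra_simps)
  qed
  show ?thesis
  proof (rule that [of "C * real N" F])
    show "0 \<le> C * real N" using C0 by simp
    fix x y assume x: "x \<in> verts" and y: "y \<in> verts"
    have "C * card (sep x y) \<le> C * (real N * d x y)"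
      using card_sep_le [OF y x] C0 by (intro mult_left_mono) (simp_all add: d_commute)
    then show "dist (F x) (F y) \<le> C * real N * d x y" using path [OF x y] by (simp add: mult.assoc)
    show "sqrt (weight_sum (nat \<lceil>d x y / (2 * real N)\<rceil>)) \<le> dist (F x) (F y)"
      using wall_coord_lower [OF x y p] F [OF x y] by (intro real_le_lsqrt) simp_all
  qed
qed

section \<open>From vertices to arbitrary points\<close>

lemma vertex_near:
  assumes "x \<in> points K"
  obtains v where "v \<in> verts" "d x v \<le> real N"
proof -
  obtain c u where cu: "c \<in> cubes K" "u \<in> cube_of K c" "x = chart K c u" using assms by (rule pointsE)
  define w where "w = (\<lambda>i. if i < cdim K c then 0 else undefined :: real)"
  have w: "corner c w" using cu by (auto simp: corner_def w_def cube_of_def unit_cube_def PiE_iff extensional_def)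
  have "cd c u w \<le> (\<Sum>i<cdim K c. \<bar>u i - w i\<bar>)"
    unfolding cube_dist_def by (rule L2_set_le_sum_abs)
  also have "\<dots> \<le> (\<Sum>i<cdim K c. 1)"
    using cube_mem [OF cu(2)] by (intro sum_mono) (simp add: w_def)
  also have "\<dots> \<le> real N" using dim_le [OF cu(1)] by simp
  finally have "cd c u w \<le> real N" .
  moreover have "w \<in> cube_of K c" using w by (simp add: corner_def)
  ultimately have "d x (chart K c w) \<le> real N"
    using d_le_cd [OF cu(1,2)] cu(3) by (metis order_trans)
  then show ?thesis using that [of "chart K c w"] w by simp
qed

text \<open>Each point takes the image of a vertex within distance \<open>N\<close>. The map need
  not be continuous, but distances in the complex change by at most
  \<open>2 * real N\<close>.\<close>

lemma point_embedding:
  assumes N: "1 \<le> N"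
  obtains f :: "'a \<Rightarrow> 'a ell2" and C :: real where "0 \<le> C"
    "\<And>x y. x \<in> points K \<Longrightarrow> y \<in> points K \<Longrightarrow> dist (f x) (f y) \<le> C * (d x y + 2 * real N)"
    "\<And>x y. x \<in> points K \<Longrightarrow> y \<in> points K \<Longrightarrow>
      sqrt (weight_sum (nat \<lceil>(d x y - 2 * real N) / (2 * real N)\<rceil>)) \<le> dist (f x) (f y)"
proof (cases "points K = {}")
  case True
  show ?thesis by (rule that [of 0 "\<lambda>_. 0"]) (simp_all add: True)
next
  case False
  then obtain p where p: "p \<in> verts" using vertex_near by blast
  obtain F :: "'a \<Rightarrow> 'a ell2" and C :: real where C: "0 \<le> C"
    and up: "\<And>x y. x \<in> verts \<Longrightarrow> y \<in> verts \<Longrightarrow> dist (F x) (F y) \<le> C * d x y"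
    and lo: "\<And>x y. x \<in> verts \<Longrightarrow> y \<in> verts \<Longrightarrow> sqrt (weight_sum (nat \<lceil>d x y / (2 * real N)\<rceil>)) \<le> dist (F x) (F y)"
    using vertex_embedding [OF p] by metis
  define v where "v x = (SOME v. v \<in> verts \<and> d x v \<le> real N)" for x
  have v: "v x \<in> verts" "d x (v x) \<le> real N" if "x \<in> points K" for x
    using someI_ex [of "\<lambda>v. v \<in> verts \<and> d x v \<le> real N"] vertex_near [OF that] unfolding v_def by blast+
  have near: "\<bar>d (v x) (v y) - d x y\<bar> \<le> 2 * real N" if x: "x \<in> points K" and y: "y \<in> points K" for x y
  proof -
    have vp: "v x \<in> points K" "v y \<in> points K" using v x y verts_points by blast+
    have "d (v x) (v y) \<le> d (v x) x + d x (v y)" "d x (v y) \<le> d x y + d y (v y)"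
      "d x y \<le> d x (v x) + d (v x) y" "d (v x) y \<le> d (v x) (v y) + d (v y) y"
      using d_triangle x y vp by blast+
    then show ?thesis using v(2) [OF x] v(2) [OF y] d_commute [of x "v x"] d_commute [of y "v y"] by linarith
  qed
  show ?thesis
  proof (rule that [of C "\<lambda>x. F (v x)"])
    fix x y assume x: "x \<in> points K" and y: "y \<in> points K"
    have "C * d (v x) (v y) \<le> C * (d x y + 2 * real N)"
      using near [OF x y] C by (intro mult_left_mono) auto
    then show "dist (F (v x)) (F (v y)) \<le> C * (d x y + 2 * real N)"
      using up [OF v(1) [OF x] v(1) [OF y]] by linarith
    have "(d x y - 2 * real N) / (2 * real N) \<le> d (v x) (v y) / (2 * real N)"
      using near [OF x y] N by (intro divide_right_mono) auto
    then have "weight_sum (nat \<lceil>(d x y - 2 * real N) / (2 * real N)\<rceil>) \<le> weight_sum (nat \<lceil>d (v x) (v y) / (2 * real N)\<rceil>)"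
      by (intro weight_sum_mono nat_mono ceiling_mono)
    then show "sqrt (weight_sum (nat \<lceil>(d x y - 2 * real N) / (2 * real N)\<rceil>)) \<le> dist (F (v x)) (F (v y))"
      using lo [OF v(1) [OF x] v(1) [OF y]] real_sqrt_le_mono order_trans by blast
  qed (rule C)
qed

end

theorem theorem4p1:
  fixes K :: "('c, 'a) cube_complex"
  assumes "CAT0_cubical_complex K"
    and "finite_dimensional_complex K"
    and "locally_finite_complex K"
  shows "\<exists>f :: 'a \<Rightarrow> 'a ell2.
    uniform_embedding (points K) (intrinsic_dist K) f \<and>
    (\<lambda>t. ereal (t / (sqrt (ln t) * ln (ln t)))) \<preceq> compression (points K) (intrinsic_dist K) f"
proof -
  obtain N0 where N0: "\<And>c. c \<in> cubes K \<Longrightarrow> cdim K c \<le> N0"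
    using assms(2) unfolding finite_dimensional_complex_def by blast
  \<comment> \<open>The successor keeps \<open>N\<close> positive for complexes of dimension 0,
    since \<open>N\<close> occurs as a divisor.\<close>
  define N where "N = Suc N0"
  have dim: "cdim K c \<le> N" if "c \<in> cubes K" for c using N0 [OF that] by (simp add: N_def)
  have N1: "1 \<le> N" by (simp add: N_def)
  interpret cat0_cubes K N
    using assms(1) dim by unfold_locales
  have N: "1 \<le> N" "1 \<le> real N" using N1 by simp_all
  obtain f :: "'a \<Rightarrow> 'a ell2" and C :: real where C: "0 \<le> C"
    and up: "\<And>x y. x \<in> points K \<Longrightarrow> y \<in> points K \<Longrightarrow> dist (f x) (f y) \<le> C * (d x y + 2 * real N)"
    and lo: "\<And>x y. x \<in> points K \<Longrightarrow> y \<in> points K \<Longrightarrow>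
      sqrt (weight_sum (nat \<lceil>(d x y - 2 * real N) / (2 * real N)\<rceil>)) \<le> dist (f x) (f y)"
    using point_embedding [OF N1] by metis
  define \<rho> where "\<rho> t = sqrt (weight_sum (nat \<lceil>(t - 2 * real N) / (2 * real N)\<rceil>))" for t
  have mono: "\<rho> s \<le> \<rho> t" if "s \<le> t" for s t
    unfolding \<rho>_def using that N
    by (intro real_sqrt_le_mono weight_sum_mono nat_mono ceiling_mono divide_right_mono) auto
  have "filterlim \<rho> at_top at_top"
    unfolding filterlim_at_top
  proof
    fix Z
    define c where "c = (weight 1)\<^sup>2"
    have c: "0 < c" using weight_one_pos by (simp add: c_def)
    show "\<forall>\<^sub>F t in at_top. Z \<le> \<rho> t"
    proof (rule eventually_at_top_linorderI)
      \<comment> \<open>The threshold solves (t - 2 N) / (2 N) = Z^2 / c for \<open>t\<close>, so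
        that the linear bound on \<open>weight_sum\<close> reaches Z^2.\<close>
      fix t assume "2 * real N + 2 * real N * (Z\<^sup>2 / c) \<le> t"
      then have "Z\<^sup>2 / c \<le> (t - 2 * real N) / (2 * real N)" using N by (simp add: field_simps)
      then have "Z\<^sup>2 / c \<le> real (nat \<lceil>(t - 2 * real N) / (2 * real N)\<rceil>)"
        using real_nat_ceiling_ge order_trans by blast
      then have "Z\<^sup>2 \<le> real (nat \<lceil>(t - 2 * real N) / (2 * real N)\<rceil>) * c" using c by (simp add: field_simps)
      then have "Z\<^sup>2 \<le> weight_sum (nat \<lceil>(t - 2 * real N) / (2 * real N)\<rceil>)"
        using weight_sum_ge_linear unfolding c_def by (rule order_trans)
      then show "Z \<le> \<rho> t" unfolding \<rho>_def by (rule real_le_rsqrt)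
    qed
  qed
  moreover have "\<rho> \<in> {0..} \<rightarrow> {0..}" unfolding \<rho>_def by (simp add: weight_sum_nonneg)
  moreover have "(\<lambda>t. C * (t + 2 * real N)) \<in> {0..} \<rightarrow> {0..}" using C by simp
  moreover have "mono_on {0..} \<rho>" using mono by (intro mono_onI)
  moreover have "mono_on {0..} (\<lambda>t. C * (t + 2 * real N))"
    using C by (intro mono_onI mult_left_mono) simp_all
  moreover have "\<forall>x\<in>points K. \<forall>y\<in>points K. \<rho> (d x y) \<le> dist (f x) (f y) \<and> dist (f x) (f y) \<le> C * (d x y + 2 * real N)"
    using up lo unfolding \<rho>_def by blast
  ultimately have emb: "uniform_embedding (points K) d f"
    unfolding uniform_embedding_def by (intro exI [of _ \<rho>] exI [of _ "\<lambda>t. C * (t + 2 * real N)"]) blast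
  define E where "E = sqrt ((8 * real N) ^ 3)"
  have E: "0 < E" using N by (simp add: E_def)
  have "ereal (t / (sqrt (ln t) * ln (ln t))) \<le> ereal E * compression (points K) d f t"
    if t: "4 * real N + 6 \<le> t" for t
  proof -
    let ?g = "t / (sqrt (ln t) * ln (ln t))"
    have "?g\<^sup>2 \<le> (8 * real N) ^ 3 * weight_sum (nat \<lceil>(t - 2 * real N) / (2 * real N)\<rceil>)"
      by (rule weight_sum_growth [OF N(1) t])
    then have "?g \<le> sqrt ((8 * real N) ^ 3 * weight_sum (nat \<lceil>(t - 2 * real N) / (2 * real N)\<rceil>))"
      by (rule real_le_rsqrt)
    then have "?g \<le> E * \<rho> t" by (simp add: E_def \<rho>_def real_sqrt_mult)
    moreover have "ereal (\<rho> t) \<le> compression (points K) d f t"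
      unfolding compression_def
    proof (rule INF_greatest, clarify)
      fix x y assume xy: "x \<in> points K" "y \<in> points K" "t \<le> d x y"
      have "\<rho> t \<le> dist (f x) (f y)"
        using mono [OF xy(3)] lo [OF xy(1,2)] unfolding \<rho>_def by linarith
      then show "ereal (\<rho> t) \<le> ereal (dist (f x) (f y))" by simp
    qed
    then have "ereal E * ereal (\<rho> t) \<le> ereal E * compression (points K) d f t"
      using E by (intro ereal_mult_left_mono) simp_all
    ultimately show ?thesis by (metis ereal_less_eq(3) order_trans times_ereal.simps(1))
  qed
  then have "(\<lambda>t. ereal (t / (sqrt (ln t) * ln (ln t)))) \<preceq> compression (points K) d f"
    unfolding asymp_le_def using E by blast
  then show ?thesis using emb by blast
qed

end
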